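(* Let $\Omega\subset\mathbb{R}^n$ be a bounded open set, $p>1$, $T>0$, $m$ a positive integer, $\Omega_T=\Omega\times(0,T)$. Let $\Phi=(\Phi^1,\dots,\Phi^m)\colon\mathbb{R}^m\to\mathbb{R}^m$ and $f(x,t,v,\lambda)\colon\Omega_T\times\mathbb{R}^m\times\mathbb{R}^{mn}\to\mathbb{R}$ be such that $\Phi(v)\in L^1(\Omega_T,\mathbb{R}^m)$ and $f(x,t,v,Dv)\in L^1(\Omega_T)$ for each $v\in V_p(\Omega_T,m)$, and let $u_0\in L^1(\Omega,\mathbb{R}^m)$. Suppose that $f$ is $C^1$ in $v$ and $\lambda$ and that $$|f(x,t,v,\lambda)|+|f_v(x,t,v,\lambda)|+|f_\lambda(x,t,v,\lambda)|\le C(1+|v|^p+|\lambda|^p)$$ for some constant $C$. If $u\in V_p^0(\Omega_T,m)$ is a parabolic-minimum of the functional $F(v,\Omega_T)=\int_{\Omega_T}f(x,t,v,Dv)\,dx\,dt$, $v\in V_p(\Omega_T,m)$, with respect to $(\Phi,u_0)$, then $u$ is a weak solution of the initial-boundary value problem: $\Phi(u)\in L^1(\Omega_T,\mathbb{R}^m)$, and for $i=1,2,\dots,m$, $$\frac{\partial\Phi^i(u)}{\partial t}-\frac{\partial}{\partial x_\alpha}\left(f_{\lambda^i_\alpha}(x,t,u,Du)\right)+f_{u^i}(x,t,u,Du)=0\quad\text{in }\Omega_T,$$ $$u=0\quad\text{on }\partial\Omega\times(0,T),\qquad\Phi(u(x,0))=u_0(x),$$ where summation over $\alpha=1,\dots,n$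 is understood.
   Context: Notation: $V_p(\Omega_T,m)=L^p([0,T],W^{1,p}(\Omega,\mathbb{R}^m))$, $V_p^0(\Omega_T,m)=L^p([0,T],W^{1,p}_0(\Omega,\mathbb{R}^m))$, and $Du=\nabla u=\left(\frac{\partial u^i}{\partial x_j}\right)$, $1\le i\le m$, $1\le j\le n$, is the spatial gradient. $f_{u^i}$ denotes the partial derivative of $f$ in the $i$-th component of its third argument $v$, and $f_{\lambda^i_\alpha}$ the partial derivative in the $(i,\alpha)$ entry of $\lambda$. Parabolic-minimum: $u\in V_p(\Omega_T,m)$ is a parabolic-minimum of $F$ with respect to the function couple $(\Phi,u_0)$ if for all $\eta\in C^\infty([0,T],C_0^\infty(\Omega,\mathbb{R}^m))$ with $\eta(\cdot,T)=0$, $$-\int_{\Omega_T}\Phi(u)\cdot\frac{\partial\eta}{\partial t}\,dx\,dt+F(u,\Omega_T)\le F(u-\eta,\Omega_T)+\int_\Omega u_0(x)\cdot\eta(x,0)\,dx.$$ Weak solution: $u\in V_p^0(\Omega_T,m)$ with $\Phi(u)\in L^1(\Omega_T,\mathbb{R}^m)$ is a weak solution of the initial-boundary value problem $$\frac{\partial\Phi^i(u)}{\partial t}-\frac{\partial}{\partial x_\alpha}\left(f_{\lambda^i_\alpha}(x,t,u,Du)\right)+f_{u^i}(x,t,u,Du)=0\quad\text{in }\Omega_T,\quad i=1,2,\dots,m,$$ $$u=0\quad\text{on }\partial\Omega\times(0,T),\qquad\Phi(u(x,0))=u_0(x),$$ if for all $\eta\in C^\infty([0,T],C_0^\infty(\Omega,\mathbb{R}^m))$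 with $\eta(\cdot,T)=0$, $$-\int_{\Omega_T}\Phi(u)\cdot\frac{\partial\eta}{\partial t}\,dx\,dt+\int_{\Omega_T}\left(f_{\lambda^i_\alpha}(x,t,u,Du)\frac{\partial\eta^i}{\partial x_\alpha}+f_{u^i}(x,t,u,Du)\,\eta^i\right)dx\,dt=\int_\Omega u_0(x)\cdot\eta(x,0)\,dx,$$ with summation over repeated indices $i,\alpha$. *)

theory Defs
  imports "HOL-Analysis.Analysis"
begin

section \<open>Test functions and test curves\<close>

fun iter_deriv :: "'a::euclidean_space list \<Rightarrow> ('a \<Rightarrow> 'b::euclidean_space) \<Rightarrow> 'a \<Rightarrow> 'b" where
  "iter_deriv [] \<phi> = \<phi>"
| "iter_deriv (h # hs) \<phi> = iter_deriv hs (\<lambda>x. frechet_derivative \<phi> (at x) h)"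

definition smooth :: "('a::euclidean_space \<Rightarrow> 'b::euclidean_space) \<Rightarrow> bool" where
  "smooth \<phi> \<longleftrightarrow> (\<forall>hs x. iter_deriv hs \<phi> differentiable (at x))"

text \<open>The space \<open>C\<^sub>0\<^sup>\<infinity>(\<Omega>)\<close>; its elements are extended by 0 to the whole space.\<close>

definition test_functions ::
    "'a::euclidean_space set \<Rightarrow> ('a \<Rightarrow> 'b::euclidean_space) set" where
  "test_functions \<Omega> =
     {\<phi>. smooth \<phi> \<and> (\<exists>K. compact K \<and> K \<subseteq> \<Omega> \<and> (\<forall>x. x \<notin> K \<longrightarrow> \<phi> x = 0))}"

text \<open>Convergence in the usual topology of \<open>C\<^sub>0\<^sup>\<infinity>(\<Omega>)\<close>: supports in a common compact subset of
  \<open>\<Omega>\<close>, and uniform convergence of every iterated derivative.  For filters with a countable base,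
  such as the ones used below, this is convergence in the inductive limit topology.\<close>

definition test_limit ::
    "'a::euclidean_space set \<Rightarrow> ('s \<Rightarrow> 'a \<Rightarrow> 'b::euclidean_space) \<Rightarrow> ('a \<Rightarrow> 'b) \<Rightarrow> 's filter \<Rightarrow> bool" where
  "test_limit \<Omega> \<phi> \<psi> F \<longleftrightarrow>
     (\<exists>K. compact K \<and> K \<subseteq> \<Omega> \<and> (\<forall>\<^sub>F s in F. \<forall>x. x \<notin> K \<longrightarrow> \<phi> s x = 0) \<and>
          (\<forall>x. x \<notin> K \<longrightarrow> \<psi> x = 0)) \<and>
     (\<forall>hs. uniform_limit UNIV (\<lambda>s. iter_deriv hs (\<phi> s)) (iter_deriv hs \<psi>) F)"

text \<open>The space \<open>C\<^sup>\<infinity>([0,T], C\<^sub>0\<^sup>\<infinity>(\<Omega>))\<close> of smooth curves in \<open>C\<^sub>0\<^sup>\<infinity>(\<Omega>)\<close>: \<open>H k\<close> is the \<open>k\<close>-th time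
  derivative, one-sided at \<open>t = 0\<close> and \<open>t = T\<close>.  Values outside \<open>[0,T]\<close> are irrelevant.\<close>

definition smooth_test_curves ::
    "'a::euclidean_space set \<Rightarrow> real \<Rightarrow> (real \<Rightarrow> 'a \<Rightarrow> 'b::euclidean_space) set" where
  "smooth_test_curves \<Omega> T =
     {\<eta>. \<exists>H :: nat \<Rightarrow> real \<Rightarrow> 'a \<Rightarrow> 'b.
        (\<forall>t\<in>{0..T}. H 0 t = \<eta> t) \<and>
        (\<forall>k. \<forall>t\<in>{0..T}.
           H k t \<in> test_functions \<Omega> \<and>
           test_limit \<Omega> (\<lambda>s x. (H k s x - H k t x) /\<^sub>R (s - t)) (H (Suc k) t) (at t within {0..T}))}"


section \<open>Sobolev spaces\<close>

text \<open>A gradient of an \<open>\<real>\<^sup>m\<close>-valued function is an \<open>m \<times> n\<close> matrix; \<open>G x $ i $ \<alpha>\<close> is the derivative of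
  the component \<open>i\<close> in the direction \<open>\<alpha>\<close>.  The norm of \<open>real^'n^'m\<close> is the Euclidean
  (Frobenius) norm.\<close>

definition locally_integrable ::
    "'a::euclidean_space set \<Rightarrow> ('a \<Rightarrow> 'b::euclidean_space) \<Rightarrow> bool" where
  "locally_integrable \<Omega> w \<longleftrightarrow> (\<forall>K. compact K \<and> K \<subseteq> \<Omega> \<longrightarrow> integrable (lebesgue_on K) w)"

definition is_weak_gradient ::
    "(real^'n) set \<Rightarrow> (real^'n \<Rightarrow> real^'m) \<Rightarrow> (real^'n \<Rightarrow> real^'n^'m) \<Rightarrow> bool" where
  "is_weak_gradient \<Omega> w G \<longleftrightarrow>
     locally_integrable \<Omega> w \<and> locally_integrable \<Omega> G \<and>
     (\<forall>\<phi> \<in> test_functions \<Omega>. \<forall>i \<alpha>.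
        (\<integral>x. w x $ i * frechet_derivative \<phi> (at x) (axis \<alpha> 1) \<partial>lebesgue_on \<Omega>) =
        - (\<integral>x. G x $ i $ \<alpha> * \<phi> x \<partial>lebesgue_on \<Omega>))"

definition weak_gradient ::
    "(real^'n) set \<Rightarrow> (real^'n \<Rightarrow> real^'m) \<Rightarrow> real^'n \<Rightarrow> real^'n^'m" where
  "weak_gradient \<Omega> w = (SOME G. is_weak_gradient \<Omega> w G)"

definition Lp :: "real \<Rightarrow> 'a::euclidean_space set \<Rightarrow> ('a \<Rightarrow> 'b::euclidean_space) set" where
  "Lp p \<Omega> = {w. w \<in> borel_measurable (lebesgue_on \<Omega>) \<and>
                integrable (lebesgue_on \<Omega>) (\<lambda>x. norm (w x) powr p)}"

definition W1p :: "real \<Rightarrow> (real^'n) set \<Rightarrow> (real^'n \<Rightarrow> real^'m) set" where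
  "W1p p \<Omega> = {w \<in> Lp p \<Omega>. \<exists>G \<in> Lp p \<Omega>. is_weak_gradient \<Omega> w G}"

definition W1p_norm :: "real \<Rightarrow> (real^'n) set \<Rightarrow> (real^'n \<Rightarrow> real^'m) \<Rightarrow> real" where
  "W1p_norm p \<Omega> w =
     ((\<integral>x. norm (w x) powr p \<partial>lebesgue_on \<Omega>) +
      (\<integral>x. norm (weak_gradient \<Omega> w x) powr p \<partial>lebesgue_on \<Omega>)) powr (1 / p)"

text \<open>\<open>W\<^sub>0\<^sup>1\<^sup>,\<^sup>p(\<Omega>)\<close> is the closure of \<open>C\<^sub>0\<^sup>\<infinity>(\<Omega>)\<close> in \<open>W\<^sup>1\<^sup>,\<^sup>p(\<Omega>)\<close>.\<close>

definition W1p0 :: "real \<Rightarrow> (real^'n) set \<Rightarrow> (real^'n \<Rightarrow> real^'m) set" where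
  "W1p0 p \<Omega> = {w \<in> W1p p \<Omega>. \<exists>\<phi> :: nat \<Rightarrow> real^'n \<Rightarrow> real^'m.
      (\<forall>k. \<phi> k \<in> test_functions \<Omega>) \<and> (\<lambda>k. W1p_norm p \<Omega> (\<lambda>x. \<phi> k x - w x)) \<longlonglongrightarrow> 0}"


section \<open>Bochner spaces\<close>

text \<open>\<open>L\<^sup>p([0,T], X)\<close> for a space \<open>X\<close> of functions with norm \<open>N\<close>: strongly measurable curves
  (almost everywhere limits, in the norm \<open>N\<close>, of measurable curves with finitely many values)
  whose norm is in \<open>L\<^sup>p([0,T])\<close>.\<close>

definition bochner_Lp ::
    "real \<Rightarrow> real \<Rightarrow> ('a \<Rightarrow> 'b::real_vector) set \<Rightarrow> (('a \<Rightarrow> 'b) \<Rightarrow> real) \<Rightarrow> (real \<Rightarrow> 'a \<Rightarrow> 'b) set" where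
  "bochner_Lp p T X N =
     {u. (AE t in lebesgue_on {0..T}. u t \<in> X) \<and>
         (\<exists>s :: nat \<Rightarrow> real \<Rightarrow> 'a \<Rightarrow> 'b.
            (\<forall>k. finite (s k ` {0..T}) \<and> s k ` {0..T} \<subseteq> X \<and>
                 (\<forall>w. {t \<in> {0..T}. s k t = w} \<in> sets lebesgue)) \<and>
            (AE t in lebesgue_on {0..T}. (\<lambda>k. N (\<lambda>x. s k t x - u t x)) \<longlonglongrightarrow> 0)) \<and>
         integrable (lebesgue_on {0..T}) (\<lambda>t. N (u t) powr p)}"

text \<open>The cylinder \<open>\<Omega>\<^sub>T = \<Omega> \<times> (0,T)\<close> with Lebesgue measure.\<close>

abbreviation cyl :: "(real^'n) set \<Rightarrow> real \<Rightarrow> ((real^'n) \<times> real) measure" where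
  "cyl \<Omega> T \<equiv> lebesgue_on (\<Omega> \<times> {0<..<T})"

definition is_spatial_gradient ::
    "(real^'n) set \<Rightarrow> real \<Rightarrow> (real \<Rightarrow> real^'n \<Rightarrow> real^'m) \<Rightarrow> (real \<Rightarrow> real^'n \<Rightarrow> real^'n^'m) \<Rightarrow> bool" where
  "is_spatial_gradient \<Omega> T u G \<longleftrightarrow>
     (\<lambda>(x, t). G t x) \<in> borel_measurable (cyl \<Omega> T) \<and>
     (AE t in lebesgue_on {0<..<T}. is_weak_gradient \<Omega> (u t) (G t))"

text \<open>The spatial gradient \<open>Du\<close>, unique up to a null set of the cylinder.\<close>

definition spatial_gradient ::
    "(real^'n) set \<Rightarrow> real \<Rightarrow> (real \<Rightarrow> real^'n \<Rightarrow> real^'m) \<Rightarrow> real \<Rightarrow> real^'n \<Rightarrow> real^'n^'m" where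
  "spatial_gradient \<Omega> T u = (SOME G. is_spatial_gradient \<Omega> T u G)"

text \<open>A curve \<open>t \<mapsto> u(t)\<close> into a space of functions modulo null sets becomes a function on the cylinder
  only after representatives are chosen.  Choosing them separately for each \<open>t\<close> can destroy
  measurability in \<open>(x,t)\<close>.  Every element of \<open>L\<^sup>p([0,T], W\<^sup>1\<^sup>,\<^sup>p(\<Omega>))\<close> has representatives of
  itself and of its gradient that are jointly measurable; the following set fixes them so.\<close>

definition joint_repr :: "(real^'n) set \<Rightarrow> real \<Rightarrow> (real \<Rightarrow> real^'n \<Rightarrow> real^'m) set" where
  "joint_repr \<Omega> T = {u. (\<lambda>(x, t). u t x) \<in> borel_measurable (cyl \<Omega> T) \<and>
                         (\<exists>G. is_spatial_gradient \<Omega> T u G)}"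

definition Vp :: "real \<Rightarrow> (real^'n) set \<Rightarrow> real \<Rightarrow> (real \<Rightarrow> real^'n \<Rightarrow> real^'m) set" where
  "Vp p \<Omega> T = bochner_Lp p T (W1p p \<Omega>) (W1p_norm p \<Omega>) \<inter> joint_repr \<Omega> T"

definition Vp0 :: "real \<Rightarrow> (real^'n) set \<Rightarrow> real \<Rightarrow> (real \<Rightarrow> real^'n \<Rightarrow> real^'m) set" where
  "Vp0 p \<Omega> T = bochner_Lp p T (W1p0 p \<Omega>) (W1p_norm p \<Omega>) \<inter> joint_repr \<Omega> T"


section \<open>The integrand and its derivatives\<close>

type_synonym ('n, 'm) integrand = "real^'n \<Rightarrow> real \<Rightarrow> real^'m \<Rightarrow> real^'n^'m \<Rightarrow> real"

definition f_v :: "('n::finite, 'm::finite) integrand \<Rightarrow> real^'n \<Rightarrow> real \<Rightarrow> real^'m \<Rightarrow> real^'n^'m \<Rightarrow> real^'m" where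
  "f_v f x t v \<Lambda> = (\<chi> i. frechet_derivative (\<lambda>w. f x t w \<Lambda>) (at v) (axis i 1))"

definition f_lam :: "('n::finite, 'm::finite) integrand \<Rightarrow> real^'n \<Rightarrow> real \<Rightarrow> real^'m \<Rightarrow> real^'n^'m \<Rightarrow> real^'n^'m" where
  "f_lam f x t v \<Lambda> = (\<chi> i \<alpha>. frechet_derivative (\<lambda>M. f x t v M) (at \<Lambda>) (axis i (axis \<alpha> 1)))"

definition C1_fun :: "('a::euclidean_space \<Rightarrow> 'b::euclidean_space) \<Rightarrow> bool" where
  "C1_fun g \<longleftrightarrow> (\<forall>z. g differentiable (at z)) \<and>
                 (\<forall>h. continuous_on UNIV (\<lambda>z. frechet_derivative g (at z) h))"

definition energy ::
    "('n::finite, 'm::finite) integrand \<Rightarrow> (real^'n) set \<Rightarrow> real \<Rightarrow> (real \<Rightarrow> real^'n \<Rightarrow> real^'m) \<Rightarrow> real" where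
  "energy f \<Omega> T v = (\<integral>(x, t). f x t (v t x) (spatial_gradient \<Omega> T v t x) \<partial>cyl \<Omega> T)"


section \<open>Parabolic minima and weak solutions\<close>

definition parabolic_minimum ::
    "real \<Rightarrow> (real^'n) set \<Rightarrow> real \<Rightarrow> ((real \<Rightarrow> real^'n \<Rightarrow> real^'m) \<Rightarrow> real) \<Rightarrow>
     (real^'m \<Rightarrow> real^'m) \<Rightarrow> (real^'n \<Rightarrow> real^'m) \<Rightarrow> (real \<Rightarrow> real^'n \<Rightarrow> real^'m) \<Rightarrow> bool" where
  "parabolic_minimum p \<Omega> T F \<Phi> u0 u \<longleftrightarrow>
     u \<in> Vp p \<Omega> T \<and>
     (\<forall>\<eta> \<in> smooth_test_curves \<Omega> T. (\<forall>x. \<eta> T x = 0) \<longrightarrow>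
        - (\<integral>(x, t). \<Phi> (u t x) \<bullet> vector_derivative (\<lambda>s. \<eta> s x) (at t) \<partial>cyl \<Omega> T) + F u
        \<le> F (\<lambda>t x. u t x - \<eta> t x) + (\<integral>x. u0 x \<bullet> \<eta> 0 x \<partial>lebesgue_on \<Omega>))"

text \<open>Weak solutions of the initial-boundary value problem
  \<open>\<partial>\<^sub>t \<Phi>\<^sup>i(u) - \<partial>\<^sub>\<alpha> (f\<^sub>\<lambda>(x,t,u,Du))\<^sup>i\<^sub>\<alpha> + (f\<^sub>v(x,t,u,Du))\<^sup>i = 0\<close> in the cylinder, \<open>u = 0\<close> on
  \<open>\<partial>\<Omega> \<times> (0,T)\<close>, \<open>\<Phi>(u(x,0)) = u\<^sub>0(x)\<close>.  Lebesgue integrals of non-integrable functions are 0 in this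
  library, so integrability of the second integrand is demanded explicitly; that of the other two
  follows from \<open>\<Phi>(u)\<close>, \<open>u\<^sub>0\<close> being in \<open>L\<^sup>1\<close>.\<close>

definition weak_solution ::
    "real \<Rightarrow> (real^'n) set \<Rightarrow> real \<Rightarrow> ('n::finite, 'm::finite) integrand \<Rightarrow>
     (real^'m \<Rightarrow> real^'m) \<Rightarrow> (real^'n \<Rightarrow> real^'m) \<Rightarrow> (real \<Rightarrow> real^'n \<Rightarrow> real^'m) \<Rightarrow> bool" where
  "weak_solution p \<Omega> T f \<Phi> u0 u \<longleftrightarrow>
     u \<in> Vp0 p \<Omega> T \<and>
     integrable (cyl \<Omega> T) (\<lambda>(x, t). \<Phi> (u t x)) \<and>
     (\<forall>\<eta> \<in> smooth_test_curves \<Omega> T. (\<forall>x. \<eta> T x = 0) \<longrightarrow>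
        (let Du = spatial_gradient \<Omega> T u;
             g = (\<lambda>(x, t).
               (\<Sum>i\<in>UNIV. \<Sum>\<alpha>\<in>UNIV. f_lam f x t (u t x) (Du t x) $ i $ \<alpha> *
                                 frechet_derivative (\<eta> t) (at x) (axis \<alpha> 1) $ i) +
               (\<Sum>i\<in>UNIV. f_v f x t (u t x) (Du t x) $ i * \<eta> t x $ i))
         in integrable (cyl \<Omega> T) g \<and>
            - (\<integral>(x, t). \<Phi> (u t x) \<bullet> vector_derivative (\<lambda>s. \<eta> s x) (at t) \<partial>cyl \<Omega> T) +
              (\<integral>z. g z \<partial>cyl \<Omega> T) =
            (\<integral>x. u0 x \<bullet> \<eta> 0 x \<partial>lebesgue_on \<Omega>)))"

end

theory Submission
  imports Defs
begin

text \<open>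
  For a test curve \<open>\<eta>\<close> and a real \<open>\<epsilon>\<close>, comparing \<open>u\<close> with \<open>u - \<epsilon>\<eta>\<close> in the minimality condition gives
  \<open>F(u) - F(u - \<epsilon>\<eta>) \<le> \<epsilon> (\<integral>\<Phi>(u) \<cdot> \<partial>\<^sub>t\<eta> + \<integral>u\<^sub>0 \<cdot> \<eta>(\<cdot>,0))\<close>.  Dividing by \<open>\<epsilon>\<close> and letting \<open>\<epsilon>\<close> tend to
  \<open>0\<close> from both sides yields the weak equation: the difference quotients of the integrand converge
  pointwise to \<open>f\<^sub>\<lambda> : D\<eta> + f\<^sub>v \<cdot> \<eta>\<close> and, by the mean value theorem and the growth condition, are
  dominated by a multiple of \<open>1 + |u|\<^sup>p + |Du|\<^sup>p\<close>.  No measurability of \<open>f\<close> in \<open>(x,t)\<close> is assumed;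
  measurability of the quotients, and hence of their limit, comes from integrability of
  \<open>f(x,t,v,Dv)\<close> for the competitors \<open>v = u - \<epsilon>\<eta>\<close>.  This requires \<open>v\<close> to be in \<open>V\<^sub>p\<close> and
  \<open>Dv = Du - \<epsilon> D\<eta>\<close> almost everywhere, the latter because weak gradients are unique.
\<close>

section \<open>Smooth functions approximating indicators of boxes\<close>

text \<open>\<open>spatial_gradient\<close> is a choice, so integrability of \<open>f\<close> along
  a competitor \<open>v\<close> speaks only of the chosen \<open>Dv\<close>. Its agreement with the
  explicit matrix \<open>Du - \<epsilon> D\<eta>\<close> is shown on almost every time slice and
  then lifted to the cylinder by Fubini; the lift works because both gradients are jointly
  measurable. Uniqueness on a slice rests on the fundamental lemma of the calculus of variations,
  which needs a supply of test functions: products of one-dimensional functions built from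
  exp(-1/s), whose smoothness is proved through a class closed under differentiation. Lebesgue
  measure on a product is the completion of the product of the factors, so every use of Fubini
  passes through Borel sets or Borel representatives. The competitor must also be a strongly
  measurable curve in W^{1,p}; this is settled by freezing \<open>\<eta>\<close> on a time grid. The
  estimates compare \<open>p\<close>-th powers of norms with the constant \<open>2 powr p\<close>,
  which suffices for integrability and for convergence to 0.\<close>

lemma smooth_differentiable: "smooth \<phi> \<Longrightarrow> \<phi> differentiable (at x)"
  unfolding smooth_def by (metis iter_deriv.simps(1))

lemma smooth_derivative: "smooth \<phi> \<Longrightarrow> smooth (\<lambda>x. frechet_derivative \<phi> (at x) h)"
  unfolding smooth_def by (metis iter_deriv.simps(2))

text \<open>Avoids Leibniz formulas for iterated derivatives of products.\<close>

lemma smooth_coinduct: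
  assumes "\<phi> \<in> S" "\<And>\<psi> x. \<psi> \<in> S \<Longrightarrow> \<psi> differentiable (at x)"
    and "\<And>\<psi> h. \<psi> \<in> S \<Longrightarrow> (\<lambda>x. frechet_derivative \<psi> (at x) h) \<in> S"
  shows "smooth \<phi>"
proof -
  have "iter_deriv hs \<psi> \<in> S" if "\<psi> \<in> S" for hs \<psi>
    using that by (induction hs arbitrary: \<psi>) (auto simp: assms(3))
  then show ?thesis
    unfolding smooth_def using assms by blast
qed

text \<open>The factor \<open>s\<^sup>-\<^sup>j\<close> makes the family closed under differentiation up to linear combinations.\<close>

definition flat_exp :: "nat \<Rightarrow> real \<Rightarrow> real" where
  "flat_exp j s = (if s > 0 then exp (- inverse s) * inverse s ^ j else 0)"

text \<open>From the right, \<open>inverse s\<close> tends to infinity and the exponential beats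
  every power; from the left the function is 0.\<close>

lemma flat_exp_tendsto_0: "(flat_exp j \<longlongrightarrow> 0) (at 0)"
proof -
  have "((\<lambda>s. inverse s ^ j / exp (inverse s)) \<longlongrightarrow> 0) (at_right (0::real))"
    by (rule filterlim_compose[OF tendsto_power_div_exp_0 filterlim_inverse_at_top_right])
  then have r: "(flat_exp j \<longlongrightarrow> 0) (at_right 0)"
    by (rule Lim_transform_eventually)
      (auto simp: eventually_at_filter flat_exp_def exp_minus divide_simps)
  have l: "(flat_exp j \<longlongrightarrow> 0) (at_left 0)"
    by (rule Lim_transform_eventually[OF tendsto_const]) (auto simp: eventually_at_filter flat_exp_def)
  show ?thesis
    using l r by (simp add: filterlim_split_at)
qed

lemma flat_exp_has_derivative:
  "(flat_exp j has_real_derivative (flat_exp (j + 2) s - real j * flat_exp (j + 1) s)) (at s)"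
proof (cases s "0::real" rule: linorder_cases)
  case less
  have "((\<lambda>s. 0) has_real_derivative 0) (at s)" by simp
  then have "(flat_exp j has_real_derivative 0) (at s)"
    by (rule has_field_derivative_transform_within_open[of _ _ _ "{..<0}"])
      (use less in \<open>auto simp: flat_exp_def\<close>)
  then show ?thesis using less by (simp add: flat_exp_def)
next
  case equal
  \<comment> \<open>As \<open>flat_exp j 0 = 0\<close>, the difference quotient at 0 is
    \<open>flat_exp (Suc j) h\<close> itself, so the previous limit is the derivative.\<close>
  have "((\<lambda>h. (flat_exp j h - flat_exp j 0) / h) \<longlongrightarrow> 0) (at 0)"
    by (rule Lim_transform_eventually[OF flat_exp_tendsto_0[of "Suc j"]])
      (auto simp: eventually_at_filter flat_exp_def divide_inverse)
  then show ?thesis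
    using equal by (auto simp: DERIV_def flat_exp_def)
next
  case greater
  have "((\<lambda>s. exp (- inverse s) * inverse s ^ j) has_real_derivative
     (flat_exp (j + 2) s - real j * flat_exp (j + 1) s)) (at s)"
  proof (cases j)
    case 0
    then show ?thesis using greater
      by (auto intro!: derivative_eq_intros simp: flat_exp_def power2_eq_square)
  next
    case (Suc i)
    with greater have "inverse s ^ i = inverse s * inverse s ^ (i - Suc 0) \<or> i = 0"
      by (metis One_nat_def Suc_pred bot_nat_0.not_eq_extremum power_Suc)
    with Suc show ?thesis using greater
      by (auto intro!: derivative_eq_intros simp: flat_exp_def power2_eq_square algebra_simps)
  qed
  then show ?thesis
    by (rule has_field_derivative_transform_within_open[of _ _ _ "{0<..}"])
      (use greater in \<open>auto simp: flat_exp_def\<close>)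
qed

text \<open>The set to be used in \<open>smooth_coinduct\<close>. Products are there because bumps
  on boxes are products over the coordinates; constants because the derivative of a generator
  carries the factors \<open>- real j\<close> and \<open>h \<bullet> b\<close>.\<close>

inductive_set flat_algebra :: "('a::euclidean_space \<Rightarrow> real) set" where
  const: "(\<lambda>x. c) \<in> flat_algebra"
| flat: "(\<lambda>x. flat_exp j (x \<bullet> b + d)) \<in> flat_algebra"
| add: "\<phi> \<in> flat_algebra \<Longrightarrow> \<psi> \<in> flat_algebra \<Longrightarrow> (\<lambda>x. \<phi> x + \<psi> x) \<in> flat_algebra"
| mult: "\<phi> \<in> flat_algebra \<Longrightarrow> \<psi> \<in> flat_algebra \<Longrightarrow> (\<lambda>x. \<phi> x * \<psi> x) \<in> flat_algebra"

text \<open>Exhibiting \<open>\<phi>'\<close> makes the induction go through: the product rule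
  combines the derivatives of both factors with the factors themselves, and all four lie in the
  algebra. For a generator, the chain rule yields \<open>flat_exp (j + 2)\<close> and
  \<open>flat_exp (j + 1)\<close> of the same affine form.\<close>

lemma flat_algebra_has_derivative:
  assumes "\<phi> \<in> flat_algebra"
  shows "\<exists>\<phi>'. (\<forall>x. (\<phi> has_derivative \<phi>' x) (at x)) \<and> (\<forall>h. (\<lambda>x. \<phi>' x h) \<in> flat_algebra)"
  using assms
proof induction
  case (const c)
  then show ?case
    by (intro exI[of _ "\<lambda>x h. 0"]) (auto intro: flat_algebra.const)
next
  case (flat j b d)
  let ?D = "\<lambda>x h. (flat_exp (j + 2) (x \<bullet> b + d) + - real j * flat_exp (j + 1) (x \<bullet> b + d)) * (h \<bullet> b)"
  have "((\<lambda>x. flat_exp j (x \<bullet> b + d)) has_derivative ?D x) (at x)" for x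
  proof -
    have "((\<lambda>x. x \<bullet> b + d) has_derivative (\<lambda>h. h \<bullet> b)) (at x)"
      by (auto intro!: derivative_eq_intros)
    from has_derivative_compose[OF this, OF flat_exp_has_derivative[unfolded has_field_derivative_def]]
    show ?thesis by (simp add: algebra_simps)
  qed
  moreover have "(\<lambda>x. ?D x h) \<in> flat_algebra" for h
    by (intro flat_algebra.intros)
  ultimately show ?case
    by (intro exI[of _ ?D]) simp
next
  case (add \<phi> \<psi>)
  obtain A where A: "(\<forall>x. (\<phi> has_derivative A x) (at x)) \<and> (\<forall>h. (\<lambda>x. A x h) \<in> flat_algebra)"
    using add.IH(1) ..
  obtain B where B: "(\<forall>x. (\<psi> has_derivative B x) (at x)) \<and> (\<forall>h. (\<lambda>x. B x h) \<in> flat_algebra)"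
    using add.IH(2) ..
  show ?case
  proof (intro exI[of _ "\<lambda>x h. A x h + B x h"] conjI allI)
    show "((\<lambda>x. \<phi> x + \<psi> x) has_derivative (\<lambda>h. A x h + B x h)) (at x)" for x
      using A B by (intro has_derivative_add) blast+
    show "(\<lambda>x. A x h + B x h) \<in> flat_algebra" for h
      by (rule flat_algebra.add) (use A B in blast)+
  qed
next
  case (mult \<phi> \<psi>)
  obtain A where A: "(\<forall>x. (\<phi> has_derivative A x) (at x)) \<and> (\<forall>h. (\<lambda>x. A x h) \<in> flat_algebra)"
    using mult.IH(1) ..
  obtain B where B: "(\<forall>x. (\<psi> has_derivative B x) (at x)) \<and> (\<forall>h. (\<lambda>x. B x h) \<in> flat_algebra)"
    using mult.IH(2) ..
  show ?case
  proof (intro exI[of _ "\<lambda>x h. \<phi> x * B x h + A x h * \<psi> x"] conjI allI)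
    show "((\<lambda>x. \<phi> x * \<psi> x) has_derivative (\<lambda>h. \<phi> x * B x h + A x h * \<psi> x)) (at x)" for x
      using A B by (intro has_derivative_mult) blast+
    show "(\<lambda>x. \<phi> x * B x h + A x h * \<psi> x) \<in> flat_algebra" for h
      by (rule flat_algebra.add; rule flat_algebra.mult) (use A B mult.hyps in blast)+
  qed
qed

lemma flat_algebra_smooth: "\<phi> \<in> flat_algebra \<Longrightarrow> smooth \<phi>"
proof (erule smooth_coinduct)
  fix \<psi> :: "'a \<Rightarrow> real" and x h assume "\<psi> \<in> flat_algebra"
  obtain D where "(\<forall>x. (\<psi> has_derivative D x) (at x)) \<and> (\<forall>h. (\<lambda>x. D x h) \<in> flat_algebra)"
    using flat_algebra_has_derivative[OF \<open>\<psi> \<in> flat_algebra\<close>] ..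
  then have D: "\<And>x. (\<psi> has_derivative D x) (at x)" "\<And>h. (\<lambda>x. D x h) \<in> flat_algebra" by blast+
  show "\<psi> differentiable (at x)"
    using D(1) by (auto simp: differentiable_def)
  have "frechet_derivative \<psi> (at x) = D x" for x
    using D(1) frechet_derivative_at by metis
  then show "(\<lambda>x. frechet_derivative \<psi> (at x) h) \<in> flat_algebra"
    using D(2) by simp
qed

lemma flat_algebra_prod:
  "finite I \<Longrightarrow> (\<And>i. i \<in> I \<Longrightarrow> \<phi> i \<in> flat_algebra) \<Longrightarrow> (\<lambda>x. \<Prod>i\<in>I. \<phi> i x) \<in> flat_algebra"
  by (induction I rule: finite_induct) (simp_all add: flat_algebra.const flat_algebra.mult)

text \<open>The arguments are \<open>k\<close> times \<open>x \<bullet> i - a \<bullet> i\<close>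
  and \<open>k\<close> times \<open>b \<bullet> i - x \<bullet> i\<close>, written so that they
  match the generators of \<open>flat_algebra\<close>. The factor \<open>k\<close> sharpens the
  edges, since exp(-1/(k s)) tends to 1 for every s > 0.\<close>

definition box_bump :: "'a::euclidean_space \<Rightarrow> 'a \<Rightarrow> nat \<Rightarrow> 'a \<Rightarrow> real" where
  "box_bump a b k x = (\<Prod>i\<in>Basis. flat_exp 0 (x \<bullet> (real k *\<^sub>R i) + real k * - (a \<bullet> i)) *
     flat_exp 0 (x \<bullet> (- real k *\<^sub>R i) + real k * (b \<bullet> i)))"

lemma smooth_box_bump: "smooth (box_bump a b k)"
  unfolding box_bump_def[abs_def]
  by (intro flat_algebra_smooth flat_algebra_prod flat_algebra.intros finite_Basis)

lemma flat_exp_0_bounds: "0 \<le> flat_exp 0 s" "flat_exp 0 s \<le> 1"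
  by (auto simp: flat_exp_def)

lemma box_bump_bounds: "0 \<le> box_bump a b k x" "box_bump a b k x \<le> 1"
  unfolding box_bump_def
  by (auto intro!: prod_nonneg prod_le_1 mult_le_one simp: flat_exp_0_bounds)

lemma box_bump_outside: "x \<notin> cbox a b \<Longrightarrow> box_bump a b k x = 0"
proof -
  assume "x \<notin> cbox a b"
  then obtain i where i: "i \<in> Basis" "x \<bullet> i < a \<bullet> i \<or> b \<bullet> i < x \<bullet> i"
    by (auto simp: mem_box not_le)
  then have "flat_exp 0 (x \<bullet> (real k *\<^sub>R i) + real k * - (a \<bullet> i)) *
     flat_exp 0 (x \<bullet> (- real k *\<^sub>R i) + real k * (b \<bullet> i)) = 0"
    by (auto simp: flat_exp_def mult_less_cancel_left algebra_simps)
  then show ?thesis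
    unfolding box_bump_def using i(1) by (metis (mono_tags, lifting) finite_Basis prod_zero)
qed

lemma flat_exp_scaled_tendsto: "(\<lambda>k. flat_exp 0 (real k * s)) \<longlonglongrightarrow> (if s > 0 then 1 else 0)"
proof (cases "s > 0")
  case True
  have "filterlim (\<lambda>k. real k * s) at_top sequentially"
    using filterlim_tendsto_pos_mult_at_top[OF tendsto_const True filterlim_real_sequentially]
    by (simp add: mult.commute)
  then have "(\<lambda>k. inverse (real k * s)) \<longlonglongrightarrow> 0"
    by (rule tendsto_inverse_0_at_top)
  then have "(\<lambda>k. exp (- inverse (real k * s))) \<longlonglongrightarrow> exp (- 0)"
    by (intro tendsto_intros)
  moreover have "\<forall>\<^sub>F k in sequentially. exp (- inverse (real k * s)) = flat_exp 0 (real k * s)"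
    using eventually_gt_at_top[of 0] by eventually_elim (use True in \<open>simp add: flat_exp_def\<close>)
  ultimately have "(\<lambda>k. flat_exp 0 (real k * s)) \<longlonglongrightarrow> exp (- 0)"
    by (rule Lim_transform_eventually)
  then show ?thesis
    using True by simp
next
  case False
  then show ?thesis by (auto simp: flat_exp_def zero_less_mult_iff)
qed

lemma box_bump_tendsto: "(\<lambda>k. box_bump a b k x) \<longlonglongrightarrow> indicator (box a b) x"
proof -
  have "(\<lambda>k. flat_exp 0 (x \<bullet> (real k *\<^sub>R i) + real k * - (a \<bullet> i)) *
     flat_exp 0 (x \<bullet> (- real k *\<^sub>R i) + real k * (b \<bullet> i)))
     \<longlonglongrightarrow> (if x \<bullet> i - a \<bullet> i > 0 then 1 else 0) * (if b \<bullet> i - x \<bullet> i > 0 then 1 else 0)" for i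
    using tendsto_mult[OF flat_exp_scaled_tendsto[of "x \<bullet> i - a \<bullet> i"] flat_exp_scaled_tendsto[of "b \<bullet> i - x \<bullet> i"]]
    by (simp add: algebra_simps)
  then have "(\<lambda>k. box_bump a b k x) \<longlonglongrightarrow>
    (\<Prod>i\<in>Basis. (if x \<bullet> i - a \<bullet> i > 0 then 1 else 0) * (if b \<bullet> i - x \<bullet> i > 0 then 1 else 0))"
    unfolding box_bump_def by (intro tendsto_prod)
  also have "(\<Prod>i\<in>Basis. (if x \<bullet> i - a \<bullet> i > 0 then 1 else 0) * (if b \<bullet> i - x \<bullet> i > 0 then 1 else 0)) =
    (indicator (box a b) x :: real)"
  proof (cases "x \<in> box a b")
    case False
    then obtain i where "i \<in> Basis" "\<not> (a \<bullet> i < x \<bullet> i \<and> x \<bullet> i < b \<bullet> i)"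
      by (auto simp: mem_box)
    then show ?thesis using False
      by (auto intro!: prod_zero bexI[of _ i])
  qed (auto simp: mem_box)
  finally show ?thesis .
qed

lemma box_bump_test_function:
  "cbox a b \<subseteq> \<Omega> \<Longrightarrow> box_bump a b k \<in> test_functions \<Omega>"
  unfolding test_functions_def
  by (intro CollectI conjI smooth_box_bump exI[of _ "cbox a b"] allI impI box_bump_outside compact_cbox)

section \<open>The fundamental lemma of the calculus of variations\<close>

text \<open>Completeness of Lebesgue measure: the preimages of \<open>f\<close> and \<open>g\<close>
  differ by a subset of a null set. This is how measurability is transferred between different
  representatives of a gradient, and between integrands evaluated at them.\<close>

lemma borel_measurable_lebesgue_on_cong_AE:
  fixes f g :: "'a::euclidean_space \<Rightarrow> 'b::topological_space"
  assumes S: "S \<in> sets lebesgue" and f: "f \<in> borel_measurable (lebesgue_on S)"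
    and ae: "AE x in lebesgue_on S. f x = g x"
  shows "g \<in> borel_measurable (lebesgue_on S)"
proof (rule measurableI)
  fix A :: "'b set" assume A: "A \<in> sets borel"
  have "f -` A \<inter> S \<in> sets (lebesgue_on S)"
    using measurable_sets[OF f A] by simp
  then have *: "f -` A \<inter> S \<in> sets lebesgue"
    using S by (auto simp: sets_restrict_space_iff)
  have "AE x in lebesgue. x \<in> f -` A \<inter> S \<longleftrightarrow> x \<in> g -` A \<inter> S"
    using ae S by (auto simp: AE_restrict_space_iff)
  then have "g -` A \<inter> S \<in> sets lebesgue"
    by (rule completion.in_sets_AE[OF _ *]) auto
  then show "g -` A \<inter> space (lebesgue_on S) \<in> sets (lebesgue_on S)"
    using S by (auto simp: sets_restrict_space_iff)
qed auto

text \<open>For a Borel version \<open>h\<close> of \<open>g\<close>, the Borel sets over which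
  \<open>h\<close> integrates to 0 form a Dynkin system containing the boxes. These are an
  intersection-stable generator, so the system consists of all Borel sets; the sets where
  \<open>h\<close> is positive and where it is negative then show that \<open>\<bar>h\<bar>\<close>
  has integral 0.\<close>

lemma AE_zero_of_box_integrals:
  fixes g :: "'a::euclidean_space \<Rightarrow> real"
  assumes int: "integrable lebesgue g"
    and zero: "\<And>a b. (\<integral>x. indicator (box a b) x * g x \<partial>lebesgue) = 0"
  shows "AE x in lebesgue. g x = 0"
proof -
  obtain h where h: "h \<in> borel_measurable lborel" "AE x in lborel. g x = h x"
    using completion_ex_borel_measurable_real[of g lborel] int by auto
  have gh: "AE x in lebesgue. g x = h x"
    using h(2) by (simp add: AE_completion_iff)
  have "integrable lebesgue h"
    using int gh h(1) by (subst integrable_cong_AE[of h _ g]) (auto intro: measurable_completion)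
  then have inth: "integrable lborel h"
    using h(1) by (simp add: integrable_completion)
  have ind: "set_integrable lborel A h" if "A \<in> sets borel" for A
    using that inth by (intro set_integrable_subset[of lborel UNIV h A]) (auto simp: set_integrable_def)
  have box: "(LINT x:box a b|lborel. h x) = 0" for a b
  proof -
    have "(LINT x:box a b|lborel. h x) = (\<integral>x. indicator (box a b) x * h x \<partial>lebesgue)"
      unfolding set_lebesgue_integral_def using h(1) by (subst integral_completion) auto
    also have "\<dots> = (\<integral>x. indicator (box a b) x * g x \<partial>lebesgue)"
      using gh int h(1)
      by (intro integral_cong_AE)
        (auto intro!: borel_measurable_times measurable_completion[of "indicat_real (box a b)"]
          measurable_completion[of h])
    finally show ?thesis using zero by simp
  qed
  \<comment> \<open>The complement step of the induction below needs the whole space, which is not a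
    box; it is exhausted by cubes.\<close>
  have whole: "(LINT x:UNIV|lborel. h x) = 0"
  proof -
    have "(\<lambda>n. LINT x:box (- (real n *\<^sub>R One)) (real n *\<^sub>R One)|lborel. h x) \<longlonglongrightarrow> (LINT x:UNIV|lborel. h x)"
      unfolding set_lebesgue_integral_def
    proof (rule integral_dominated_convergence)
      show "AE x in lborel. (\<lambda>n. indicat_real (box (- (real n *\<^sub>R One)) (real n *\<^sub>R One)) x *\<^sub>R h x)
         \<longlonglongrightarrow> indicat_real UNIV x *\<^sub>R h x"
      proof (intro AE_I2 tendsto_intros)
        fix x :: 'a
        obtain n where n: "x \<in> box (- (real n *\<^sub>R One)) (real n *\<^sub>R One)"
          using UN_box_eq_UNIV[where 'a='a] by blast
        have "x \<in> box (- (real m *\<^sub>R One)) (real m *\<^sub>R One)" if "n \<le> m" for m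
          using n that by (fastforce simp: mem_box)
        then have "\<forall>\<^sub>F m in sequentially. indicat_real UNIV x = indicat_real (box (- (real m *\<^sub>R One)) (real m *\<^sub>R One)) x"
          unfolding eventually_sequentially by (metis indicator_simps(1) UNIV_I)
        then show "(\<lambda>n. indicat_real (box (- (real n *\<^sub>R One)) (real n *\<^sub>R One)) x) \<longlonglongrightarrow> indicat_real UNIV x"
          by (rule Lim_transform_eventually[OF tendsto_const])
      qed
      show "integrable lborel (\<lambda>x. norm (h x))" using inth by simp
    qed (use h(1) in \<open>auto simp: indicator_def\<close>)
    then show ?thesis
      unfolding box by (simp add: LIMSEQ_const_iff)
  qed
  have all: "(LINT x:A|lborel. h x) = 0" if "A \<in> sets borel" for A
  proof -
    have "A \<in> sigma_sets UNIV (range (\<lambda>(a, b). box a b))"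
      using that by (subst (asm) borel_eq_box) simp
    then show ?thesis
    proof (rule sigma_sets_induct_disjoint[rotated 2])
      show "Int_stable (range (\<lambda>(a, b). box a b :: 'a set))"
        by (auto simp: Int_stable_def box_Int_box)
      show "(LINT x:{}|lborel. h x) = 0" by (simp add: set_lebesgue_integral_def)
      show "(LINT x:B|lborel. h x) = 0" if "B \<in> range (\<lambda>(a, b). box a b)" for B
        using that box by auto
    next
      fix B assume B: "B \<in> sigma_sets UNIV (range (\<lambda>(a, b). box a b :: 'a set))" "(LINT x:B|lborel. h x) = 0"
      then have "B \<in> sets borel" by (subst borel_eq_box) simp
      with B(2) set_integral_Un[of B "UNIV - B" lborel h] ind whole
      show "(LINT x:UNIV - B|lborel. h x) = 0" by auto
    next
      fix B :: "nat \<Rightarrow> 'a set"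
      assume B: "disjoint_family B" "range B \<subseteq> sigma_sets UNIV (range (\<lambda>(a, b). box a b))"
        "\<And>i. (LINT x:B i|lborel. h x) = 0"
      then have "\<And>i. B i \<in> sets borel" by (subst borel_eq_box) auto
      with B show "(LINT x:\<Union> (range B)|lborel. h x) = 0"
        by (subst lebesgue_integral_countable_add)
          (auto intro!: ind simp: disjoint_family_on_def)
    qed auto
  qed
  have "(\<integral>x. \<bar>h x\<bar> \<partial>lborel) =
    (\<integral>x. indicator {x. h x > 0} x * h x - indicator {x. h x < 0} x * h x \<partial>lborel)"
    by (intro Bochner_Integration.integral_cong) (auto simp: indicator_def)
  also have "\<dots> = (LINT x:{x. h x > 0}|lborel. h x) - (LINT x:{x. h x < 0}|lborel. h x)"
    unfolding set_lebesgue_integral_def real_scaleR_def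
    using ind[of "{x. h x > 0}"] ind[of "{x. h x < 0}"] h(1)
    by (intro Bochner_Integration.integral_diff) (auto simp: set_integrable_def)
  also have "\<dots> = 0"
    using h(1) by (simp add: all)
  finally have "AE x in lborel. \<bar>h x\<bar> = 0"
    using inth by (subst (asm) integral_nonneg_eq_0_iff_AE) auto
  with h(2) have "AE x in lborel. g x = 0" by eventually_elim simp
  then show ?thesis by (rule AE_completion)
qed

text \<open>Bumps converge boundedly to indicators of boxes, so dominated convergence turns the
  hypothesis into vanishing box integrals. This is done inside one closed box in \<Omega>, where
  \<open>g\<close> is integrable; countably many such boxes cover \<Omega>.\<close>

lemma fundamental_lemma:
  fixes g :: "'a::euclidean_space \<Rightarrow> real"
  assumes \<Omega>: "open \<Omega>" and g: "locally_integrable \<Omega> g"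
    and zero: "\<And>\<phi>. \<phi> \<in> test_functions \<Omega> \<Longrightarrow> (\<integral>x. g x * \<phi> x \<partial>lebesgue_on \<Omega>) = 0"
  shows "AE x in lebesgue_on \<Omega>. g x = 0"
proof -
  have cbox: "AE x in lebesgue. x \<in> cbox a b \<longrightarrow> g x = 0" if sub: "cbox a b \<subseteq> \<Omega>" for a b
  proof -
    let ?G = "\<lambda>x. if x \<in> cbox a b then g x else 0"
    have G: "integrable lebesgue ?G"
      using g sub by (intro Lebesgue_Measure.integrable_restrict_UNIV[THEN iffD2]) (auto simp: locally_integrable_def)
    \<comment> \<open>For closed boxes inside \<open>cbox a b\<close> the bump is a test function on
      \<Omega> and vanishes where \<open>?G\<close> differs from \<open>g\<close>.\<close>
    have inner: "(\<integral>x. indicator (box c d) x * ?G x \<partial>lebesgue) = 0" if cd: "cbox c d \<subseteq> cbox a b" for c d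
    proof -
      have "(\<integral>x. box_bump c d k x * ?G x \<partial>lebesgue) = 0" for k
      proof -
        have "(\<integral>x. box_bump c d k x * ?G x \<partial>lebesgue) =
          (\<integral>x. (if x \<in> \<Omega> then g x * box_bump c d k x else 0) \<partial>lebesgue)"
          using box_bump_outside[of _ c d k] cd sub
          by (intro Bochner_Integration.integral_cong) auto
        also have "\<dots> = (\<integral>x. g x * box_bump c d k x \<partial>lebesgue_on \<Omega>)"
          using \<Omega> by (intro Lebesgue_Measure.integral_restrict_UNIV) auto
        also have "\<dots> = 0"
          using cd sub by (intro zero box_bump_test_function) auto
        finally show ?thesis .
      qed
      moreover have "(\<lambda>k. \<integral>x. box_bump c d k x * ?G x \<partial>lebesgue) \<longlonglongrightarrow> (\<integral>x. indicator (box c d) x * ?G x \<partial>lebesgue)"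
      proof (rule integral_dominated_convergence)
        have "continuous_on UNIV (box_bump c d k)" for k
          by (intro continuous_at_imp_continuous_on ballI differentiable_imp_continuous_within
              smooth_differentiable smooth_box_bump)
        then have "box_bump c d k \<in> borel_measurable lebesgue" for k
          by (intro measurable_completion) (simp add: borel_measurable_continuous_onI)
        with G show "(\<lambda>x. box_bump c d k x * ?G x) \<in> borel_measurable lebesgue" for k
          by (intro borel_measurable_times) auto
        have "indicat_real (box c d) \<in> borel_measurable lebesgue"
          by (intro measurable_completion) simp
        with G show "(\<lambda>x. indicat_real (box c d) x * ?G x) \<in> borel_measurable lebesgue"
          by (intro borel_measurable_times) auto
        show "integrable lebesgue (\<lambda>x. norm (?G x))" using G by (rule integrable_norm)
        show "AE x in lebesgue. (\<lambda>k. box_bump c d k x * ?G x) \<longlonglongrightarrow> indicat_real (box c d) x * ?G x"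
          by (intro AE_I2 tendsto_mult box_bump_tendsto tendsto_const)
        show "AE x in lebesgue. norm (box_bump c d k x * ?G x) \<le> norm (?G x)" for k
          using box_bump_bounds[of c d k] by (intro AE_I2) (auto simp: abs_mult intro!: mult_left_le_one_le)
      qed
      ultimately show ?thesis by (simp add: LIMSEQ_const_iff)
    qed
    \<comment> \<open>Cutting off by the open box admits arbitrary boxes as tests: the intersection
      with \<open>box a b\<close> is again a box, and if nonempty its closure lies in
      \<open>cbox a b\<close>, as \<open>inner\<close> requires. Only the boundary of the box is
      lost, a null set.\<close>
    let ?H = "\<lambda>x. indicator (box a b) x * ?G x"
    have "AE x in lebesgue. ?H x = 0"
    proof (rule AE_zero_of_box_integrals)
      show "integrable lebesgue ?H"
        using G by (intro integrable_real_mult_indicator[of "box a b" lebesgue ?G, simplified mult.commute[of _ "indicator _ _"]]) auto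
      fix c d
      obtain c' d' where cd': "box c d \<inter> box a b = box c' d'"
        by (auto simp: box_Int_box)
      have eq: "(\<integral>x. indicator (box c d) x * ?H x \<partial>lebesgue) = (\<integral>x. indicator (box c' d') x * ?G x \<partial>lebesgue)"
        unfolding cd'[symmetric] by (intro Bochner_Integration.integral_cong) (auto simp: indicator_def)
      show "(\<integral>x. indicator (box c d) x * ?H x \<partial>lebesgue) = 0"
      proof (cases "box c' d' = {}")
        case False
        have "closure (box c' d') \<subseteq> closure (box a b)"
          using cd' by (intro closure_mono) auto
        with False have "cbox c' d' \<subseteq> cbox a b"
          by (metis closure_box closure_subset_eq closed_cbox box_subset_cbox closure_mono subset_trans closure_closed)
        then show ?thesis unfolding eq by (rule inner)
      qed (simp add: eq)
    qed
    moreover have "AE x in lebesgue. x \<notin> cbox a b - box a b"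
      using negligible_frontier_interval[of a b] by (intro AE_not_in) (simp add: negligible_iff_null_sets)
    ultimately show ?thesis
      by eventually_elim (auto simp: indicator_def split: if_splits)
  qed
  obtain D where D: "countable D" "D \<subseteq> Pow \<Omega>" "\<And>X. X \<in> D \<Longrightarrow> \<exists>a b. X = cbox a b" "\<Union>D = \<Omega>"
    using open_countable_Union_open_cbox[OF \<Omega>] by metis
  have "AE x in lebesgue. x \<in> X \<longrightarrow> g x = 0" if X: "X \<in> D" for X
  proof -
    obtain a b where "X = cbox a b" using D(3)[OF X] by blast
    then show ?thesis using cbox[of a b] D(2) X by auto
  qed
  then have "AE x in lebesgue. \<forall>X\<in>D. x \<in> X \<longrightarrow> g x = 0"
    by (intro AE_ball_countable[OF D(1), THEN iffD2] ballI)
  then have "AE x in lebesgue. x \<in> \<Omega> \<longrightarrow> g x = 0"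
    by eventually_elim (use D(4) in blast)
  then show ?thesis
    using \<Omega> by (subst AE_restrict_space_iff) auto
qed

section \<open>Weak gradients\<close>

lemma smooth_continuous_on: "smooth \<phi> \<Longrightarrow> continuous_on A \<phi>"
  by (metis smooth_differentiable differentiable_imp_continuous_within
      continuous_at_imp_continuous_on)

lemma smooth_has_derivative: "smooth \<phi> \<Longrightarrow> (\<phi> has_derivative frechet_derivative \<phi> (at x)) (at x)"
  using smooth_differentiable frechet_derivative_works by blast

lemma test_functions_smooth: "\<phi> \<in> test_functions \<Omega> \<Longrightarrow> smooth \<phi>"
  by (simp add: test_functions_def)

text \<open>The complement of \<open>K\<close> is open, so the function is locally constant there
  and the same compact set serves its derivative.\<close>

lemma test_functions_support:
  fixes \<phi> :: "'a::euclidean_space \<Rightarrow> 'b::euclidean_space"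
  assumes "\<phi> \<in> test_functions \<Omega>"
  obtains K where "compact K" "K \<subseteq> \<Omega>" "\<And>x. x \<notin> K \<Longrightarrow> \<phi> x = 0"
    "\<And>x h. x \<notin> K \<Longrightarrow> frechet_derivative \<phi> (at x) h = 0"
proof -
  obtain K where K: "compact K" "K \<subseteq> \<Omega>" "\<And>x. x \<notin> K \<Longrightarrow> \<phi> x = 0"
    using assms by (auto simp: test_functions_def)
  have "frechet_derivative \<phi> (at x) h = 0" if "x \<notin> K" for x h
  proof -
    have "(\<phi> has_derivative (\<lambda>h. 0)) (at x)"
      by (rule has_derivative_transform_within_open[of "\<lambda>_. 0" _ _ _ "- K"])
        (use that K in \<open>auto simp: compact_imp_closed open_Compl\<close>)
    then show ?thesis
      using frechet_derivative_at by metis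
  qed
  with K that show ?thesis by blast
qed

section \<open>Integration against functions of compact support\<close>

lemma integrable_times_compact_support:
  fixes g \<phi> :: "'a::euclidean_space \<Rightarrow> real"
  assumes "\<Omega> \<in> sets lebesgue" and g: "locally_integrable \<Omega> g" and \<phi>: "continuous_on UNIV \<phi>"
    and K: "compact K" "K \<subseteq> \<Omega>" "\<And>x. x \<notin> K \<Longrightarrow> \<phi> x = 0"
  shows "integrable (lebesgue_on \<Omega>) (\<lambda>x. g x * \<phi> x)"
proof -
  have gK: "integrable (lebesgue_on K) g"
    using g K by (auto simp: locally_integrable_def)
  obtain B where B: "\<And>x. x \<in> K \<Longrightarrow> \<bar>\<phi> x\<bar> \<le> B"
    using compact_imp_bounded[OF compact_continuous_image[OF continuous_on_subset[OF \<phi>] K(1)]]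
    by (auto simp: bounded_iff)
  have Km: "K \<in> sets lebesgue" using K(1) by (simp add: lmeasurable_compact fmeasurableD)
  have \<phi>m: "\<phi> \<in> borel_measurable (lebesgue_on K)"
    using \<phi> Km by (intro continuous_imp_measurable_on_sets_lebesgue) (auto intro: continuous_on_subset)
  have "integrable (lebesgue_on K) (\<lambda>x. g x * \<phi> x)"
  proof (rule Bochner_Integration.integrable_bound)
    show "integrable (lebesgue_on K) (\<lambda>x. B * g x)" using gK by simp
    show "(\<lambda>x. g x * \<phi> x) \<in> borel_measurable (lebesgue_on K)" using gK \<phi>m by simp
    show "AE x in lebesgue_on K. norm (g x * \<phi> x) \<le> norm (B * g x)"
    proof (rule AE_I2)
      fix x assume "x \<in> space (lebesgue_on K)"
      then have "\<bar>\<phi> x\<bar> \<le> B" using B by simp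
      then have "\<bar>g x\<bar> * \<bar>\<phi> x\<bar> \<le> \<bar>g x\<bar> * \<bar>B\<bar>" by (intro mult_left_mono) auto
      then show "norm (g x * \<phi> x) \<le> norm (B * g x)" by (simp add: abs_mult mult.commute)
    qed
  qed
  then have "integrable lebesgue (\<lambda>x. if x \<in> K then g x * \<phi> x else 0)"
    by (rule Lebesgue_Measure.integrable_restrict_UNIV[OF Km, THEN iffD2])
  also have "(\<lambda>x. if x \<in> K then g x * \<phi> x else 0) = (\<lambda>x. if x \<in> \<Omega> then g x * \<phi> x else 0)"
    using K by (auto simp: fun_eq_iff)
  finally show ?thesis
    by (rule Lebesgue_Measure.integrable_restrict_UNIV[OF assms(1), THEN iffD1])
qed

text \<open>By translation invariance the difference quotients of \<open>\<psi>\<close> have integral 0; their limit is dominated.\<close>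

lemma integral_derivative_compact_support:
  fixes \<psi> :: "'a::euclidean_space \<Rightarrow> real"
  assumes deriv: "\<And>x. (\<psi> has_derivative \<psi>' x) (at x)" and cont: "continuous_on UNIV (\<lambda>x. \<psi>' x h)"
    and K: "compact K" "\<And>x. x \<notin> K \<Longrightarrow> \<psi> x = 0" "\<And>x. x \<notin> K \<Longrightarrow> \<psi>' x h = 0"
  shows "(\<integral>x. \<psi>' x h \<partial>lebesgue) = 0"
proof -
  have c\<psi>: "continuous_on UNIV \<psi>"
    by (intro continuous_at_imp_continuous_on ballI has_derivative_continuous[OF deriv])
  obtain R where R: "\<And>x. x \<in> K \<Longrightarrow> norm x \<le> R"
    using compact_imp_bounded[OF K(1)] by (auto simp: bounded_iff)
  obtain M where M0: "\<And>x. x \<in> K \<Longrightarrow> \<bar>\<psi>' x h\<bar> \<le> M"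
    using compact_imp_bounded[OF compact_continuous_image[OF continuous_on_subset[OF cont] K(1)]]
    by (auto simp: bounded_iff)
  have M: "\<bar>\<psi>' x h\<bar> \<le> \<bar>M\<bar>" for x
    using M0[of x] K(3)[of x] by (cases "x \<in> K") auto
  have [measurable]: "\<psi> \<in> borel_measurable borel" "(\<lambda>x. \<psi>' x h) \<in> borel_measurable borel"
    using c\<psi> cont by (simp_all add: borel_measurable_continuous_onI)
  define s where "s n = inverse (real (Suc n))" for n
  have s: "0 < s n" "s n \<le> 1" for n by (auto simp: s_def field_simps)
  define D where "D n x = (\<psi> (s n *\<^sub>R h + x) - \<psi> x) / s n" for n x
  \<comment> \<open>On the line through \<open>x\<close> in direction \<open>h\<close> the problem
    is one-dimensional; this yields both the pointwise limit of the quotients and, by the mean value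
    theorem, their bound.\<close>
  have along: "((\<lambda>r. \<psi> (r *\<^sub>R h + x)) has_real_derivative \<psi>' (r *\<^sub>R h + x) h) (at r)" for r x
  proof -
    have "((\<lambda>r. r *\<^sub>R h + x) has_derivative (\<lambda>r. r *\<^sub>R h)) (at r)"
      by (auto intro!: derivative_eq_intros)
    from has_derivative_compose[OF this deriv]
    show ?thesis
      unfolding has_field_derivative_def
      using linear_scale[OF has_derivative_linear[OF deriv]] by (simp add: mult.commute[of _ "\<psi>' _ h"] mult_commute_abs)
  qed
  have D0: "(\<integral>x. D n x \<partial>lborel) = 0" for n
  proof -
    have int: "integrable lborel \<psi>"
    proof -
      have "integrable lborel (\<lambda>x. indicator K x *\<^sub>R \<psi> x)"
        using K(1) c\<psi> by (intro borel_integrable_compact) (auto intro: continuous_on_subset)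
      also have "(\<lambda>x. indicator K x *\<^sub>R \<psi> x) = \<psi>" using K(2) by (auto simp: indicator_def fun_eq_iff)
      finally show ?thesis .
    qed
    have int': "integrable lborel (\<lambda>x. \<psi> (s n *\<^sub>R h + x))"
      using int by (subst (asm) lborel_distr_plus[of "s n *\<^sub>R h", symmetric]) (simp add: integrable_distr_eq)
    have "(\<integral>x. \<psi> (s n *\<^sub>R h + x) \<partial>lborel) = (\<integral>x. \<psi> x \<partial>lborel)"
      by (subst (2) lborel_distr_plus[of "s n *\<^sub>R h", symmetric]) (simp add: integral_distr)
    then show ?thesis
      unfolding D_def using int int' by simp
  qed
  have "(\<lambda>n. \<integral>x. D n x \<partial>lborel) \<longlonglongrightarrow> (\<integral>x. \<psi>' x h \<partial>lborel)"
  proof (rule integral_dominated_convergence)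
    \<comment> \<open>As \<open>s n \<le> 1\<close>, outside the ball of radius
      \<open>R + norm h\<close> both \<open>x\<close> and its translate miss \<open>K\<close>, so
      the quotient is 0 there.\<close>
    show "integrable lborel (\<lambda>x. indicator (cball 0 (R + norm h)) x *\<^sub>R \<bar>M\<bar>)"
      by (intro borel_integrable_compact) auto
    show "AE x in lborel. (\<lambda>n. D n x) \<longlonglongrightarrow> \<psi>' x h"
    proof (rule AE_I2)
      fix x
      have "((\<lambda>r. (\<psi> (r *\<^sub>R h + x) - \<psi> x) / r) \<longlongrightarrow> \<psi>' x h) (at 0)"
        using along[of x 0] by (simp add: has_field_derivative_iff)
      moreover have "filterlim s (at 0) sequentially"
        using s(1) LIMSEQ_inverse_real_of_nat unfolding s_def[abs_def]
        by (auto simp: filterlim_at)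
      ultimately show "(\<lambda>n. D n x) \<longlonglongrightarrow> \<psi>' x h"
        unfolding D_def by (rule filterlim_compose)
    qed
    show "AE x in lborel. norm (D n x) \<le> indicator (cball 0 (R + norm h)) x *\<^sub>R \<bar>M\<bar>" for n
    proof (rule AE_I2)
      fix x
      show "norm (D n x) \<le> indicator (cball 0 (R + norm h)) x *\<^sub>R \<bar>M\<bar>"
      proof (cases "x \<in> cball 0 (R + norm h)")
        case True
        obtain z where "\<psi> (s n *\<^sub>R h + x) - \<psi> (0 *\<^sub>R h + x) = (s n - 0) * \<psi>' (z *\<^sub>R h + x) h"
          using MVT2[OF s(1) along] by blast
        then have "D n x = \<psi>' (z *\<^sub>R h + x) h"
          using s(1)[of n] by (simp add: D_def)
        then show ?thesis using M True by simp
      next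
        case False
        then have "norm x > R + norm h" by simp
        moreover have "norm x \<le> norm (s n *\<^sub>R h + x) + norm (s n *\<^sub>R h)"
          using norm_triangle_ineq4[of "s n *\<^sub>R h + x" "s n *\<^sub>R h"] by simp
        moreover have "norm (s n *\<^sub>R h) \<le> norm h"
          using s[of n] by (simp add: mult_left_le_one_le)
        ultimately have "norm (s n *\<^sub>R h + x) > R" "norm x > R"
          using norm_ge_zero[of h] by linarith+
        then have "\<psi> (s n *\<^sub>R h + x) = 0" "\<psi> x = 0" using R K(2) by (meson not_le)+
        then show ?thesis by (simp add: D_def)
      qed
    qed
  qed (auto simp: D_def)
  then have "(\<integral>x. \<psi>' x h \<partial>lborel) = 0"
    unfolding D0 by (simp add: LIMSEQ_const_iff)
  then show ?thesis by (subst integral_completion) auto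
qed

text \<open>The classical Jacobian in the index layout of weak gradients. Being explicit, it is
  jointly continuous along test curves, which supplies the measurability and the bounds that a weak
  gradient, fixed only up to null sets, does not give by itself.\<close>

definition cgrad :: "(real^'n \<Rightarrow> real^'m) \<Rightarrow> real^'n \<Rightarrow> real^'n^'m" where
  "cgrad w x = (\<chi> i \<alpha>. frechet_derivative w (at x) (axis \<alpha> 1) $ i)"

lemma continuous_on_cgrad: "smooth w \<Longrightarrow> continuous_on A (cgrad w)"
  unfolding cgrad_def
  by (intro continuous_intros continuous_on_component smooth_continuous_on smooth_derivative)

lemma locally_integrable_continuous:
  fixes w :: "'a::euclidean_space \<Rightarrow> 'b::euclidean_space"
  assumes "continuous_on \<Omega> w"
  shows "locally_integrable \<Omega> w"
  unfolding locally_integrable_def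
proof (intro allI impI, elim conjE)
  fix K assume K: "compact K" "K \<subseteq> \<Omega>"
  have "integrable lborel (\<lambda>x. indicator K x *\<^sub>R w x)"
    using K assms by (intro borel_integrable_compact) (auto intro: continuous_on_subset)
  then have "integrable lebesgue (\<lambda>x. indicator K x *\<^sub>R w x)"
    by (subst integrable_completion) auto
  moreover have "K \<in> sets lebesgue" using K(1) by (simp add: lmeasurable_compact fmeasurableD)
  ultimately show "integrable (lebesgue_on K) w"
    by (subst integrable_restrict_space) auto
qed

lemma locally_integrable_diff_scaleR:
  fixes w z :: "'a::euclidean_space \<Rightarrow> 'b::euclidean_space"
  assumes "locally_integrable \<Omega> w" "locally_integrable \<Omega> z"
  shows "locally_integrable \<Omega> (\<lambda>x. w x - c *\<^sub>R z x)"
  using assms by (auto simp: locally_integrable_def)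

lemma locally_integrable_nth:
  fixes w :: "'a::euclidean_space \<Rightarrow> 'b::euclidean_space^'m"
  assumes "locally_integrable \<Omega> w"
  shows "locally_integrable \<Omega> (\<lambda>x. w x $ i)"
  unfolding locally_integrable_def
proof (intro allI impI)
  fix K assume "compact K \<and> K \<subseteq> \<Omega>"
  then have "integrable (lebesgue_on K) w" using assms by (simp add: locally_integrable_def)
  from integrable_bounded_linear[OF bounded_linear_vec_nth[of i] this]
  show "integrable (lebesgue_on K) (\<lambda>x. w x $ i)" .
qed

lemma integrable_times_test_function:
  fixes g :: "'a::euclidean_space \<Rightarrow> real"
  assumes "open \<Omega>" "locally_integrable \<Omega> g" "\<phi> \<in> test_functions \<Omega>"
  shows "integrable (lebesgue_on \<Omega>) (\<lambda>x. g x * \<phi> x)"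
    and "integrable (lebesgue_on \<Omega>) (\<lambda>x. g x * frechet_derivative \<phi> (at x) h)"
proof -
  obtain K where K: "compact K" "K \<subseteq> \<Omega>" "\<And>x. x \<notin> K \<Longrightarrow> \<phi> x = 0"
    "\<And>x h. x \<notin> K \<Longrightarrow> frechet_derivative \<phi> (at x) h = 0"
    using test_functions_support[OF assms(3)] by metis
  have sm: "smooth \<phi>" using assms(3) by (rule test_functions_smooth)
  show "integrable (lebesgue_on \<Omega>) (\<lambda>x. g x * \<phi> x)"
    by (rule integrable_times_compact_support[OF _ assms(2) smooth_continuous_on[OF sm] K(1-3)])
      (use assms(1) in auto)
  show "integrable (lebesgue_on \<Omega>) (\<lambda>x. g x * frechet_derivative \<phi> (at x) h)"
    by (rule integrable_times_compact_support[OF _ assms(2) smooth_continuous_on[OF smooth_derivative[OF sm]] K(1,2,4)])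
      (use assms(1) in auto)
qed

text \<open>This one linear combination covers all uses: \<open>c = \<epsilon>\<close> for
  competitors, \<open>c = 1\<close> for uniqueness and for differences of a curve at two times.
  Splitting the integrals is legitimate because test functions have compact support and the factors
  are locally integrable.\<close>

lemma is_weak_gradient_diff_scaleR:
  assumes "open \<Omega>" and w: "is_weak_gradient \<Omega> w G" and z: "is_weak_gradient \<Omega> z H"
  shows "is_weak_gradient \<Omega> (\<lambda>x. w x - c *\<^sub>R z x) (\<lambda>x. G x - c *\<^sub>R H x)"
proof -
  have loc: "locally_integrable \<Omega> w" "locally_integrable \<Omega> G" "locally_integrable \<Omega> z" "locally_integrable \<Omega> H"
    using w z by (auto simp: is_weak_gradient_def)
  have "(\<integral>x. (w x - c *\<^sub>R z x) $ i * frechet_derivative \<phi> (at x) (axis \<alpha> 1) \<partial>lebesgue_on \<Omega>) =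
        - (\<integral>x. (G x - c *\<^sub>R H x) $ i $ \<alpha> * \<phi> x \<partial>lebesgue_on \<Omega>)"
    if \<phi>: "\<phi> \<in> test_functions \<Omega>" for \<phi> i \<alpha>
  proof -
    have "(\<integral>x. (w x - c *\<^sub>R z x) $ i * frechet_derivative \<phi> (at x) (axis \<alpha> 1) \<partial>lebesgue_on \<Omega>) =
      (\<integral>x. w x $ i * frechet_derivative \<phi> (at x) (axis \<alpha> 1) - c * (z x $ i * frechet_derivative \<phi> (at x) (axis \<alpha> 1)) \<partial>lebesgue_on \<Omega>)"
      by (simp add: algebra_simps)
    also have "\<dots> = (\<integral>x. w x $ i * frechet_derivative \<phi> (at x) (axis \<alpha> 1) \<partial>lebesgue_on \<Omega>) -
       c * (\<integral>x. z x $ i * frechet_derivative \<phi> (at x) (axis \<alpha> 1) \<partial>lebesgue_on \<Omega>)"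
      by (simp add: integrable_times_test_function[OF assms(1) locally_integrable_nth \<phi>] loc)
    also have "\<dots> = - (\<integral>x. G x $ i $ \<alpha> * \<phi> x \<partial>lebesgue_on \<Omega>) + c * (\<integral>x. H x $ i $ \<alpha> * \<phi> x \<partial>lebesgue_on \<Omega>)"
      using w z \<phi> by (simp add: is_weak_gradient_def)
    also have "\<dots> = - (\<integral>x. G x $ i $ \<alpha> * \<phi> x - c * (H x $ i $ \<alpha> * \<phi> x) \<partial>lebesgue_on \<Omega>)"
      by (simp add: integrable_times_test_function[OF assms(1) locally_integrable_nth[OF locally_integrable_nth] \<phi>] loc)
    also have "\<dots> = - (\<integral>x. (G x - c *\<^sub>R H x) $ i $ \<alpha> * \<phi> x \<partial>lebesgue_on \<Omega>)"
      by (simp add: algebra_simps)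
    finally show ?thesis .
  qed
  then show ?thesis
    using loc by (auto simp: is_weak_gradient_def intro!: locally_integrable_diff_scaleR)
qed

text \<open>\<open>G - H\<close> is a weak gradient of the zero function, so each of its finitely
  many entries integrates to 0 against every test function.\<close>

lemma is_weak_gradient_unique:
  assumes "open \<Omega>" and G: "is_weak_gradient \<Omega> w G" and H: "is_weak_gradient \<Omega> w H"
  shows "AE x in lebesgue_on \<Omega>. G x = H x"
proof -
  have loc: "locally_integrable \<Omega> (\<lambda>x. G x - 1 *\<^sub>R H x)"
    using G H by (intro locally_integrable_diff_scaleR) (auto simp: is_weak_gradient_def)
  have zero: "is_weak_gradient \<Omega> (\<lambda>x. w x - 1 *\<^sub>R w x) (\<lambda>x. G x - 1 *\<^sub>R H x)"
    using assms by (rule is_weak_gradient_diff_scaleR)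
  have "AE x in lebesgue_on \<Omega>. (G x - 1 *\<^sub>R H x) $ i $ \<alpha> = 0" for i \<alpha>
  proof (rule fundamental_lemma[OF assms(1)])
    show "locally_integrable \<Omega> (\<lambda>x. (G x - 1 *\<^sub>R H x) $ i $ \<alpha>)"
      by (intro locally_integrable_nth loc)
    show "(\<integral>x. (G x - 1 *\<^sub>R H x) $ i $ \<alpha> * \<phi> x \<partial>lebesgue_on \<Omega>) = 0" if "\<phi> \<in> test_functions \<Omega>" for \<phi>
      using zero that by (simp add: is_weak_gradient_def)
  qed
  then have "AE x in lebesgue_on \<Omega>. \<forall>i. \<forall>\<alpha>. (G x - 1 *\<^sub>R H x) $ i $ \<alpha> = 0"
    by (simp add: eventually_all_finite)
  then show ?thesis
    by eventually_elim (simp add: vec_eq_iff)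
qed

text \<open>Integration by parts: the product of \<open>w $ i\<close> with \<open>\<phi>\<close> has
  compact support, hence its directional derivative integrates to 0, and the product rule splits
  that integral into the two required ones.\<close>

lemma is_weak_gradient_cgrad:
  fixes w :: "real^'n \<Rightarrow> real^'m"
  assumes "open \<Omega>" "w \<in> test_functions \<Omega>"
  shows "is_weak_gradient \<Omega> w (cgrad w)"
proof -
  have sm: "smooth w" using assms(2) by (rule test_functions_smooth)
  have loc: "locally_integrable \<Omega> w" "locally_integrable \<Omega> (cgrad w)"
    using sm by (auto intro!: locally_integrable_continuous smooth_continuous_on continuous_on_cgrad)
  have "(\<integral>x. w x $ i * frechet_derivative \<phi> (at x) (axis \<alpha> 1) \<partial>lebesgue_on \<Omega>) =
        - (\<integral>x. cgrad w x $ i $ \<alpha> * \<phi> x \<partial>lebesgue_on \<Omega>)"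
    if \<phi>: "\<phi> \<in> test_functions \<Omega>" for \<phi> i \<alpha>
  proof -
    obtain K where K: "compact K" "K \<subseteq> \<Omega>" "\<And>x. x \<notin> K \<Longrightarrow> \<phi> x = 0"
      "\<And>x h. x \<notin> K \<Longrightarrow> frechet_derivative \<phi> (at x) h = 0"
      using test_functions_support[OF \<phi>] by metis
    have s\<phi>: "smooth \<phi>" using \<phi> by (rule test_functions_smooth)
    let ?D = "\<lambda>x h. w x $ i * frechet_derivative \<phi> (at x) h + frechet_derivative w (at x) h $ i * \<phi> x"
    have "(\<integral>x. ?D x (axis \<alpha> 1) \<partial>lebesgue) = 0"
    proof (rule integral_derivative_compact_support)
      have "((\<lambda>x. w x $ i) has_derivative (\<lambda>h. frechet_derivative w (at x) h $ i)) (at x)" for x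
        by (intro bounded_linear.has_derivative[OF bounded_linear_vec_nth] smooth_has_derivative sm)
      then show "((\<lambda>x. w x $ i * \<phi> x) has_derivative ?D x) (at x)" for x
        by (intro has_derivative_mult smooth_has_derivative s\<phi>)
      show "continuous_on UNIV (\<lambda>x. ?D x (axis \<alpha> 1))"
        by (intro continuous_intros continuous_on_component smooth_continuous_on smooth_derivative sm s\<phi>)
    qed (use K in auto)
    also have "(\<integral>x. ?D x (axis \<alpha> 1) \<partial>lebesgue) = (\<integral>x. (if x \<in> \<Omega> then ?D x (axis \<alpha> 1) else 0) \<partial>lebesgue)"
      using K(3,4) contra_subsetD[OF K(2)]
      by (intro Bochner_Integration.integral_cong) simp_all
    also have "\<dots> = (\<integral>x. ?D x (axis \<alpha> 1) \<partial>lebesgue_on \<Omega>)"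
      using assms(1) by (intro Lebesgue_Measure.integral_restrict_UNIV) auto
    also have "\<dots> = (\<integral>x. w x $ i * frechet_derivative \<phi> (at x) (axis \<alpha> 1) + cgrad w x $ i $ \<alpha> * \<phi> x \<partial>lebesgue_on \<Omega>)"
      by (simp add: cgrad_def)
    also have "\<dots> = (\<integral>x. w x $ i * frechet_derivative \<phi> (at x) (axis \<alpha> 1) \<partial>lebesgue_on \<Omega>)
       + (\<integral>x. cgrad w x $ i $ \<alpha> * \<phi> x \<partial>lebesgue_on \<Omega>)"
      using loc by (intro Bochner_Integration.integral_add
        integrable_times_test_function[OF assms(1) _ \<phi>] locally_integrable_nth)
    finally show ?thesis by simp
  qed
  with loc show ?thesis by (simp add: is_weak_gradient_def)
qed

section \<open>Fubini's theorem on the cylinder\<close>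

text \<open>The exceptional set is contained in a Borel null set, to which Fubini applies; its
  slices contain the slices of the exceptional set.\<close>

lemma AE_lebesgue_swap:
  fixes P :: "'a::euclidean_space \<times> 'b::euclidean_space \<Rightarrow> bool"
  assumes "AE z in lebesgue. P z"
  shows "AE t in lebesgue. AE x in lebesgue. P (x, t)"
proof -
  have "AE z in lborel. P z" using assms by (simp add: AE_completion_iff)
  then obtain N where N: "N \<in> null_sets lborel" "{z. \<not> P z} \<subseteq> N"
    unfolding eventually_ae_filter by auto
  have "AE z in lborel \<Otimes>\<^sub>M lborel. z \<notin> N"
    unfolding lborel_prod using N(1) by (rule AE_not_in)
  then have "AE x in lborel. AE t in lborel. (x, t) \<notin> N"
    by (rule lborel_pair.AE_pair)
  moreover have "{z \<in> space (lborel \<Otimes>\<^sub>M lborel). (fst z, snd z) \<notin> N} \<in> sets (lborel \<Otimes>\<^sub>M lborel)"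
  proof -
    have "N \<in> sets (lborel \<Otimes>\<^sub>M lborel)" unfolding lborel_prod using N(1) by (rule null_setsD2)
    then have "space (lborel \<Otimes>\<^sub>M lborel) - N \<in> sets (lborel \<Otimes>\<^sub>M lborel)"
      by (rule sets.compl_sets)
    then show ?thesis by (simp add: set_diff_eq)
  qed
  ultimately have "AE t in lborel. AE x in lborel. (x, t) \<notin> N"
    by (subst (asm) lborel_pair.AE_commute) auto
  then have "AE t in lborel. AE x in lborel. P (x, t)"
    using N(2) by (elim eventually_mono) (auto elim!: eventually_mono)
  then show ?thesis by (simp add: AE_completion_iff)
qed

text \<open>Here measurability of \<open>A\<close> is essential, since null slices alone say nothing
  about a non-measurable set. \<open>A\<close> is a Borel set together with a null part; Fubini
  handles the former and the latter is negligible anyway.\<close>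

lemma AE_lebesgue_swap_converse:
  fixes A :: "('a::euclidean_space \<times> 'b::euclidean_space) set"
  assumes A: "A \<in> sets lebesgue" and ae: "AE t in lebesgue. AE x in lebesgue. (x, t) \<notin> A"
  shows "AE z in lebesgue. z \<notin> A"
proof -
  let ?B = "main_part lborel A"
  have B: "?B \<in> sets lborel" using A by (rule main_part_sets)
  have AB: "A = ?B \<union> null_part lborel A" using A by (simp add: main_part_null_part_Un)
  have "AE t in lborel. AE x in lborel. (x, t) \<notin> ?B"
    using ae AB by (simp add: AE_completion_iff) (auto elim!: eventually_mono)
  moreover have "{z \<in> space (lborel \<Otimes>\<^sub>M lborel). (fst z, snd z) \<notin> ?B} \<in> sets (lborel \<Otimes>\<^sub>M lborel)"
  proof -
    have "space (lborel \<Otimes>\<^sub>M lborel) - ?B \<in> sets (lborel \<Otimes>\<^sub>M lborel)"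
      by (rule sets.compl_sets) (unfold lborel_prod, rule B)
    then show ?thesis by (simp add: set_diff_eq)
  qed
  ultimately have "AE z in lborel \<Otimes>\<^sub>M lborel. z \<notin> ?B"
    by (subst (asm) lborel_pair.AE_commute[symmetric], simp)
      (subst (asm) lborel_pair.AE_pair_iff, auto)
  then have "AE z in lborel. z \<notin> ?B" unfolding lborel_prod .
  moreover have "AE z in lborel. z \<notin> null_part lborel A"
    using A by (rule AE_notin_null_part)
  ultimately have "AE z in lborel. z \<notin> A"
    by eventually_elim (use AB in blast)
  then show ?thesis by (simp add: AE_completion_iff)
qed

lemma sets_lebesgue_cylinder [simp]:
  "open \<Omega> \<Longrightarrow> (\<Omega> \<times> {0<..<T::real}) \<in> sets lebesgue"
  by (intro sets_completionI_sets) (auto intro!: borel_open open_Times)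

lemma AE_cylinderI:
  assumes \<Omega>: "open \<Omega>" and P: "{z \<in> \<Omega> \<times> {0<..<T}. P z} \<in> sets (cyl \<Omega> T)"
    and ae: "AE t in lebesgue_on {0<..<T}. AE x in lebesgue_on \<Omega>. P (x, t)"
  shows "AE z in cyl \<Omega> T. P z"
proof -
  let ?A = "{z \<in> \<Omega> \<times> {0<..<T}. \<not> P z}"
  have "?A = space (cyl \<Omega> T) - {z \<in> \<Omega> \<times> {0<..<T}. P z}" by auto
  with sets.compl_sets[OF P] have "?A \<in> sets (cyl \<Omega> T)" by (simp only:)
  then have A: "?A \<in> sets lebesgue"
    using \<Omega> by (auto simp: sets_restrict_space_iff)
  have "AE t in lebesgue. AE x in lebesgue. (x, t) \<notin> ?A"
    using ae \<Omega> by (simp add: AE_restrict_space_iff) (auto elim!: eventually_mono)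
  from AE_lebesgue_swap_converse[OF A this] show ?thesis
    using \<Omega> by (auto simp: AE_restrict_space_iff elim!: eventually_mono)
qed

text \<open>Tonelli for a Borel function \<open>h\<close> that equals \<open>g\<close>, extended by
  0, almost everywhere. Almost every slice of \<open>g\<close> agrees almost everywhere with the
  slice of \<open>h\<close>; slices over the exceptional times may be non-measurable, but there are
  too few of them to affect the outer integral or, by completeness, the measurability in
  \<open>t\<close>.\<close>

lemma nn_integral_cylinder:
  fixes g :: "(real^'n) \<times> real \<Rightarrow> ennreal"
  assumes \<Omega>: "open \<Omega>" and g: "g \<in> borel_measurable (cyl \<Omega> T)"
  shows "(\<lambda>t. \<integral>\<^sup>+x. g (x, t) \<partial>lebesgue_on \<Omega>) \<in> borel_measurable (lebesgue_on {0<..<T})"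
    and "(\<integral>\<^sup>+z. g z \<partial>cyl \<Omega> T) = (\<integral>\<^sup>+t. \<integral>\<^sup>+x. g (x, t) \<partial>lebesgue_on \<Omega> \<partial>lebesgue_on {0<..<T})"
proof -
  let ?Q = "\<Omega> \<times> {0<..<T}"
  let ?g = "\<lambda>z. g z * indicator ?Q z"
  have Q: "?Q \<in> sets lebesgue" using \<Omega> by simp
  have "?g \<in> borel_measurable lebesgue"
    using g Q by (subst (asm) borel_measurable_restrict_space_iff_ennreal) auto
  then obtain h where h: "h \<in> borel_measurable lborel" "AE z in lborel. ?g z = h z"
    using completion_ex_borel_measurable by blast
  have hp: "h \<in> borel_measurable (lborel \<Otimes>\<^sub>M lborel)" unfolding lborel_prod by (rule h(1))
  have "AE z in lebesgue. ?g z = h z" using h(2) by (rule AE_completion)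
  then have "AE t in lebesgue. AE x in lebesgue. ?g (x, t) = h (x, t)" by (rule AE_lebesgue_swap)
  then have slice: "AE t in lebesgue. (\<integral>\<^sup>+x. h (x, t) \<partial>lborel) =
      (\<integral>\<^sup>+x. g (x, t) \<partial>lebesgue_on \<Omega>) * indicator {0<..<T} t"
  proof eventually_elim
    case (elim t)
    have "(\<integral>\<^sup>+x. h (x, t) \<partial>lborel) = (\<integral>\<^sup>+x. h (x, t) \<partial>lebesgue)"
      by (simp add: nn_integral_completion)
    also have "\<dots> = (\<integral>\<^sup>+x. ?g (x, t) \<partial>lebesgue)"
      using elim by (intro nn_integral_cong_AE) (auto elim: eventually_mono)
    also have "\<dots> = (\<integral>\<^sup>+x. g (x, t) * indicator \<Omega> x * indicator {0<..<T} t \<partial>lebesgue)"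
      by (intro nn_integral_cong) (auto simp: indicator_def)
    also have "\<dots> = (\<integral>\<^sup>+x. g (x, t) * indicator \<Omega> x \<partial>lebesgue) * indicator {0<..<T} t"
      by (cases "t \<in> {0<..<T}") auto
    also have "(\<integral>\<^sup>+x. g (x, t) * indicator \<Omega> x \<partial>lebesgue) = (\<integral>\<^sup>+x. g (x, t) \<partial>lebesgue_on \<Omega>)"
      using \<Omega> by (subst nn_integral_restrict_space) auto
    finally show ?case .
  qed
  have "(\<lambda>t. \<integral>\<^sup>+x. h (x, t) \<partial>lborel) \<in> borel_measurable lborel"
    using hp by measurable
  then have "(\<lambda>t. \<integral>\<^sup>+x. h (x, t) \<partial>lborel) \<in> borel_measurable (lebesgue_on {0<..<T})"
    by (intro measurable_restrict_space1 measurable_completion)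
  moreover have "AE t in lebesgue_on {0<..<T}. (\<integral>\<^sup>+x. h (x, t) \<partial>lborel) = (\<integral>\<^sup>+x. g (x, t) \<partial>lebesgue_on \<Omega>)"
    using slice by (auto simp: AE_restrict_space_iff elim!: eventually_mono)
  ultimately show "(\<lambda>t. \<integral>\<^sup>+x. g (x, t) \<partial>lebesgue_on \<Omega>) \<in> borel_measurable (lebesgue_on {0<..<T})"
    by (rule borel_measurable_lebesgue_on_cong_AE[rotated]) simp
  have "(\<integral>\<^sup>+z. g z \<partial>cyl \<Omega> T) = (\<integral>\<^sup>+z. ?g z \<partial>lebesgue)"
    using Q by (subst nn_integral_restrict_space) auto
  also have "\<dots> = (\<integral>\<^sup>+z. h z \<partial>lborel)"
    using h(2) by (subst nn_integral_completion) (rule nn_integral_cong_AE)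
  also have "\<dots> = (\<integral>\<^sup>+t. \<integral>\<^sup>+x. h (x, t) \<partial>lborel \<partial>lborel)"
    using lborel_pair.nn_integral_snd[OF hp] unfolding lborel_prod by simp
  also have "\<dots> = (\<integral>\<^sup>+t. \<integral>\<^sup>+x. h (x, t) \<partial>lborel \<partial>lebesgue)"
    by (simp add: nn_integral_completion)
  also have "\<dots> = (\<integral>\<^sup>+t. (\<integral>\<^sup>+x. g (x, t) \<partial>lebesgue_on \<Omega>) * indicator {0<..<T} t \<partial>lebesgue)"
    by (rule nn_integral_cong_AE[OF slice])
  also have "\<dots> = (\<integral>\<^sup>+t. \<integral>\<^sup>+x. g (x, t) \<partial>lebesgue_on \<Omega> \<partial>lebesgue_on {0<..<T})"
    by (subst nn_integral_restrict_space) auto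
  finally show "(\<integral>\<^sup>+z. g z \<partial>cyl \<Omega> T) = (\<integral>\<^sup>+t. \<integral>\<^sup>+x. g (x, t) \<partial>lebesgue_on \<Omega> \<partial>lebesgue_on {0<..<T})" .
qed

section \<open>Sobolev functions\<close>

text \<open>From \<open>norm (a - b)\<close> being at most twice the larger norm; in this form the
  constant is valid for every \<open>p \<ge> 0\<close>.\<close>

lemma norm_diff_powr_le:
  fixes a b :: "'a::real_normed_vector"
  assumes "0 \<le> p"
  shows "norm (a - b) powr p \<le> 2 powr p * (norm a powr p + norm b powr p)"
proof -
  have "norm (a - b) \<le> 2 * max (norm a) (norm b)"
    using norm_triangle_ineq4[of a b] by linarith
  then have "norm (a - b) powr p \<le> (2 * max (norm a) (norm b)) powr p"
    using assms by (intro powr_mono2) auto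
  also have "\<dots> = 2 powr p * max (norm a) (norm b) powr p"
    by (simp add: powr_mult)
  also have "\<dots> \<le> 2 powr p * (norm a powr p + norm b powr p)"
    by (intro mult_left_mono) (auto simp: max_def)
  finally show ?thesis .
qed

lemma Lp_cong_AE:
  fixes w z :: "'a::euclidean_space \<Rightarrow> 'b::euclidean_space"
  assumes "\<Omega> \<in> sets lebesgue" "w \<in> Lp p \<Omega>" "AE x in lebesgue_on \<Omega>. w x = z x"
  shows "z \<in> Lp p \<Omega>"
    and "(\<integral>x. norm (z x) powr p \<partial>lebesgue_on \<Omega>) = (\<integral>x. norm (w x) powr p \<partial>lebesgue_on \<Omega>)"
proof -
  have m: "w \<in> borel_measurable (lebesgue_on \<Omega>)" and i: "integrable (lebesgue_on \<Omega>) (\<lambda>x. norm (w x) powr p)"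
    using assms(2) by (auto simp: Lp_def)
  have z: "z \<in> borel_measurable (lebesgue_on \<Omega>)"
    using borel_measurable_lebesgue_on_cong_AE[OF assms(1) m assms(3)] .
  have ae: "AE x in lebesgue_on \<Omega>. norm (z x) powr p = norm (w x) powr p"
    using assms(3) by eventually_elim simp
  show "(\<integral>x. norm (z x) powr p \<partial>lebesgue_on \<Omega>) = (\<integral>x. norm (w x) powr p \<partial>lebesgue_on \<Omega>)"
    using m z ae by (intro integral_cong_AE) auto
  have "integrable (lebesgue_on \<Omega>) (\<lambda>x. norm (z x) powr p)"
    using m z ae i by (subst integrable_cong_AE[where g = "\<lambda>x. norm (w x) powr p"]) auto
  with z show "z \<in> Lp p \<Omega>" by (simp add: Lp_def)
qed

lemma Lp_diff_scaleR:
  fixes w z :: "'a::euclidean_space \<Rightarrow> 'b::euclidean_space"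
  assumes "0 \<le> p" "w \<in> Lp p \<Omega>" "z \<in> Lp p \<Omega>"
  shows "(\<lambda>x. w x - c *\<^sub>R z x) \<in> Lp p \<Omega>"
    and "(\<integral>x. norm (w x - c *\<^sub>R z x) powr p \<partial>lebesgue_on \<Omega>) \<le>
      2 powr p * ((\<integral>x. norm (w x) powr p \<partial>lebesgue_on \<Omega>) + \<bar>c\<bar> powr p * (\<integral>x. norm (z x) powr p \<partial>lebesgue_on \<Omega>))"
proof -
  have m: "w \<in> borel_measurable (lebesgue_on \<Omega>)" "z \<in> borel_measurable (lebesgue_on \<Omega>)"
    and i: "integrable (lebesgue_on \<Omega>) (\<lambda>x. norm (w x) powr p)" "integrable (lebesgue_on \<Omega>) (\<lambda>x. norm (z x) powr p)"
    using assms(2,3) by (auto simp: Lp_def)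
  let ?R = "\<lambda>x. 2 powr p * (norm (w x) powr p + \<bar>c\<bar> powr p * norm (z x) powr p)"
  have R: "integrable (lebesgue_on \<Omega>) ?R"
    using i by simp
  have le: "norm (w x - c *\<^sub>R z x) powr p \<le> ?R x" for x
    using norm_diff_powr_le[OF assms(1), of "w x" "c *\<^sub>R z x"] by (simp add: powr_mult)
  have L: "integrable (lebesgue_on \<Omega>) (\<lambda>x. norm (w x - c *\<^sub>R z x) powr p)"
    by (rule Bochner_Integration.integrable_bound[OF R])
      (use m le in \<open>auto intro: order_trans[OF _ abs_ge_self]\<close>)
  then show "(\<lambda>x. w x - c *\<^sub>R z x) \<in> Lp p \<Omega>"
    using m by (simp add: Lp_def)
  have "(\<integral>x. norm (w x - c *\<^sub>R z x) powr p \<partial>lebesgue_on \<Omega>) \<le> (\<integral>x. ?R x \<partial>lebesgue_on \<Omega>)"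
    using L R le by (rule integral_mono)
  then show "(\<integral>x. norm (w x - c *\<^sub>R z x) powr p \<partial>lebesgue_on \<Omega>) \<le>
      2 powr p * ((\<integral>x. norm (w x) powr p \<partial>lebesgue_on \<Omega>) + \<bar>c\<bar> powr p * (\<integral>x. norm (z x) powr p \<partial>lebesgue_on \<Omega>))"
    using i by simp
qed

lemma finite_measure_lebesgue_on_bounded:
  "open \<Omega> \<Longrightarrow> bounded \<Omega> \<Longrightarrow> finite_measure (lebesgue_on (\<Omega>::'a::euclidean_space set))"
  by (intro finite_measure_lebesgue_on bounded_set_imp_lmeasurable) auto

lemma Lp_bounded:
  fixes w :: "'a::euclidean_space \<Rightarrow> 'b::euclidean_space"
  assumes "open \<Omega>" "bounded \<Omega>" "0 \<le> p" "w \<in> borel_measurable (lebesgue_on \<Omega>)"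
    "\<And>x. x \<in> \<Omega> \<Longrightarrow> norm (w x) \<le> M"
  shows "w \<in> Lp p \<Omega>"
proof -
  interpret finite_measure "lebesgue_on \<Omega>"
    using assms by (intro finite_measure_lebesgue_on_bounded)
  have "integrable (lebesgue_on \<Omega>) (\<lambda>x. norm (w x) powr p)"
    by (rule integrable_const_bound[of _ "M powr p"])
      (use assms in \<open>auto intro!: AE_I2 powr_mono2\<close>)
  with assms(4) show ?thesis by (simp add: Lp_def)
qed

text \<open>\<open>W1p_norm\<close> and \<open>W1p\<close> refer to different, possibly distinct
  choices of gradient; by uniqueness any weak gradient may be used for both.\<close>

lemma weak_gradient_Lp:
  assumes "open \<Omega>" "w \<in> W1p p \<Omega>" "is_weak_gradient \<Omega> w G"
  shows "G \<in> Lp p \<Omega>"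
    and "W1p_norm p \<Omega> w = ((\<integral>x. norm (w x) powr p \<partial>lebesgue_on \<Omega>) +
      (\<integral>x. norm (G x) powr p \<partial>lebesgue_on \<Omega>)) powr (1 / p)"
proof -
  obtain H where H: "H \<in> Lp p \<Omega>" "is_weak_gradient \<Omega> w H"
    using assms(2) by (auto simp: W1p_def)
  have \<Omega>: "\<Omega> \<in> sets lebesgue" using assms(1) by auto
  show G: "G \<in> Lp p \<Omega>"
    using Lp_cong_AE(1)[OF \<Omega> H(1) is_weak_gradient_unique[OF assms(1) H(2) assms(3)]] .
  have "is_weak_gradient \<Omega> w (weak_gradient \<Omega> w)"
    unfolding weak_gradient_def using assms(3) by (rule someI[of "is_weak_gradient \<Omega> w"])
  from Lp_cong_AE(2)[OF \<Omega> G is_weak_gradient_unique[OF assms(1,3) this]]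
  show "W1p_norm p \<Omega> w = ((\<integral>x. norm (w x) powr p \<partial>lebesgue_on \<Omega>) +
      (\<integral>x. norm (G x) powr p \<partial>lebesgue_on \<Omega>)) powr (1 / p)"
    by (simp add: W1p_norm_def)
qed

lemma W1p_norm_powr:
  assumes "open \<Omega>" "0 < p" "w \<in> W1p p \<Omega>" "is_weak_gradient \<Omega> w G"
  shows "W1p_norm p \<Omega> w powr p = (\<integral>x. norm (w x) powr p \<partial>lebesgue_on \<Omega>) +
      (\<integral>x. norm (G x) powr p \<partial>lebesgue_on \<Omega>)"
proof -
  have "0 \<le> (\<integral>x. norm (w x) powr p \<partial>lebesgue_on \<Omega>) + (\<integral>x. norm (G x) powr p \<partial>lebesgue_on \<Omega>)"
    by (intro add_nonneg_nonneg integral_nonneg) auto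
  then show ?thesis
    using weak_gradient_Lp(2)[OF assms(1,3,4)] assms(2) by (simp add: powr_powr)
qed

text \<open>The quantitative part is a triangle inequality up to a constant for \<open>p\<close>-th
  powers, inherited from the pointwise bound for \<open>w\<close> and for the gradient
  separately.\<close>

lemma W1p_diff_scaleR:
  assumes "open \<Omega>" "0 < p" "w \<in> W1p p \<Omega>" "z \<in> W1p p \<Omega>"
  shows "(\<lambda>x. w x - c *\<^sub>R z x) \<in> W1p p \<Omega>"
    and "W1p_norm p \<Omega> (\<lambda>x. w x - c *\<^sub>R z x) powr p \<le>
      2 powr p * (W1p_norm p \<Omega> w powr p + \<bar>c\<bar> powr p * W1p_norm p \<Omega> z powr p)"
proof -
  obtain G where G: "G \<in> Lp p \<Omega>" "is_weak_gradient \<Omega> w G" and w: "w \<in> Lp p \<Omega>"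
    using assms(3) by (auto simp: W1p_def)
  obtain H where H: "H \<in> Lp p \<Omega>" "is_weak_gradient \<Omega> z H" and z: "z \<in> Lp p \<Omega>"
    using assms(4) by (auto simp: W1p_def)
  have D: "is_weak_gradient \<Omega> (\<lambda>x. w x - c *\<^sub>R z x) (\<lambda>x. G x - c *\<^sub>R H x)"
    using assms(1) G(2) H(2) by (rule is_weak_gradient_diff_scaleR)
  have p: "0 \<le> p" using assms(2) by simp
  show W: "(\<lambda>x. w x - c *\<^sub>R z x) \<in> W1p p \<Omega>"
    unfolding W1p_def using Lp_diff_scaleR(1)[OF p w z] Lp_diff_scaleR(1)[OF p G(1) H(1)] D by auto
  show "W1p_norm p \<Omega> (\<lambda>x. w x - c *\<^sub>R z x) powr p \<le>
      2 powr p * (W1p_norm p \<Omega> w powr p + \<bar>c\<bar> powr p * W1p_norm p \<Omega> z powr p)"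
    unfolding W1p_norm_powr[OF assms(1,2) W D] W1p_norm_powr[OF assms(1-3) G(2)]
      W1p_norm_powr[OF assms(1,2,4) H(2)]
    using Lp_diff_scaleR(2)[OF p w z, of c] Lp_diff_scaleR(2)[OF p G(1) H(1), of c]
    by (simp add: algebra_simps)
qed

lemma borel_measurable_lebesgue_on_continuous:
  "open \<Omega> \<Longrightarrow> continuous_on \<Omega> w \<Longrightarrow> w \<in> borel_measurable (lebesgue_on \<Omega>)"
  by (intro continuous_imp_measurable_on_sets_lebesgue) auto

lemma continuous_compact_support_bounded:
  fixes \<phi> :: "'a::euclidean_space \<Rightarrow> 'b::real_normed_vector"
  assumes "continuous_on UNIV \<phi>" "compact K" "\<And>x. x \<notin> K \<Longrightarrow> \<phi> x = 0"
  obtains B where "\<And>x. norm (\<phi> x) \<le> B"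
proof -
  obtain B where B: "\<And>x. x \<in> K \<Longrightarrow> norm (\<phi> x) \<le> B"
    using compact_imp_bounded[OF compact_continuous_image[OF continuous_on_subset[OF assms(1)] assms(2)]]
    by (auto simp: bounded_iff)
  have "norm (\<phi> x) \<le> \<bar>B\<bar>" for x
    using B[of x] assms(3)[of x] by (cases "x \<in> K") auto
  then show ?thesis using that by blast
qed

lemma test_functions_W1p:
  fixes w :: "real^'n \<Rightarrow> real^'m"
  assumes "open \<Omega>" "bounded \<Omega>" "0 \<le> p" "w \<in> test_functions \<Omega>"
  shows "w \<in> W1p p \<Omega>"
proof -
  obtain K where K: "compact K" "\<And>x. x \<notin> K \<Longrightarrow> w x = 0" "\<And>x h. x \<notin> K \<Longrightarrow> frechet_derivative w (at x) h = 0"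
    using test_functions_support[OF assms(4)] by metis
  have sm: "smooth w" using assms(4) by (rule test_functions_smooth)
  obtain A where A: "\<And>x. norm (w x) \<le> A"
    using continuous_compact_support_bounded[OF smooth_continuous_on[OF sm] K(1,2)] by blast
  have "cgrad w x = 0" if "x \<notin> K" for x
    using K(3) that by (simp add: cgrad_def vec_eq_iff)
  then obtain B where B: "\<And>x. norm (cgrad w x) \<le> B"
    using continuous_compact_support_bounded[OF continuous_on_cgrad[OF sm] K(1)] by blast
  have "w \<in> Lp p \<Omega>" "cgrad w \<in> Lp p \<Omega>"
    using assms A B sm
    by (auto intro!: Lp_bounded borel_measurable_lebesgue_on_continuous smooth_continuous_on continuous_on_cgrad)
  then show ?thesis
    using is_weak_gradient_cgrad[OF assms(1,4)] by (auto simp: W1p_def)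
qed

section \<open>Smooth test curves\<close>

text \<open>Smoothness enters at every level: \<open>frechet_derivative\<close> is linear in the
  function only where the functions are differentiable.\<close>

lemma iter_deriv_linear_combination:
  fixes \<phi> \<psi> :: "'a::euclidean_space \<Rightarrow> 'b::euclidean_space"
  assumes "smooth \<phi>" "smooth \<psi>"
  shows "iter_deriv hs (\<lambda>x. a *\<^sub>R \<phi> x + b *\<^sub>R \<psi> x) =
    (\<lambda>x. a *\<^sub>R iter_deriv hs \<phi> x + b *\<^sub>R iter_deriv hs \<psi> x)"
  using assms
proof (induction hs arbitrary: \<phi> \<psi>)
  case (Cons h hs)
  have "((\<lambda>x. a *\<^sub>R \<phi> x + b *\<^sub>R \<psi> x) has_derivative
    (\<lambda>h. a *\<^sub>R frechet_derivative \<phi> (at x) h + b *\<^sub>R frechet_derivative \<psi> (at x) h)) (at x)" for x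
    by (intro has_derivative_add has_derivative_scaleR_right smooth_has_derivative Cons.prems)
  from frechet_derivative_at[OF this, symmetric]
  show ?case
    using Cons.IH[OF smooth_derivative[OF Cons.prems(1), of h] smooth_derivative[OF Cons.prems(2), of h]]
    by simp
qed simp

lemma smooth_linear:
  fixes \<phi> \<psi> :: "'a::euclidean_space \<Rightarrow> 'b::euclidean_space"
  assumes "smooth \<phi>" "smooth \<psi>"
  shows "smooth (\<lambda>x. a *\<^sub>R \<phi> x + b *\<^sub>R \<psi> x)"
  using assms unfolding smooth_def iter_deriv_linear_combination[OF assms]
  by (auto intro!: derivative_intros)

lemma smooth_scaleR:
  fixes \<phi> :: "'a::euclidean_space \<Rightarrow> 'b::euclidean_space"
  assumes "smooth \<phi>"
  shows "smooth (\<lambda>x. a *\<^sub>R \<phi> x)" and "iter_deriv hs (\<lambda>x. a *\<^sub>R \<phi> x) = (\<lambda>x. a *\<^sub>R iter_deriv hs \<phi> x)"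
  using smooth_linear[OF assms assms, of a 0] iter_deriv_linear_combination[OF assms assms, of hs a 0]
  by simp_all

text \<open>Spatial derivatives commute with time difference quotients, so \<open>test_limit\<close>
  for the slopes becomes a statement about the slopes of each spatial derivative.\<close>

lemma smooth_slope:
  fixes \<phi> \<psi> :: "'a::euclidean_space \<Rightarrow> 'b::euclidean_space"
  assumes "smooth \<phi>" "smooth \<psi>"
  shows "smooth (\<lambda>x. (\<phi> x - \<psi> x) /\<^sub>R r)"
    and "iter_deriv hs (\<lambda>x. (\<phi> x - \<psi> x) /\<^sub>R r) = (\<lambda>x. (iter_deriv hs \<phi> x - iter_deriv hs \<psi> x) /\<^sub>R r)"
  using smooth_linear[OF assms, of "inverse r" "- inverse r"]
    iter_deriv_linear_combination[OF assms, of hs "inverse r" "- inverse r"]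
  by (simp_all add: algebra_simps)

lemma test_functions_scaleR:
  fixes \<phi> :: "'a::euclidean_space \<Rightarrow> 'b::euclidean_space"
  shows "\<phi> \<in> test_functions \<Omega> \<Longrightarrow> (\<lambda>x. c *\<^sub>R \<phi> x) \<in> test_functions \<Omega>"
  unfolding test_functions_def by (force intro: smooth_scaleR)

lemma test_functions_iter_deriv:
  fixes \<phi> :: "'a::euclidean_space \<Rightarrow> 'b::euclidean_space"
  shows "\<phi> \<in> test_functions \<Omega> \<Longrightarrow> iter_deriv hs \<phi> \<in> test_functions \<Omega>"
proof (induction hs arbitrary: \<phi>)
  case (Cons h hs)
  obtain K where "compact K" "K \<subseteq> \<Omega>" "\<And>x h. x \<notin> K \<Longrightarrow> frechet_derivative \<phi> (at x) h = 0"
    using test_functions_support[OF Cons.prems] by metis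
  then have "(\<lambda>x. frechet_derivative \<phi> (at x) h) \<in> test_functions \<Omega>"
    using smooth_derivative[OF test_functions_smooth[OF Cons.prems]] by (auto simp: test_functions_def)
  then show ?case using Cons.IH by simp
qed simp

lemma test_functions_bounded:
  fixes \<phi> :: "'a::euclidean_space \<Rightarrow> 'b::euclidean_space"
  assumes "\<phi> \<in> test_functions \<Omega>"
  obtains B where "\<And>x. norm (\<phi> x) \<le> B"
proof -
  obtain K where "compact K" "\<And>x. x \<notin> K \<Longrightarrow> \<phi> x = 0"
    using test_functions_support[OF assms] by metis
  then show ?thesis
    using continuous_compact_support_bounded[OF smooth_continuous_on[OF test_functions_smooth[OF assms]]] that
    by metis
qed

section \<open>Convergence of test functions and scaling of test curves\<close>

lemma eventually_mem_within: "\<forall>\<^sub>F s in at t within S. s \<in> S \<and> s \<noteq> t"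
  by (simp add: eventually_at_filter)

lemma test_limit_uniform_limit:
  "test_limit \<Omega> \<phi> \<psi> F \<Longrightarrow> uniform_limit UNIV (\<lambda>s. iter_deriv hs (\<phi> s)) (iter_deriv hs \<psi>) F"
  by (simp add: test_limit_def)

lemma test_limit_scaleR:
  fixes \<psi> :: "'a::euclidean_space \<Rightarrow> 'b::euclidean_space"
  assumes lim: "test_limit \<Omega> \<phi> \<psi> F" and sm: "\<forall>\<^sub>F s in F. smooth (\<phi> s)" "smooth \<psi>"
  shows "test_limit \<Omega> (\<lambda>s x. c *\<^sub>R \<phi> s x) (\<lambda>x. c *\<^sub>R \<psi> x) F"
proof -
  obtain K where K: "compact K" "K \<subseteq> \<Omega>" "\<forall>\<^sub>F s in F. \<forall>x. x \<notin> K \<longrightarrow> \<phi> s x = 0" "\<forall>x. x \<notin> K \<longrightarrow> \<psi> x = 0"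
    using lim unfolding test_limit_def by blast
  have K': "\<forall>\<^sub>F s in F. \<forall>x. x \<notin> K \<longrightarrow> c *\<^sub>R \<phi> s x = 0"
    using K(3) by eventually_elim simp
  have "uniform_limit UNIV (\<lambda>s. iter_deriv hs (\<lambda>x. c *\<^sub>R \<phi> s x)) (iter_deriv hs (\<lambda>x. c *\<^sub>R \<psi> x)) F" for hs
  proof -
    have "uniform_limit UNIV (\<lambda>s x. c *\<^sub>R iter_deriv hs (\<phi> s) x) (\<lambda>x. c *\<^sub>R iter_deriv hs \<psi> x) F"
      by (intro bounded_linear.uniform_limit[OF bounded_linear_scaleR_right] test_limit_uniform_limit[OF lim])
    moreover have "\<forall>\<^sub>F s in F. \<forall>x\<in>UNIV. c *\<^sub>R iter_deriv hs (\<phi> s) x = iter_deriv hs (\<lambda>x. c *\<^sub>R \<phi> s x) x"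
      using sm(1) by eventually_elim (simp add: smooth_scaleR)
    ultimately show ?thesis
      by (rule uniform_limit_cong[THEN iffD1, rotated 2]) (simp add: smooth_scaleR sm(2))
  qed
  then show ?thesis
    unfolding test_limit_def
    by (intro conjI allI exI[of _ K] K(1,2) K') (use K(4) in auto)
qed

lemma smooth_test_curvesE:
  assumes "\<eta> \<in> smooth_test_curves \<Omega> T"
  obtains H where "\<And>t. t \<in> {0..T} \<Longrightarrow> H 0 t = \<eta> t"
    "\<And>k t. t \<in> {0..T} \<Longrightarrow> H k t \<in> test_functions \<Omega>"
    "\<And>k t. t \<in> {0..T} \<Longrightarrow>
      test_limit \<Omega> (\<lambda>s x. (H k s x - H k t x) /\<^sub>R (s - t)) (H (Suc k) t) (at t within {0..T})"
  using assms unfolding smooth_test_curves_def by blast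

text \<open>Scaling all time derivatives by \<open>c\<close> gives the witness. It admits
  \<open>\<epsilon> \<eta>\<close> of either sign in the minimality condition.\<close>

lemma smooth_test_curves_scaleR:
  assumes "\<eta> \<in> smooth_test_curves \<Omega> T"
  shows "(\<lambda>t x. c *\<^sub>R \<eta> t x) \<in> smooth_test_curves \<Omega> T"
proof -
  obtain H where H0: "\<And>t. t \<in> {0..T} \<Longrightarrow> H 0 t = \<eta> t"
    and H: "\<And>k t. t \<in> {0..T} \<Longrightarrow> H k t \<in> test_functions \<Omega>"
      "\<And>k t. t \<in> {0..T} \<Longrightarrow> test_limit \<Omega> (\<lambda>s x. (H k s x - H k t x) /\<^sub>R (s - t)) (H (Suc k) t) (at t within {0..T})"
    by (fact smooth_test_curvesE[OF assms(1)])
  have "test_limit \<Omega> (\<lambda>s x. (c *\<^sub>R H k s x - c *\<^sub>R H k t x) /\<^sub>R (s - t)) (\<lambda>x. c *\<^sub>R H (Suc k) t x) (at t within {0..T})"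
    if t: "t \<in> {0..T}" for k t
  proof -
    \<comment> \<open>\<open>H k s\<close> is known to be a test function only for \<open>s\<close>
      in the interval, hence the restricted filter.\<close>
    have "\<forall>\<^sub>F s in at t within {0..T}. smooth (\<lambda>x. (H k s x - H k t x) /\<^sub>R (s - t))"
      using eventually_mem_within
      by eventually_elim (use t H(1) test_functions_smooth in \<open>blast intro: smooth_slope\<close>)
    from test_limit_scaleR[OF H(2)[OF t] this test_functions_smooth[OF H(1)[OF t]], of c]
    show ?thesis by (simp add: algebra_simps)
  qed
  then show ?thesis
    unfolding smooth_test_curves_def using H0 H(1)
    by (intro CollectI exI[of _ "\<lambda>k t x. c *\<^sub>R H k t x"]) (auto intro: test_functions_scaleR)
qed

lemma smooth_test_curves_test_functions:
  assumes "\<eta> \<in> smooth_test_curves \<Omega> T" and t: "t \<in> {0..T}"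
  shows "\<eta> t \<in> test_functions \<Omega>"
proof -
  obtain H where H: "\<And>t. t \<in> {0..T} \<Longrightarrow> H 0 t = \<eta> t"
    "\<And>k t. t \<in> {0..T} \<Longrightarrow> H k t \<in> test_functions \<Omega>"
      "\<And>k t. t \<in> {0..T} \<Longrightarrow> test_limit \<Omega> (\<lambda>s x. (H k s x - H k t x) /\<^sub>R (s - t)) (H (Suc k) t) (at t within {0..T})"
    by (fact smooth_test_curvesE[OF assms(1)])
  from H(2)[OF t, of 0] show ?thesis by (simp add: H(1)[OF t])
qed

text \<open>Convergence of the slopes in the space of test functions contains uniform, hence
  pointwise, convergence (no spatial derivative taken), and at an interior time the limit is
  two-sided. It is needed to pull a constant out of \<open>vector_derivative\<close>.\<close>

lemma smooth_test_curves_differentiable: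
  fixes \<eta> :: "real \<Rightarrow> 'a::euclidean_space \<Rightarrow> 'b::euclidean_space"
  assumes "\<eta> \<in> smooth_test_curves \<Omega> T" "t \<in> {0<..<T}"
  shows "(\<lambda>s. \<eta> s x) differentiable (at t)"
proof -
  obtain H where H0: "\<And>t. t \<in> {0..T} \<Longrightarrow> H 0 t = \<eta> t"
    and "\<And>k t. t \<in> {0..T} \<Longrightarrow> H k t \<in> test_functions \<Omega>"
    and H: "\<And>k t. t \<in> {0..T} \<Longrightarrow> test_limit \<Omega> (\<lambda>s x. (H k s x - H k t x) /\<^sub>R (s - t)) (H (Suc k) t) (at t within {0..T})"
    by (fact smooth_test_curvesE[OF assms(1)])
  have t: "t \<in> {0..T}" "t \<in> interior {0..T}" using assms(2) by auto
  have "uniform_limit UNIV (\<lambda>s. iter_deriv [] (\<lambda>x. (H 0 s x - H 0 t x) /\<^sub>R (s - t))) (iter_deriv [] (H (Suc 0) t)) (at t)"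
    using test_limit_uniform_limit[OF H[OF t(1), of 0]] unfolding at_within_interior[OF t(2)] .
  then have "((\<lambda>s. (H 0 s x - H 0 t x) /\<^sub>R (s - t)) \<longlongrightarrow> H 1 t x) (at t)"
    by (auto dest: tendsto_uniform_limitI[where x = x])
  then have "((\<lambda>s. norm ((H 0 s x - H 0 t x) /\<^sub>R (s - t) - H 1 t x)) \<longlongrightarrow> 0) (at t)"
    by (simp add: LIM_zero tendsto_norm_zero)
  then have "((\<lambda>s. norm ((H 0 s x - H 0 t x) - (s - t) *\<^sub>R H 1 t x) / norm (s - t)) \<longlongrightarrow> 0) (at t)"
  proof (rule Lim_transform_eventually)
    show "\<forall>\<^sub>F s in at t. norm ((H 0 s x - H 0 t x) /\<^sub>R (s - t) - H 1 t x) =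
       norm ((H 0 s x - H 0 t x) - (s - t) *\<^sub>R H 1 t x) / norm (s - t)"
      using eventually_mem_within[of UNIV t]
    proof eventually_elim
      case (elim s)
      then have "(H 0 s x - H 0 t x) /\<^sub>R (s - t) - H 1 t x = ((H 0 s x - H 0 t x) - (s - t) *\<^sub>R H 1 t x) /\<^sub>R (s - t)"
        by (simp add: scaleR_diff_right)
      then show ?case by (simp add: divide_inverse mult.commute)
    qed
  qed
  then have "((\<lambda>s. H 0 s x) has_derivative (\<lambda>r. r *\<^sub>R H 1 t x)) (at t)"
    by (simp add: has_derivative_iff_norm bounded_linear_scaleR_left)
  \<comment> \<open>\<open>H 0\<close> and \<open>\<eta>\<close> agree only on the closed interval;
    its interior is a neighbourhood of \<open>t\<close>.\<close>
  then have "((\<lambda>s. \<eta> s x) has_derivative (\<lambda>r. r *\<^sub>R H 1 t x)) (at t)"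
    by (rule has_derivative_transform_within_open[of _ _ _ _ "{0<..<T}"]) (use assms(2) H0 in auto)
  then show ?thesis by (auto simp: differentiable_def)
qed

text \<open>Near \<open>t\<close> the slopes are within 1 of \<open>E\<close>, hence bounded by
  \<open>\<bar>B\<bar> + 1\<close> uniformly in \<open>x\<close>; the increment is
  \<open>s - t\<close> times the slope.\<close>

lemma uniform_limit_of_slopes:
  fixes D :: "real \<Rightarrow> 'a \<Rightarrow> 'b::real_normed_vector"
  assumes lim: "uniform_limit X (\<lambda>s x. (D s x - D t x) /\<^sub>R (s - t)) E (at t within S)"
    and B: "\<And>x. norm (E x) \<le> B"
  shows "uniform_limit X D (D t) (at t within S)"
proof (rule uniform_limitI)
  fix e :: real assume e: "e > 0"
  have "\<forall>\<^sub>F s in at t within S. dist s t < e / (\<bar>B\<bar> + 1)"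
    using tendstoD[OF tendsto_ident_at, of "e / (\<bar>B\<bar> + 1)" t S] e by simp
  moreover have "\<forall>\<^sub>F s in at t within S. \<forall>x\<in>X. dist ((D s x - D t x) /\<^sub>R (s - t)) (E x) < 1"
    using lim by (rule uniform_limitD) simp
  ultimately show "\<forall>\<^sub>F s in at t within S. \<forall>x\<in>X. dist (D s x) (D t x) < e"
    using eventually_mem_within[of S t]
  proof eventually_elim
    case (elim s)
    show ?case
    proof
      fix x assume "x \<in> X"
      let ?q = "(D s x - D t x) /\<^sub>R (s - t)"
      have "norm ?q \<le> norm (E x) + norm (?q - E x)" by (rule norm_triangle_sub)
      then have q: "norm ?q \<le> \<bar>B\<bar> + 1"
        using elim(2) \<open>x \<in> X\<close> B[of x] unfolding dist_norm by fastforce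
      have "dist (D s x) (D t x) = \<bar>s - t\<bar> * norm ?q"
        using elim(3) by (simp add: dist_norm)
      also have "\<dots> \<le> \<bar>s - t\<bar> * (\<bar>B\<bar> + 1)" using q by (intro mult_left_mono) auto
      also have "\<dots> < e / (\<bar>B\<bar> + 1) * (\<bar>B\<bar> + 1)"
        using elim(1) by (intro mult_strict_right_mono) (auto simp: dist_real_def)
      finally show "dist (D s x) (D t x) < e" by simp
    qed
  qed
qed

text \<open>The slopes of every spatial derivative converge uniformly to a spatial derivative of the
  first time derivative. The latter is a test function, hence bounded, so the previous lemma
  applies.\<close>

lemma smooth_test_curves_uniform_limit:
  fixes \<eta> :: "real \<Rightarrow> 'a::euclidean_space \<Rightarrow> 'b::euclidean_space"
  assumes "\<eta> \<in> smooth_test_curves \<Omega> T" "t \<in> {0..T}"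
  shows "uniform_limit UNIV (\<lambda>s. iter_deriv hs (\<eta> s)) (iter_deriv hs (\<eta> t)) (at t within {0..T})"
proof -
  obtain H where H0: "\<And>t. t \<in> {0..T} \<Longrightarrow> H 0 t = \<eta> t"
    and H: "\<And>k t. t \<in> {0..T} \<Longrightarrow> H k t \<in> test_functions \<Omega>"
      "\<And>k t. t \<in> {0..T} \<Longrightarrow> test_limit \<Omega> (\<lambda>s x. (H k s x - H k t x) /\<^sub>R (s - t)) (H (Suc k) t) (at t within {0..T})"
    by (fact smooth_test_curvesE[OF assms(1)])
  have "uniform_limit UNIV (\<lambda>s. iter_deriv hs (\<lambda>x. (H 0 s x - H 0 t x) /\<^sub>R (s - t))) (iter_deriv hs (H (Suc 0) t)) (at t within {0..T})"
    by (rule test_limit_uniform_limit[OF H(2)[OF assms(2), of 0]])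
  moreover have "\<forall>\<^sub>F s in at t within {0..T}. \<forall>x\<in>UNIV. iter_deriv hs (\<lambda>x. (H 0 s x - H 0 t x) /\<^sub>R (s - t)) x =
     (iter_deriv hs (\<eta> s) x - iter_deriv hs (\<eta> t) x) /\<^sub>R (s - t)"
    using eventually_mem_within[of "{0..T}" t]
  proof eventually_elim
    case (elim s)
    then have "smooth (\<eta> s)" "smooth (\<eta> t)" "H 0 s = \<eta> s" "H 0 t = \<eta> t"
      using H(1)[of s 0] H(1)[OF assms(2), of 0] H0 assms(2) by (auto intro: test_functions_smooth)
    then show ?case by (simp add: smooth_slope)
  qed
  ultimately have "uniform_limit UNIV (\<lambda>s x. (iter_deriv hs (\<eta> s) x - iter_deriv hs (\<eta> t) x) /\<^sub>R (s - t))
     (iter_deriv hs (H (Suc 0) t)) (at t within {0..T})"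
    by (rule uniform_limit_cong[THEN iffD1, rotated 2]) simp
  moreover obtain B where "\<And>x. norm (iter_deriv hs (H (Suc 0) t) x) \<le> B"
    using test_functions_bounded[OF test_functions_iter_deriv[OF H(1)[OF assms(2)]]] by metis
  ultimately show ?thesis by (rule uniform_limit_of_slopes)
qed

lemma uniform_limit_vec_lambda:
  fixes f :: "'s \<Rightarrow> 'a \<Rightarrow> 'b::real_normed_vector^'m"
  assumes "\<And>i. uniform_limit X (\<lambda>s x. f s x $ i) (\<lambda>x. g x $ i) F"
  shows "uniform_limit X f g F"
proof (rule uniform_limitI)
  fix e :: real assume e: "e > 0"
  let ?d = "e / real CARD('m)"
  have "\<forall>\<^sub>F s in F. \<forall>x\<in>X. dist (f s x $ i) (g x $ i) < ?d" for i
    using uniform_limitD[OF assms[of i], of ?d] e by simp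
  then have "\<forall>\<^sub>F s in F. \<forall>i. \<forall>x\<in>X. dist (f s x $ i) (g x $ i) < ?d"
    by (simp add: eventually_all_finite)
  then show "\<forall>\<^sub>F s in F. \<forall>x\<in>X. dist (f s x) (g x) < e"
  proof eventually_elim
    case (elim s)
    show ?case
    proof
      fix x assume x: "x \<in> X"
      have "dist (f s x) (g x) \<le> (\<Sum>i\<in>UNIV. dist (f s x $ i) (g x $ i))"
        unfolding dist_vec_def by (intro L2_set_le_sum) auto
      also have "\<dots> < (\<Sum>i\<in>(UNIV::'m set). ?d)"
        using elim x by (intro sum_strict_mono) auto
      also have "\<dots> = e" by simp
      finally show "dist (f s x) (g x) < e" .
    qed
  qed
qed

lemma smooth_test_curves_uniform_limit_cgrad:
  fixes \<eta> :: "real \<Rightarrow> real^'n \<Rightarrow> real^'m"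
  assumes "\<eta> \<in> smooth_test_curves \<Omega> T" "t \<in> {0..T}"
  shows "uniform_limit UNIV (\<lambda>s. cgrad (\<eta> s)) (cgrad (\<eta> t)) (at t within {0..T})"
proof (intro uniform_limit_vec_lambda)
  fix i \<alpha>
  show "uniform_limit UNIV (\<lambda>s x. cgrad (\<eta> s) x $ i $ \<alpha>) (\<lambda>x. cgrad (\<eta> t) x $ i $ \<alpha>) (at t within {0..T})"
    using bounded_linear.uniform_limit[OF bounded_linear_vec_nth[of i] smooth_test_curves_uniform_limit[OF assms, of "[axis \<alpha> 1]"]]
    by (simp add: cgrad_def)
qed

text \<open>Uniformity in space lets both variables move at once: first change the time at a fixed
  point \<open>y\<close>, at cost e/2 independent of \<open>y\<close>, then change the point at the
  fixed time \<open>t\<close>.\<close>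

lemma continuous_on_curve:
  fixes h :: "real \<Rightarrow> 'a::t2_space \<Rightarrow> 'b::metric_space"
  assumes cont: "\<And>t. t \<in> S \<Longrightarrow> continuous_on UNIV (h t)"
    and unif: "\<And>t. t \<in> S \<Longrightarrow> uniform_limit UNIV h (h t) (at t within S)"
  shows "continuous_on (UNIV \<times> S) (\<lambda>(x, t). h t x)"
  unfolding continuous_on_def
proof (clarify, rule tendstoI)
  fix x :: 'a and t e :: real assume t: "t \<in> S" and e: "e > 0"
  let ?F = "at (x, t) within UNIV \<times> S"
  have "\<forall>\<^sub>F s in at t within S. \<forall>y\<in>UNIV. dist (h s y) (h t y) < e / 2"
    using uniform_limitD[OF unif[OF t], of "e / 2"] e by simp
  then obtain U where U: "open U" "t \<in> U" "\<And>s y. s \<in> U \<Longrightarrow> s \<in> S \<Longrightarrow> s \<noteq> t \<Longrightarrow> dist (h s y) (h t y) < e / 2"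
    unfolding eventually_at_topological by auto
  have "isCont (h t) x" using cont[OF t] by (simp add: continuous_on_eq_continuous_at)
  then have "\<forall>\<^sub>F y in nhds x. dist (h t y) (h t x) < e / 2"
    unfolding isCont_def tendsto_at_iff_tendsto_nhds using e by (auto dest: tendstoD[where e = "e / 2"])
  then obtain V where V: "open V" "x \<in> V" "\<And>y. y \<in> V \<Longrightarrow> dist (h t y) (h t x) < e / 2"
    unfolding eventually_nhds by auto
  have "dist (h s y) (h t x) < e" if "(y, s) \<in> V \<times> U" "s \<in> S" for y s
  proof -
    have "dist (h s y) (h t y) < e / 2" using U(3)[of s y] that e by (cases "s = t") auto
    moreover have "dist (h t y) (h t x) < e / 2" using V(3) that by auto
    ultimately show ?thesis using dist_triangle[of "h s y" "h t x" "h t y"] by linarith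
  qed
  then show "\<forall>\<^sub>F z in ?F. dist (case z of (x, t) \<Rightarrow> h t x) (h t x) < e"
    unfolding eventually_at_topological using U(1,2) V(1,2)
    by (intro exI[of _ "V \<times> U"]) (auto intro: open_Times)
qed

lemma smooth_test_curves_continuous:
  fixes \<eta> :: "real \<Rightarrow> real^'n \<Rightarrow> real^'m"
  assumes "\<eta> \<in> smooth_test_curves \<Omega> T"
  shows "continuous_on (UNIV \<times> {0..T}) (\<lambda>(x, t). \<eta> t x)"
    and "continuous_on (UNIV \<times> {0..T}) (\<lambda>(x, t). cgrad (\<eta> t) x)"
proof -
  have sm: "smooth (\<eta> t)" if "t \<in> {0..T}" for t
    using smooth_test_curves_test_functions[OF assms that] by (rule test_functions_smooth)
  show "continuous_on (UNIV \<times> {0..T}) (\<lambda>(x, t). \<eta> t x)"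
    using smooth_continuous_on[OF sm] smooth_test_curves_uniform_limit[OF assms, of _ "[]"]
    by (intro continuous_on_curve) simp_all
  show "continuous_on (UNIV \<times> {0..T}) (\<lambda>(x, t). cgrad (\<eta> t) x)"
    using continuous_on_cgrad[OF sm] smooth_test_curves_uniform_limit_cgrad[OF assms]
    by (intro continuous_on_curve)
qed

text \<open>Joint continuity on the compact set
  \<open>closure \<Omega> \<times> {0..T}\<close>.\<close>

lemma smooth_test_curves_bounded:
  fixes \<eta> :: "real \<Rightarrow> real^'n \<Rightarrow> real^'m"
  assumes "bounded \<Omega>" and \<eta>: "\<eta> \<in> smooth_test_curves \<Omega> T"
  obtains M where "M \<ge> 0" "\<And>x t. x \<in> \<Omega> \<Longrightarrow> t \<in> {0..T} \<Longrightarrow> norm (\<eta> t x) \<le> M"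
    "\<And>x t. x \<in> \<Omega> \<Longrightarrow> t \<in> {0..T} \<Longrightarrow> norm (cgrad (\<eta> t) x) \<le> M"
proof -
  let ?K = "closure \<Omega> \<times> {0..T}"
  have K: "compact ?K" using assms(1) by (intro compact_Times) auto
  have "continuous_on ?K (\<lambda>(x, t). \<eta> t x)"
    by (rule continuous_on_subset[OF smooth_test_curves_continuous(1)[OF \<eta>]]) auto
  from compact_imp_bounded[OF compact_continuous_image[OF this K]]
  obtain A where A: "\<And>z. z \<in> ?K \<Longrightarrow> norm ((\<lambda>(x, t). \<eta> t x) z) \<le> A"
    unfolding bounded_iff by blast
  have "continuous_on ?K (\<lambda>(x, t). cgrad (\<eta> t) x)"
    by (rule continuous_on_subset[OF smooth_test_curves_continuous(2)[OF \<eta>]]) auto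
  from compact_imp_bounded[OF compact_continuous_image[OF this K]]
  obtain B where B: "\<And>z. z \<in> ?K \<Longrightarrow> norm ((\<lambda>(x, t). cgrad (\<eta> t) x) z) \<le> B"
    unfolding bounded_iff by blast
  show ?thesis
  proof (rule that[of "\<bar>A\<bar> + \<bar>B\<bar>"])
    fix x t assume "x \<in> \<Omega>" "t \<in> {0..T}"
    then have "(x, t) \<in> ?K" using closure_subset by auto
    from A[OF this] B[OF this]
    show "norm (\<eta> t x) \<le> \<bar>A\<bar> + \<bar>B\<bar>" "norm (cgrad (\<eta> t) x) \<le> \<bar>A\<bar> + \<bar>B\<bar>" by auto
  qed simp
qed

lemma smooth_test_curves_measurable:
  fixes \<eta> :: "real \<Rightarrow> real^'n \<Rightarrow> real^'m"
  assumes "open \<Omega>" and \<eta>: "\<eta> \<in> smooth_test_curves \<Omega> T"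
  shows "(\<lambda>(x, t). \<eta> t x) \<in> borel_measurable (cyl \<Omega> T)"
    and "(\<lambda>(x, t). cgrad (\<eta> t) x) \<in> borel_measurable (cyl \<Omega> T)"
  using assms(1) smooth_test_curves_continuous[OF \<eta>]
  by (auto intro!: continuous_imp_measurable_on_sets_lebesgue elim!: continuous_on_subset)

section \<open>Competitors\<close>

text \<open>\<open>bochner_Lp\<close> lives on the closed interval and the cylinder on the open one;
  the endpoints are the whole difference.\<close>

lemma null_endpoints: "{0, T::real} \<in> null_sets lebesgue"
  by (intro null_sets_completionI finite_imp_null_set_lborel) auto

lemma AE_closed_interval_iff:
  "(AE t in lebesgue_on {0..T::real}. P t) \<longleftrightarrow> (AE t in lebesgue_on {0<..<T}. P t)"
proof -
  have "(AE t in lebesgue. t \<in> {0..T} \<longrightarrow> P t) \<longleftrightarrow> (AE t in lebesgue. t \<in> {0<..<T} \<longrightarrow> P t)"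
    using AE_not_in[OF null_endpoints[of T]]
    by (intro iffI; elim eventually_rev_mp; intro eventually_mono[OF AE_not_in[OF null_endpoints[of T]]]) auto
  then show ?thesis by (simp add: AE_restrict_space_iff)
qed

lemma integrable_closed_interval_iff:
  fixes f :: "real \<Rightarrow> real"
  shows "integrable (lebesgue_on {0..T}) f \<longleftrightarrow> integrable (lebesgue_on {0<..<T}) f"
proof -
  let ?f = "\<lambda>S t. indicat_real S t *\<^sub>R f t"
  have ae: "AE t in lebesgue. ?f {0..T} t = ?f {0<..<T} t"
    using AE_not_in[OF null_endpoints[of T]] by eventually_elim (auto simp: indicator_def)
  have ae': "AE t in lebesgue. ?f {0<..<T} t = ?f {0..T} t"
    using ae by eventually_elim (rule sym)
  have ae_cong: "integrable lebesgue h" if "integrable lebesgue g" "AE t in lebesgue. g t = h t" for g h :: "real \<Rightarrow> real"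
  proof -
    have "h \<in> borel_measurable lebesgue"
      using borel_measurable_lebesgue_on_cong_AE[of UNIV g h, unfolded lebesgue_on_UNIV_eq] that by auto
    then show ?thesis using that by (intro integrable_cong_AE_imp[of lebesgue g h]) auto
  qed
  have "integrable lebesgue (?f {0..T}) \<longleftrightarrow> integrable lebesgue (?f {0<..<T})"
    using ae_cong[OF _ ae] ae_cong[OF _ ae'] by blast
  then show ?thesis by (simp add: integrable_restrict_space)
qed

text \<open>Uniqueness on almost every slice, lifted by \<open>AE_cylinderI\<close>. The lift needs
  the set of agreement to be measurable, which joint measurability of both gradients provides; the
  norm of the difference makes this a statement about one real function.\<close>

lemma is_spatial_gradient_unique:
  assumes "open \<Omega>" and G: "is_spatial_gradient \<Omega> T u G" and H: "is_spatial_gradient \<Omega> T u H"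
  shows "AE (x, t) in cyl \<Omega> T. G t x = H t x"
proof -
  have [measurable]: "(\<lambda>(x, t). G t x) \<in> borel_measurable (cyl \<Omega> T)" "(\<lambda>(x, t). H t x) \<in> borel_measurable (cyl \<Omega> T)"
    using G H by (auto simp: is_spatial_gradient_def)
  have "AE z in cyl \<Omega> T. norm ((\<lambda>(x, t). G t x) z - (\<lambda>(x, t). H t x) z) = 0"
  proof (rule AE_cylinderI[OF assms(1)])
    have "{z \<in> space (cyl \<Omega> T). norm ((\<lambda>(x, t). G t x) z - (\<lambda>(x, t). H t x) z) = 0} \<in> sets (cyl \<Omega> T)"
      by measurable
    then show "{z \<in> \<Omega> \<times> {0<..<T}. norm ((\<lambda>(x, t). G t x) z - (\<lambda>(x, t). H t x) z) = 0} \<in> sets (cyl \<Omega> T)"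
      by simp
    have "AE t in lebesgue_on {0<..<T}. is_weak_gradient \<Omega> (u t) (G t)" "AE t in lebesgue_on {0<..<T}. is_weak_gradient \<Omega> (u t) (H t)"
      using G H by (auto simp: is_spatial_gradient_def)
    then show "AE t in lebesgue_on {0<..<T}. AE x in lebesgue_on \<Omega>. norm ((\<lambda>(x, t). G t x) (x, t) - (\<lambda>(x, t). H t x) (x, t)) = 0"
    proof eventually_elim
      case (elim t)
      show ?case
        using is_weak_gradient_unique[OF assms(1) elim] by eventually_elim simp
    qed
  qed
  then show ?thesis by eventually_elim (simp add: case_prod_beta)
qed

text \<open>Tonelli, with the measurability of
  \<open>t \<mapsto> W1p_norm p \<Omega> (w t) powr p\<close> as a by-product. One direction
  extracts cylinder bounds for \<open>u\<close> and \<open>Du\<close>, the other returns them to the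
  Bochner norm of a competitor.\<close>

lemma integrable_W1p_norm_iff:
  fixes w :: "real \<Rightarrow> real^'n \<Rightarrow> real^'m"
  assumes \<Omega>: "open \<Omega>" and p: "0 < p" and w: "(\<lambda>(x, t). w t x) \<in> borel_measurable (cyl \<Omega> T)"
    and W: "is_spatial_gradient \<Omega> T w W" and ae: "AE t in lebesgue_on {0..T}. w t \<in> W1p p \<Omega>"
  shows "integrable (lebesgue_on {0..T}) (\<lambda>t. W1p_norm p \<Omega> (w t) powr p) \<longleftrightarrow>
    integrable (cyl \<Omega> T) (\<lambda>(x, t). norm (w t x) powr p + norm (W t x) powr p)"
proof -
  let ?N = "\<lambda>t. W1p_norm p \<Omega> (w t) powr p"
  let ?g = "\<lambda>(x, t). norm (w t x) powr p + norm (W t x) powr p"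
  have W': "(\<lambda>(x, t). W t x) \<in> borel_measurable (cyl \<Omega> T)" "AE t in lebesgue_on {0<..<T}. is_weak_gradient \<Omega> (w t) (W t)"
    using W by (auto simp: is_spatial_gradient_def)
  have "(\<lambda>z. norm ((\<lambda>(x, t). w t x) z) powr p + norm ((\<lambda>(x, t). W t x) z) powr p) \<in> borel_measurable (cyl \<Omega> T)"
    using w W'(1) by measurable
  then have g: "?g \<in> borel_measurable (cyl \<Omega> T)" by (simp add: case_prod_beta)
  have "AE t in lebesgue_on {0<..<T}. w t \<in> W1p p \<Omega>" using ae by (simp add: AE_closed_interval_iff)
  with W'(2) have slice: "AE t in lebesgue_on {0<..<T}. (\<integral>\<^sup>+x. ennreal (?g (x, t)) \<partial>lebesgue_on \<Omega>) = ennreal (?N t)"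
  proof eventually_elim
    case (elim t)
    have "w t \<in> Lp p \<Omega>" "W t \<in> Lp p \<Omega>"
      using elim weak_gradient_Lp(1)[OF \<Omega> elim(2,1)] by (auto simp: W1p_def)
    then have i: "integrable (lebesgue_on \<Omega>) (\<lambda>x. norm (w t x) powr p)" "integrable (lebesgue_on \<Omega>) (\<lambda>x. norm (W t x) powr p)"
      by (auto simp: Lp_def)
    have "(\<integral>\<^sup>+x. ennreal (?g (x, t)) \<partial>lebesgue_on \<Omega>) = ennreal (\<integral>x. ?g (x, t) \<partial>lebesgue_on \<Omega>)"
      using i by (intro nn_integral_eq_integral) auto
    also have "(\<integral>x. ?g (x, t) \<partial>lebesgue_on \<Omega>) = ?N t"
      using i W1p_norm_powr[OF \<Omega> p elim(2,1)] by simp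
    finally show ?case .
  qed
  have gm: "(\<lambda>z. ennreal (?g z)) \<in> borel_measurable (cyl \<Omega> T)" using g by measurable
  have "(\<lambda>t. ennreal (?N t)) \<in> borel_measurable (lebesgue_on {0<..<T})"
    by (rule borel_measurable_lebesgue_on_cong_AE[OF _ nn_integral_cylinder(1)[OF \<Omega> gm] slice]) simp
  then have "(\<lambda>t. enn2real (ennreal (?N t))) \<in> borel_measurable (lebesgue_on {0<..<T})"
    by (rule borel_measurable_enn2real)
  then have N: "?N \<in> borel_measurable (lebesgue_on {0<..<T})" by simp
  have eq: "(\<integral>\<^sup>+z. ennreal (?g z) \<partial>cyl \<Omega> T) = (\<integral>\<^sup>+t. ennreal (?N t) \<partial>lebesgue_on {0<..<T})"
    unfolding nn_integral_cylinder(2)[OF \<Omega> gm] by (rule nn_integral_cong_AE[OF slice])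
  have "integrable (lebesgue_on {0<..<T}) ?N \<longleftrightarrow> (\<integral>\<^sup>+t. ennreal (?N t) \<partial>lebesgue_on {0<..<T}) < \<infinity>"
    using N by (simp add: integrable_iff_bounded)
  moreover have "integrable (cyl \<Omega> T) ?g \<longleftrightarrow> (\<integral>\<^sup>+z. ennreal (?g z) \<partial>cyl \<Omega> T) < \<infinity>"
  proof -
    have "norm (?g z) = ?g z" for z by (simp add: case_prod_beta)
    then show ?thesis using g by (simp add: integrable_iff_bounded)
  qed
  ultimately show ?thesis using eq by (simp add: integrable_closed_interval_iff)
qed

lemma spatial_gradient_works:
  "u \<in> joint_repr \<Omega> T \<Longrightarrow> is_spatial_gradient \<Omega> T u (spatial_gradient \<Omega> T u)"
  unfolding spatial_gradient_def joint_repr_def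
  by (auto intro: someI[of "is_spatial_gradient \<Omega> T u"])

lemma is_spatial_gradient_diff_curve:
  fixes u \<eta> :: "real \<Rightarrow> real^'n \<Rightarrow> real^'m"
  assumes \<Omega>: "open \<Omega>" and G: "is_spatial_gradient \<Omega> T u G" and \<eta>: "\<eta> \<in> smooth_test_curves \<Omega> T"
  shows "is_spatial_gradient \<Omega> T (\<lambda>t x. u t x - c *\<^sub>R \<eta> t x) (\<lambda>t x. G t x - c *\<^sub>R cgrad (\<eta> t) x)"
proof -
  have "(\<lambda>(x, t). G t x) \<in> borel_measurable (cyl \<Omega> T)" and ae: "AE t in lebesgue_on {0<..<T}. is_weak_gradient \<Omega> (u t) (G t)"
    using G by (auto simp: is_spatial_gradient_def)
  then have "(\<lambda>z. (\<lambda>(x, t). G t x) z - c *\<^sub>R (\<lambda>(x, t). cgrad (\<eta> t) x) z) \<in> borel_measurable (cyl \<Omega> T)"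
    using smooth_test_curves_measurable(2)[OF \<Omega> \<eta>] by measurable
  moreover have "AE t in lebesgue_on {0<..<T}. is_weak_gradient \<Omega> (\<lambda>x. u t x - c *\<^sub>R \<eta> t x) (\<lambda>x. G t x - c *\<^sub>R cgrad (\<eta> t) x)"
  proof -
    have "AE t in lebesgue_on {0<..<T}. t \<in> {0<..<T}" by (simp add: AE_restrict_space_iff)
    with ae show ?thesis
    proof eventually_elim
      case (elim t)
      then have "\<eta> t \<in> test_functions \<Omega>" using smooth_test_curves_test_functions[OF \<eta>] by simp
      then show ?case
        by (intro is_weak_gradient_diff_scaleR[OF \<Omega> elim(1)] is_weak_gradient_cgrad[OF \<Omega>])
    qed
  qed
  ultimately show ?thesis by (simp add: is_spatial_gradient_def case_prod_beta)
qed

text \<open>The time rounded down to the grid of step \<open>T / (k + 1)\<close>; it makes the approximations of a smooth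
  curve finitely valued.\<close>

lemma time_grid_tendsto:
  fixes t T :: real
  assumes "0 < T" "t \<in> {0..T}"
  shows "T * real (nat \<lfloor>real (Suc k) * t / T\<rfloor>) / real (Suc k) \<in> {0..T}"
    and "nat \<lfloor>real (Suc k) * t / T\<rfloor> \<le> Suc k"
    and "(\<lambda>k. T * real (nat \<lfloor>real (Suc k) * t / T\<rfloor>) / real (Suc k)) \<longlonglongrightarrow> t"
proof -
  let ?j = "\<lambda>k. nat \<lfloor>real (Suc k) * t / T\<rfloor>"
  let ?\<tau> = "\<lambda>k. T * real (?j k) / real (Suc k)"
  have j: "real (?j k) \<le> real (Suc k) * t / T" "real (Suc k) * t / T - 1 \<le> real (?j k)" for k
    using assms by (auto simp: of_nat_nat)
  have up: "?\<tau> k \<le> t" for k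
  proof -
    have "T * real (?j k) \<le> T * (real (Suc k) * t / T)" using j(1) assms by (intro mult_left_mono) auto
    then show ?thesis using assms(1) by (simp add: divide_le_eq mult.commute)
  qed
  have low: "t - T * inverse (real (Suc k)) \<le> ?\<tau> k" for k
  proof -
    have "T * (real (Suc k) * t / T - 1) \<le> T * real (?j k)" using j(2) assms by (intro mult_left_mono) auto
    then have "real (Suc k) * t - T \<le> T * real (?j k)" using assms(1) by (simp add: right_diff_distrib)
    then have "(real (Suc k) * t - T) / real (Suc k) \<le> ?\<tau> k" by (intro divide_right_mono) auto
    moreover have "(real (Suc k) * t - T) / real (Suc k) = t - T * inverse (real (Suc k))"
      by (simp add: field_simps del: of_nat_Suc)
    ultimately show ?thesis by simp
  qed
  show "?\<tau> k \<in> {0..T}" using up[of k] assms by (auto intro: order_trans)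
  have "real (Suc k) * t / T \<le> real (Suc k)"
    using assms by (simp add: divide_le_eq)
  with j(1)[of k] have "real (?j k) \<le> real (Suc k)" by linarith
  then show "?j k \<le> Suc k" by simp
  have "(\<lambda>k. t - T * inverse (real (Suc k))) \<longlonglongrightarrow> t - T * 0"
    by (intro tendsto_intros LIMSEQ_inverse_real_of_nat)
  then have l: "(\<lambda>k. t - T * inverse (real (Suc k))) \<longlonglongrightarrow> t" by simp
  show "?\<tau> \<longlonglongrightarrow> t"
    by (rule tendsto_sandwich[OF always_eventually always_eventually l tendsto_const]) (use up low in auto)
qed

section \<open>Finitely valued approximation of competitors in W^{1,p}\<close>

lemma W1p_norm_nonneg: "0 \<le> W1p_norm p \<Omega> w"
  by (simp add: W1p_norm_def)

lemma integral_powr_tendsto_0: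
  fixes h :: "nat \<Rightarrow> 'a::euclidean_space \<Rightarrow> 'b::euclidean_space"
  assumes "open \<Omega>" "bounded \<Omega>" "0 < p" and m: "\<And>k. h k \<in> borel_measurable (lebesgue_on \<Omega>)"
    and M: "\<And>k x. x \<in> \<Omega> \<Longrightarrow> norm (h k x) \<le> M" and lim: "\<And>x. x \<in> \<Omega> \<Longrightarrow> (\<lambda>k. h k x) \<longlonglongrightarrow> 0"
  shows "(\<lambda>k. \<integral>x. norm (h k x) powr p \<partial>lebesgue_on \<Omega>) \<longlonglongrightarrow> 0"
proof -
  interpret finite_measure "lebesgue_on \<Omega>"
    using assms(1,2) by (rule finite_measure_lebesgue_on_bounded)
  have "(\<lambda>k. \<integral>x. norm (h k x) powr p \<partial>lebesgue_on \<Omega>) \<longlonglongrightarrow> (\<integral>x. 0 \<partial>lebesgue_on \<Omega>)"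
  proof (rule integral_dominated_convergence)
    show "integrable (lebesgue_on \<Omega>) (\<lambda>x. M powr p)" by simp
    show "(\<lambda>x. norm (h k x) powr p) \<in> borel_measurable (lebesgue_on \<Omega>)" for k
      using m by measurable
    show "AE x in lebesgue_on \<Omega>. norm (norm (h k x) powr p) \<le> M powr p" for k
      using M assms(3) by (intro AE_I2) (auto intro: powr_mono2)
    show "AE x in lebesgue_on \<Omega>. (\<lambda>k. norm (h k x) powr p) \<longlonglongrightarrow> 0"
    proof (rule AE_I2)
      fix x assume "x \<in> space (lebesgue_on \<Omega>)"
      then have "(\<lambda>k. norm (h k x)) \<longlonglongrightarrow> 0" using lim by (simp add: tendsto_norm_zero)
      then show "(\<lambda>k. norm (h k x) powr p) \<longlonglongrightarrow> 0"
        using tendsto_powr'[of "\<lambda>k. norm (h k x)" 0 sequentially "\<lambda>_. p" p] assms(3) by simp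
    qed
  qed simp
  then show ?thesis by simp
qed

text \<open>Continuity of the curve into W^{1,p}: \<open>\<eta>\<close> and its Jacobian converge
  pointwise and stay below \<open>M\<close>, so their differences are bounded by
  \<open>2 * M\<close> and bounded convergence applies on the finite measure space \<Omega>. The
  factor 1 fits the lemmas on \<open>w - c z\<close>.\<close>

lemma W1p_norm_curve_tendsto:
  fixes \<eta> :: "real \<Rightarrow> real^'n \<Rightarrow> real^'m"
  assumes \<Omega>: "open \<Omega>" "bounded \<Omega>" and p: "0 < p" and \<eta>: "\<eta> \<in> smooth_test_curves \<Omega> T"
    and t: "t \<in> {0..T}" and \<tau>: "\<And>k. \<tau> k \<in> {0..T}" "\<tau> \<longlonglongrightarrow> t"
  shows "(\<lambda>k. W1p_norm p \<Omega> (\<lambda>x. \<eta> (\<tau> k) x - 1 *\<^sub>R \<eta> t x) powr p) \<longlonglongrightarrow> 0"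
proof -
  obtain M where M: "M \<ge> 0" "\<And>x t. x \<in> \<Omega> \<Longrightarrow> t \<in> {0..T} \<Longrightarrow> norm (\<eta> t x) \<le> M"
    "\<And>x t. x \<in> \<Omega> \<Longrightarrow> t \<in> {0..T} \<Longrightarrow> norm (cgrad (\<eta> t) x) \<le> M"
    using smooth_test_curves_bounded[OF \<Omega>(2) \<eta>] by blast
  have tf: "\<eta> s \<in> test_functions \<Omega>" if "s \<in> {0..T}" for s
    using smooth_test_curves_test_functions[OF \<eta> that] .
  have sm: "smooth (\<eta> s)" if "s \<in> {0..T}" for s
    using tf[OF that] by (rule test_functions_smooth)
  have W1: "\<eta> s \<in> W1p p \<Omega>" if "s \<in> {0..T}" for s
    using test_functions_W1p[OF \<Omega> _ tf[OF that], of p] p by simp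
  have pt: "(\<lambda>k. (x, \<tau> k)) \<longlonglongrightarrow> (x, t)" for x :: "real^'n"
    using \<tau>(2) by (intro tendsto_intros)
  have lim: "(\<lambda>k. \<eta> (\<tau> k) x) \<longlonglongrightarrow> \<eta> t x" "(\<lambda>k. cgrad (\<eta> (\<tau> k)) x) \<longlonglongrightarrow> cgrad (\<eta> t) x" for x
    using continuous_on_tendsto_compose[OF smooth_test_curves_continuous(1)[OF \<eta>] pt[of x]]
      continuous_on_tendsto_compose[OF smooth_test_curves_continuous(2)[OF \<eta>] pt[of x]] t \<tau>(1)
    by auto
  have two: "norm (a - b) \<le> 2 * M" if "norm a \<le> M" "norm b \<le> M" for a b :: "'z::real_normed_vector"
    using norm_triangle_ineq4[of a b] that by linarith
  have "(\<lambda>k. (\<integral>x. norm (\<eta> (\<tau> k) x - 1 *\<^sub>R \<eta> t x) powr p \<partial>lebesgue_on \<Omega>) +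
    (\<integral>x. norm (cgrad (\<eta> (\<tau> k)) x - 1 *\<^sub>R cgrad (\<eta> t) x) powr p \<partial>lebesgue_on \<Omega>)) \<longlonglongrightarrow> 0 + 0"
  proof (intro tendsto_add integral_powr_tendsto_0[OF \<Omega> p])
    show "(\<lambda>x. \<eta> (\<tau> k) x - 1 *\<^sub>R \<eta> t x) \<in> borel_measurable (lebesgue_on \<Omega>)" for k
      by (intro borel_measurable_lebesgue_on_continuous[OF \<Omega>(1)] continuous_intros
          smooth_continuous_on[OF sm[OF \<tau>(1)]] smooth_continuous_on[OF sm[OF t]])
    show "(\<lambda>x. cgrad (\<eta> (\<tau> k)) x - 1 *\<^sub>R cgrad (\<eta> t) x) \<in> borel_measurable (lebesgue_on \<Omega>)" for k
      by (intro borel_measurable_lebesgue_on_continuous[OF \<Omega>(1)] continuous_intros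
          continuous_on_cgrad[OF sm[OF \<tau>(1)]] continuous_on_cgrad[OF sm[OF t]])
    show "norm (\<eta> (\<tau> k) x - 1 *\<^sub>R \<eta> t x) \<le> 2 * M" if "x \<in> \<Omega>" for k x
      using two[OF M(2) M(2)] that \<tau>(1) t by simp
    show "norm (cgrad (\<eta> (\<tau> k)) x - 1 *\<^sub>R cgrad (\<eta> t) x) \<le> 2 * M" if "x \<in> \<Omega>" for k x
      using two[OF M(3) M(3)] that \<tau>(1) t by simp
    show "(\<lambda>k. \<eta> (\<tau> k) x - 1 *\<^sub>R \<eta> t x) \<longlonglongrightarrow> 0" for x
      using lim(1)[of x] by (simp add: LIM_zero)
    show "(\<lambda>k. cgrad (\<eta> (\<tau> k)) x - 1 *\<^sub>R cgrad (\<eta> t) x) \<longlonglongrightarrow> 0" for x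
      using lim(2)[of x] by (simp add: LIM_zero)
  qed
  moreover have "W1p_norm p \<Omega> (\<lambda>x. \<eta> (\<tau> k) x - 1 *\<^sub>R \<eta> t x) powr p =
    (\<integral>x. norm (\<eta> (\<tau> k) x - 1 *\<^sub>R \<eta> t x) powr p \<partial>lebesgue_on \<Omega>) +
    (\<integral>x. norm (cgrad (\<eta> (\<tau> k)) x - 1 *\<^sub>R cgrad (\<eta> t) x) powr p \<partial>lebesgue_on \<Omega>)" for k
    using \<tau>(1) t
    by (intro W1p_norm_powr[OF \<Omega>(1) p] W1p_diff_scaleR[OF \<Omega>(1) p] W1
        is_weak_gradient_diff_scaleR[OF \<Omega>(1)] is_weak_gradient_cgrad[OF \<Omega>(1)] tf)
  ultimately show ?thesis by simp
qed

text \<open>The k-th approximation combines that of \<open>u\<close> with \<open>\<eta>\<close>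
  frozen at the grid time \<open>\<tau> k (j k t)\<close>. Its value depends only on the pair of
  \<open>s k t\<close> and the grid index \<open>j k t\<close>, and there are finitely many such
  pairs.\<close>

lemma strongly_measurable_diff_curve:
  fixes u \<eta> :: "real \<Rightarrow> real^'n \<Rightarrow> real^'m"
  assumes \<Omega>: "open \<Omega>" "bounded \<Omega>" and p: "0 < p" and T: "0 < T" and \<eta>: "\<eta> \<in> smooth_test_curves \<Omega> T"
    and X: "AE t in lebesgue_on {0..T}. u t \<in> W1p p \<Omega>"
    and s: "\<And>k. finite (s k ` {0..T})" "\<And>k. s k ` {0..T} \<subseteq> W1p p \<Omega>"
      "\<And>k w. {t \<in> {0..T}. s k t = w} \<in> sets lebesgue"
      "AE t in lebesgue_on {0..T}. (\<lambda>k. W1p_norm p \<Omega> (\<lambda>x. s k t x - u t x)) \<longlonglongrightarrow> 0"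
  shows "\<exists>s :: nat \<Rightarrow> real \<Rightarrow> real^'n \<Rightarrow> real^'m.
            (\<forall>k. finite (s k ` {0..T}) \<and> s k ` {0..T} \<subseteq> W1p p \<Omega> \<and>
                 (\<forall>w. {t \<in> {0..T}. s k t = w} \<in> sets lebesgue)) \<and>
            (AE t in lebesgue_on {0..T}. (\<lambda>k. W1p_norm p \<Omega> (\<lambda>x. s k t x - (u t x - c *\<^sub>R \<eta> t x))) \<longlonglongrightarrow> 0)"
proof -
  define j where "j k t = nat \<lfloor>real (Suc k) * t / T\<rfloor>" for k t
  define \<tau> where "\<tau> k i = T * real i / real (Suc k)" for k and i :: nat
  have \<tau>j: "\<tau> k (j k t) \<in> {0..T}" "j k t \<le> Suc k" "(\<lambda>k. \<tau> k (j k t)) \<longlonglongrightarrow> t" if "t \<in> {0..T}" for k t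
    using time_grid_tendsto[OF T that] by (simp_all add: \<tau>_def j_def)
  define d where "d k w i = (\<lambda>x. w x - c *\<^sub>R \<eta> (\<tau> k i) x)" for k and w :: "real^'n \<Rightarrow> real^'m" and i
  define s' where "s' k t = d k (s k t) (j k t)" for k t
  have W1: "\<eta> r \<in> W1p p \<Omega>" if "r \<in> {0..T}" for r
    using test_functions_W1p[OF \<Omega> _ smooth_test_curves_test_functions[OF \<eta> that], of p] p by simp
  have jm: "{t \<in> {0..T}. j k t = i} \<in> sets lebesgue" for k i
  proof -
    have "{t \<in> {0..T}. j k t = i} \<in> sets borel"
      unfolding j_def by measurable
    then show ?thesis by auto
  qed
  have "finite (s' k ` {0..T})" for k
  proof (rule finite_subset)
    show "s' k ` {0..T} \<subseteq> (\<lambda>(w, i). d k w i) ` (s k ` {0..T} \<times> {..Suc k})"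
      using \<tau>j(2) by (auto simp: s'_def)
  qed (use s(1) in auto)
  moreover have "s' k ` {0..T} \<subseteq> W1p p \<Omega>" for k
    using s(2)[of k] W1 \<tau>j(1) unfolding s'_def d_def
    by (auto intro!: W1p_diff_scaleR[OF \<Omega>(1) p])
  moreover have "{t \<in> {0..T}. s' k t = w} \<in> sets lebesgue" for k w
  proof -
    \<comment> \<open>Distinct pairs may produce the same function \<open>w\<close>, so the level
      set is a union over all pairs that yield \<open>w\<close>.\<close>
    let ?I = "{q \<in> s k ` {0..T} \<times> {..Suc k}. d k (fst q) (snd q) = w}"
    let ?A = "\<lambda>q. {t \<in> {0..T}. s k t = fst q} \<inter> {t \<in> {0..T}. j k t = snd q}"
    have sub: "{t \<in> {0..T}. s' k t = w} \<subseteq> (\<Union>q\<in>?I. ?A q)"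
    proof
      fix t assume "t \<in> {t \<in> {0..T}. s' k t = w}"
      then show "t \<in> (\<Union>q\<in>?I. ?A q)"
        using \<tau>j(2)[of t k] by (intro UN_I[of "(s k t, j k t)"]) (auto simp: s'_def)
    qed
    have sup: "(\<Union>q\<in>?I. ?A q) \<subseteq> {t \<in> {0..T}. s' k t = w}"
      by (auto simp: s'_def)
    have "finite ?I"
      using s(1) by (intro finite_subset[of ?I "s k ` {0..T} \<times> {..Suc k}"]) auto
    then have "(\<Union>q\<in>?I. ?A q) \<in> sets lebesgue"
      by (intro sets.finite_UN sets.Int s(3) jm)
    then show ?thesis
      unfolding equalityI[OF sub sup] .
  qed
  moreover have "AE t in lebesgue_on {0..T}. (\<lambda>k. W1p_norm p \<Omega> (\<lambda>x. s' k t x - (u t x - c *\<^sub>R \<eta> t x))) \<longlonglongrightarrow> 0"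
  proof -
    have "AE t in lebesgue_on {0..T}. t \<in> {0..T}" by (simp add: AE_restrict_space_iff)
    with s(4) X show ?thesis
    proof eventually_elim
      case (elim t)
      let ?a = "\<lambda>k. \<lambda>x. s k t x - 1 *\<^sub>R u t x"
      let ?b = "\<lambda>k. \<lambda>x. \<eta> (\<tau> k (j k t)) x - 1 *\<^sub>R \<eta> t x"
      let ?N = "\<lambda>w. W1p_norm p \<Omega> w powr p"
      \<comment> \<open>Two errors: that of approximating \<open>u\<close>, and that of freezing
        \<open>\<eta>\<close> at the grid time.\<close>
      have eq: "(\<lambda>x. s' k t x - (u t x - c *\<^sub>R \<eta> t x)) = (\<lambda>x. ?a k x - c *\<^sub>R ?b k x)" for k
        by (simp add: s'_def d_def algebra_simps fun_eq_iff)
      have sW: "s k t \<in> W1p p \<Omega>" for k using s(2)[of k] elim(3) by auto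
      have le: "?N (\<lambda>x. s' k t x - (u t x - c *\<^sub>R \<eta> t x)) \<le> 2 powr p * (?N (?a k) + \<bar>c\<bar> powr p * ?N (?b k))" for k
        unfolding eq using elim(2,3) \<tau>j(1) sW
        by (intro W1p_diff_scaleR[OF \<Omega>(1) p] W1)
      have a: "(\<lambda>k. ?N (?a k)) \<longlonglongrightarrow> 0"
        using tendsto_powr'[OF elim(1), of "\<lambda>_. p" p] p by (simp add: W1p_norm_nonneg)
      have b: "(\<lambda>k. ?N (?b k)) \<longlonglongrightarrow> 0"
        by (rule W1p_norm_curve_tendsto[OF \<Omega> p \<eta> elim(3) \<tau>j(1)[OF elim(3)] \<tau>j(3)[OF elim(3)]])
      have "(\<lambda>k. 2 powr p * (?N (?a k) + \<bar>c\<bar> powr p * ?N (?b k))) \<longlonglongrightarrow> 2 powr p * (0 + \<bar>c\<bar> powr p * 0)"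
        by (intro tendsto_intros a b)
      then have "(\<lambda>k. 2 powr p * (?N (?a k) + \<bar>c\<bar> powr p * ?N (?b k))) \<longlonglongrightarrow> 0" by simp
      from tendsto_sandwich[OF _ always_eventually tendsto_const this]
      have Np: "(\<lambda>k. ?N (\<lambda>x. s' k t x - (u t x - c *\<^sub>R \<eta> t x))) \<longlonglongrightarrow> 0"
        using le by simp
      have "(\<lambda>k. ?N (\<lambda>x. s' k t x - (u t x - c *\<^sub>R \<eta> t x)) powr (1 / p)) \<longlonglongrightarrow> 0"
        using tendsto_powr'[OF Np, of "\<lambda>_. 1 / p" "1 / p"] p by simp
      then show ?case
        using p by (simp add: powr_powr abs_of_nonneg[OF W1p_norm_nonneg])
    qed
  qed
  ultimately show ?thesis by blast
qed

section \<open>Membership of competitors in the space \<open>Vp\<close>\<close>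

lemma Vp_integrable:
  fixes u :: "real \<Rightarrow> real^'n \<Rightarrow> real^'m"
  assumes \<Omega>: "open \<Omega>" and p: "0 < p" and u: "u \<in> Vp p \<Omega> T" and G: "is_spatial_gradient \<Omega> T u G"
  shows "integrable (cyl \<Omega> T) (\<lambda>(x, t). norm (u t x) powr p + norm (G t x) powr p)"
proof -
  have um: "(\<lambda>(x, t). u t x) \<in> borel_measurable (cyl \<Omega> T)" using u by (simp add: Vp_def joint_repr_def)
  have X: "AE t in lebesgue_on {0..T}. u t \<in> W1p p \<Omega>"
    and i: "integrable (lebesgue_on {0..T}) (\<lambda>t. W1p_norm p \<Omega> (u t) powr p)"
    using u by (auto simp: Vp_def bochner_Lp_def)
  show ?thesis
    using i by (subst (asm) integrable_W1p_norm_iff[OF \<Omega> p um G X])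
qed

text \<open>Joint representatives come from \<open>u\<close>, from \<open>\<eta>\<close> and from
  the explicit gradient \<open>?H\<close>; strong measurability from the grid; integrability of the
  norm is moved to the cylinder, bounded there pointwise, and moved back.\<close>

lemma Vp_diff_curve:
  fixes u \<eta> :: "real \<Rightarrow> real^'n \<Rightarrow> real^'m"
  assumes \<Omega>: "open \<Omega>" "bounded \<Omega>" and p: "0 < p" and T: "0 < T" and \<eta>: "\<eta> \<in> smooth_test_curves \<Omega> T"
    and u: "u \<in> Vp p \<Omega> T"
  shows "(\<lambda>t x. u t x - c *\<^sub>R \<eta> t x) \<in> Vp p \<Omega> T"
proof -
  let ?v = "\<lambda>t x. u t x - c *\<^sub>R \<eta> t x"
  let ?G = "spatial_gradient \<Omega> T u"
  let ?H = "\<lambda>t x. ?G t x - c *\<^sub>R cgrad (\<eta> t) x"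
  have uJ: "u \<in> joint_repr \<Omega> T" and uB: "u \<in> bochner_Lp p T (W1p p \<Omega>) (W1p_norm p \<Omega>)"
    using u by (auto simp: Vp_def)
  have G: "is_spatial_gradient \<Omega> T u ?G" using uJ by (rule spatial_gradient_works)
  have H: "is_spatial_gradient \<Omega> T ?v ?H" by (rule is_spatial_gradient_diff_curve[OF \<Omega>(1) G \<eta>])
  have um: "(\<lambda>(x, t). u t x) \<in> borel_measurable (cyl \<Omega> T)" using uJ by (simp add: joint_repr_def)
  have Gm: "(\<lambda>(x, t). ?G t x) \<in> borel_measurable (cyl \<Omega> T)" using G by (simp add: is_spatial_gradient_def)
  have Hm: "(\<lambda>(x, t). ?H t x) \<in> borel_measurable (cyl \<Omega> T)" using H by (simp add: is_spatial_gradient_def)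
  have "(\<lambda>z. (\<lambda>(x, t). u t x) z - c *\<^sub>R (\<lambda>(x, t). \<eta> t x) z) \<in> borel_measurable (cyl \<Omega> T)"
    using um smooth_test_curves_measurable(1)[OF \<Omega>(1) \<eta>] by measurable
  then have vm: "(\<lambda>(x, t). ?v t x) \<in> borel_measurable (cyl \<Omega> T)" by (simp add: case_prod_beta)
  have vJ: "?v \<in> joint_repr \<Omega> T" using vm H by (auto simp: joint_repr_def)
  have X: "AE t in lebesgue_on {0..T}. u t \<in> W1p p \<Omega>" using uB by (simp add: bochner_Lp_def)
  have "AE t in lebesgue_on {0..T}. t \<in> {0..T}" by (simp add: AE_restrict_space_iff)
  with X have vX: "AE t in lebesgue_on {0..T}. ?v t \<in> W1p p \<Omega>"
  proof eventually_elim
    case (elim t)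
    have "\<eta> t \<in> W1p p \<Omega>"
      using test_functions_W1p[OF \<Omega> _ smooth_test_curves_test_functions[OF \<eta> elim(2)], of p] p by simp
    with elim show ?case by (intro W1p_diff_scaleR[OF \<Omega>(1) p])
  qed
  obtain s :: "nat \<Rightarrow> real \<Rightarrow> real^'n \<Rightarrow> real^'m" where
      s0: "\<forall>k. finite (s k ` {0..T}) \<and> s k ` {0..T} \<subseteq> W1p p \<Omega> \<and> (\<forall>w. {t \<in> {0..T}. s k t = w} \<in> sets lebesgue)"
      and s4: "AE t in lebesgue_on {0..T}. (\<lambda>k. W1p_norm p \<Omega> (\<lambda>x. s k t x - u t x)) \<longlonglongrightarrow> 0"
    using uB unfolding bochner_Lp_def by blast
  have s: "\<And>k. finite (s k ` {0..T})" "\<And>k. s k ` {0..T} \<subseteq> W1p p \<Omega>"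
      "\<And>k w. {t \<in> {0..T}. s k t = w} \<in> sets lebesgue"
    using s0 by blast+
  have ui: "integrable (cyl \<Omega> T) (\<lambda>(x, t). norm (u t x) powr p + norm (?G t x) powr p)"
    by (rule Vp_integrable[OF \<Omega>(1) p u G])
  obtain M where M: "M \<ge> 0" "\<And>x t. x \<in> \<Omega> \<Longrightarrow> t \<in> {0..T} \<Longrightarrow> norm (\<eta> t x) \<le> M"
    "\<And>x t. x \<in> \<Omega> \<Longrightarrow> t \<in> {0..T} \<Longrightarrow> norm (cgrad (\<eta> t) x) \<le> M"
    using smooth_test_curves_bounded[OF \<Omega>(2) \<eta>] by blast
  have fin: "finite_measure (cyl \<Omega> T)"
    using \<Omega> by (intro finite_measure_lebesgue_on_bounded open_Times bounded_Times) auto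
  \<comment> \<open>The constant appears twice, once for \<open>c \<eta>\<close> and once for its
    Jacobian, both of norm at most \<open>\<bar>c\<bar> * M\<close>.\<close>
  let ?R = "\<lambda>z. 2 powr p * ((\<lambda>(x, t). norm (u t x) powr p + norm (?G t x) powr p) z + 2 * (\<bar>c\<bar> * M) powr p)"
  have R: "integrable (cyl \<Omega> T) ?R"
    using ui fin by (intro integrable_mult_right Bochner_Integration.integrable_add finite_measure.integrable_const)
  have "integrable (cyl \<Omega> T) (\<lambda>(x, t). norm (?v t x) powr p + norm (?H t x) powr p)"
  proof (rule Bochner_Integration.integrable_bound[OF R])
    have "(\<lambda>z. norm ((\<lambda>(x, t). ?v t x) z) powr p + norm ((\<lambda>(x, t). ?H t x) z) powr p) \<in> borel_measurable (cyl \<Omega> T)"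
      using vm Hm by measurable
    then show "(\<lambda>(x, t). norm (?v t x) powr p + norm (?H t x) powr p) \<in> borel_measurable (cyl \<Omega> T)"
      by (simp add: case_prod_beta)
    show "AE z in cyl \<Omega> T. norm ((\<lambda>(x, t). norm (?v t x) powr p + norm (?H t x) powr p) z) \<le> norm (?R z)"
    proof (rule AE_I2)
      fix z assume "z \<in> space (cyl \<Omega> T)"
      then obtain x t where z: "z = (x, t)" "x \<in> \<Omega>" "t \<in> {0..T}" by (auto)
      have c: "norm (c *\<^sub>R \<eta> t x) powr p \<le> (\<bar>c\<bar> * M) powr p" "norm (c *\<^sub>R cgrad (\<eta> t) x) powr p \<le> (\<bar>c\<bar> * M) powr p"
        using M(2,3)[OF z(2,3)] p by (auto intro!: powr_mono2 mult_left_mono)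
      have "norm (?v t x) powr p \<le> 2 powr p * (norm (u t x) powr p + (\<bar>c\<bar> * M) powr p)"
        using norm_diff_powr_le[of p "u t x" "c *\<^sub>R \<eta> t x"] p c(1)
        by (auto elim!: order_trans intro!: mult_left_mono)
      moreover have "norm (?H t x) powr p \<le> 2 powr p * (norm (?G t x) powr p + (\<bar>c\<bar> * M) powr p)"
        using norm_diff_powr_le[of p "?G t x" "c *\<^sub>R cgrad (\<eta> t) x"] p c(2)
        by (auto elim!: order_trans intro!: mult_left_mono)
      ultimately have "norm (?v t x) powr p + norm (?H t x) powr p \<le> ?R z"
        unfolding z(1) by (simp add: algebra_simps)
      then show "norm ((\<lambda>(x, t). norm (?v t x) powr p + norm (?H t x) powr p) z) \<le> norm (?R z)"
        unfolding z(1) by simp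
    qed
  qed
  then have vi: "integrable (lebesgue_on {0..T}) (\<lambda>t. W1p_norm p \<Omega> (?v t) powr p)"
    by (subst integrable_W1p_norm_iff[OF \<Omega>(1) p vm H vX])
  have "?v \<in> bochner_Lp p T (W1p p \<Omega>) (W1p_norm p \<Omega>)"
    unfolding bochner_Lp_def using vX vi strongly_measurable_diff_curve[OF \<Omega> p T \<eta> X s s4, of c] by simp
  with vJ show ?thesis by (simp add: Vp_def)
qed

section \<open>The first variation\<close>

text \<open>\<open>f_v\<close> and \<open>f_lam\<close> collect partial derivatives. Joint
  differentiability identifies them with the restrictions of the total derivative \<open>D\<close>
  to the two factors, and \<open>D (a, B) = D (a, 0) + D (0, B)\<close>.\<close>

lemma C1_fun_has_derivative:
  fixes f :: "('n::finite, 'm::finite) integrand"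
  assumes "C1_fun (\<lambda>(v, \<Lambda>). f x t v \<Lambda>)"
  shows "((\<lambda>(v, \<Lambda>). f x t v \<Lambda>) has_derivative (\<lambda>(a, B). f_v f x t v \<Lambda> \<bullet> a + f_lam f x t v \<Lambda> \<bullet> B)) (at (v, \<Lambda>))"
proof -
  let ?F = "\<lambda>(v, \<Lambda>). f x t v \<Lambda>"
  define D where "D = frechet_derivative ?F (at (v, \<Lambda>))"
  have D: "(?F has_derivative D) (at (v, \<Lambda>))"
    using assms unfolding C1_fun_def D_def frechet_derivative_works by blast
  have lin: "linear D" using D by (rule has_derivative_linear)
  have "((\<lambda>w. ?F (w, \<Lambda>)) has_derivative (\<lambda>a. D (a, 0))) (at v)"
  proof -
    have "((\<lambda>w. (w, \<Lambda>)) has_derivative (\<lambda>a. (a, 0))) (at v)" by (auto intro!: derivative_eq_intros)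
    from has_derivative_compose[OF this D] show ?thesis by simp
  qed
  then have v: "frechet_derivative (\<lambda>w. f x t w \<Lambda>) (at v) = (\<lambda>a. D (a, 0))"
    by (simp add: frechet_derivative_at[symmetric])
  have "((\<lambda>M. ?F (v, M)) has_derivative (\<lambda>B. D (0, B))) (at \<Lambda>)"
  proof -
    have "((\<lambda>M. (v, M)) has_derivative (\<lambda>B. (0, B))) (at \<Lambda>)" by (auto intro!: derivative_eq_intros)
    from has_derivative_compose[OF this D] show ?thesis by simp
  qed
  then have lam: "frechet_derivative (\<lambda>M. f x t v M) (at \<Lambda>) = (\<lambda>B. D (0, B))"
    by (simp add: frechet_derivative_at[symmetric])
  have la: "linear (\<lambda>a. D (a, 0))" "linear (\<lambda>B. D (0, B))"
    using linear_compose[OF _ lin, of "\<lambda>a. (a, 0)"] linear_compose[OF _ lin, of "\<lambda>B. (0, B)"]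
    by (auto simp: o_def linear_iff)
  have e1: "(\<lambda>a. D (a, 0)) = (\<lambda>a. f_v f x t v \<Lambda> \<bullet> a)"
  proof (rule linear_eq_stdbasis[OF la(1)])
    show "linear (\<lambda>a. f_v f x t v \<Lambda> \<bullet> a)" by (simp add: bounded_linear.linear bounded_linear_inner_right)
    fix b :: "real^'m" assume "b \<in> Basis"
    then obtain i where "b = axis i 1" by (auto simp: Basis_vec_def)
    then show "D (b, 0) = f_v f x t v \<Lambda> \<bullet> b" by (simp add: f_v_def v inner_axis)
  qed
  have e2: "(\<lambda>B. D (0, B)) = (\<lambda>B. f_lam f x t v \<Lambda> \<bullet> B)"
  proof (rule linear_eq_stdbasis[OF la(2)])
    show "linear (\<lambda>B. f_lam f x t v \<Lambda> \<bullet> B)" by (simp add: bounded_linear.linear bounded_linear_inner_right)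
    fix b :: "real^'n^'m" assume "b \<in> Basis"
    then obtain i \<alpha> where "b = axis i (axis \<alpha> 1)" by (auto simp: Basis_vec_def)
    then show "D (0, b) = f_lam f x t v \<Lambda> \<bullet> b" by (simp add: f_lam_def lam inner_axis)
  qed
  have "D (a, B) = f_v f x t v \<Lambda> \<bullet> a + f_lam f x t v \<Lambda> \<bullet> B" for a B
    using linear_add[OF lin, of "(a, 0)" "(0, B)"] fun_cong[OF e1, of a] fun_cong[OF e2, of B] by simp
  then have "D = (\<lambda>(a, B). f_v f x t v \<Lambda> \<bullet> a + f_lam f x t v \<Lambda> \<bullet> B)"
    by (auto simp: fun_eq_iff)
  with D show ?thesis by simp
qed

lemma integrand_line_derivative:
  fixes f :: "('n::finite, 'm::finite) integrand"
  assumes "C1_fun (\<lambda>(v, \<Lambda>). f x t v \<Lambda>)"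
  shows "((\<lambda>r. f x t (v - r *\<^sub>R a) (\<Lambda> - r *\<^sub>R B)) has_real_derivative
    - (f_v f x t (v - r *\<^sub>R a) (\<Lambda> - r *\<^sub>R B) \<bullet> a + f_lam f x t (v - r *\<^sub>R a) (\<Lambda> - r *\<^sub>R B) \<bullet> B)) (at r)"
proof -
  have "((\<lambda>r. (v - r *\<^sub>R a, \<Lambda> - r *\<^sub>R B)) has_derivative (\<lambda>h. (- (h *\<^sub>R a), - (h *\<^sub>R B)))) (at r)"
    by (auto intro!: derivative_eq_intros)
  from has_derivative_compose[OF this C1_fun_has_derivative[where f = f and x = x and t = t, OF assms]]
  show ?thesis
    unfolding has_field_derivative_def case_prod_conv
    by (rule has_derivative_eq_rhs) (simp add: fun_eq_iff algebra_simps)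
qed

text \<open>By the mean value theorem the quotient is a derivative at a point displaced by at most
  \<open>a\<close> and \<open>B\<close>, because \<open>\<bar>e\<bar> \<le> 1\<close>. The growth
  condition there gives a bound that no longer involves \<open>e\<close>.\<close>

lemma integrand_difference_quotient_bound:
  fixes f :: "('n::finite, 'm::finite) integrand"
  assumes C1: "C1_fun (\<lambda>(v, \<Lambda>). f x t v \<Lambda>)"
    and growth: "\<And>v \<Lambda>. \<bar>f x t v \<Lambda>\<bar> + norm (f_v f x t v \<Lambda>) + norm (f_lam f x t v \<Lambda>)
           \<le> C * (1 + norm v powr p + norm \<Lambda> powr p)"
    and p: "0 \<le> p" and e: "e \<noteq> 0" "\<bar>e\<bar> \<le> 1" and M: "norm a \<le> M" "norm B \<le> M"
  shows "\<bar>(f x t v \<Lambda> - f x t (v - e *\<^sub>R a) (\<Lambda> - e *\<^sub>R B)) / e\<bar> \<le>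
    \<bar>C\<bar> * M * (1 + 2 powr p * (norm v powr p + norm \<Lambda> powr p + 2 * M powr p))"
proof -
  let ?P = "\<lambda>r. f_v f x t (v - r *\<^sub>R a) (\<Lambda> - r *\<^sub>R B) \<bullet> a + f_lam f x t (v - r *\<^sub>R a) (\<Lambda> - r *\<^sub>R B) \<bullet> B"
  let ?q = "\<lambda>r. f x t (v - r *\<^sub>R a) (\<Lambda> - r *\<^sub>R B)"
  have M0: "0 \<le> M" using M(1) norm_ge_zero[of a] by linarith
  \<comment> \<open>Parametrising by \<open>s\<close> in [0,1] treats both signs of \<open>e\<close>
    at once.\<close>
  have "((\<lambda>s. ?q (s * e)) has_real_derivative - ?P (s * e) * e) (at s)" for s
    by (rule DERIV_chain2[OF integrand_line_derivative[where f = f and x = x and t = t, OF C1]]) (auto intro!: derivative_eq_intros)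
  from MVT2[of 0 1 "\<lambda>s. ?q (s * e)", OF _ this] obtain z where z: "0 < z" "z < 1"
    and eq: "?q (1 * e) - ?q (0 * e) = (1 - 0) * (- ?P (z * e) * e)" by auto
  let ?w = "v - (z * e) *\<^sub>R a" and ?L = "\<Lambda> - (z * e) *\<^sub>R B"
  have ze: "\<bar>z * e\<bar> \<le> 1" using z e(2) by (simp add: abs_mult mult_le_one)
  have "(f x t v \<Lambda> - ?q e) / e = ?P (z * e)" using eq e(1) by (simp add: field_simps)
  then have "\<bar>(f x t v \<Lambda> - ?q e) / e\<bar> \<le> norm (f_v f x t ?w ?L) * norm a + norm (f_lam f x t ?w ?L) * norm B"
    using Cauchy_Schwarz_ineq2[of "f_v f x t ?w ?L" a] Cauchy_Schwarz_ineq2[of "f_lam f x t ?w ?L" B] by linarith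
  also have "\<dots> \<le> norm (f_v f x t ?w ?L) * M + norm (f_lam f x t ?w ?L) * M"
    using M by (intro add_mono mult_left_mono) auto
  also have "\<dots> = (norm (f_v f x t ?w ?L) + norm (f_lam f x t ?w ?L)) * M" by (simp add: algebra_simps)
  also have "\<dots> \<le> (C * (1 + norm ?w powr p + norm ?L powr p)) * M"
    using growth[of ?w ?L] M0 by (intro mult_right_mono) linarith+
  \<comment> \<open>\<open>C\<close> has no prescribed sign; with \<open>\<bar>C\<bar>\<close> the
    bound is monotone in the powers, which are enlarged next.\<close>
  also have "\<dots> \<le> (\<bar>C\<bar> * (1 + norm ?w powr p + norm ?L powr p)) * M"
    using M0 by (intro mult_right_mono) (auto intro!: add_nonneg_nonneg)
  also have "\<dots> \<le> (\<bar>C\<bar> * (1 + 2 powr p * (norm v powr p + norm \<Lambda> powr p + 2 * M powr p))) * M"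
  proof -
    have "norm ((z * e) *\<^sub>R a) \<le> 1 * M" "norm ((z * e) *\<^sub>R B) \<le> 1 * M"
      unfolding norm_scaleR using ze M M0 by (intro mult_mono; simp)+
    then have m: "norm ((z * e) *\<^sub>R a) powr p \<le> M powr p" "norm ((z * e) *\<^sub>R B) powr p \<le> M powr p"
      using p by (auto intro!: powr_mono2)
    have "norm ?w powr p \<le> 2 powr p * (norm v powr p + M powr p)"
      by (rule order_trans[OF norm_diff_powr_le[OF p]]) (use m(1) in \<open>auto intro!: mult_left_mono\<close>)
    moreover have "norm ?L powr p \<le> 2 powr p * (norm \<Lambda> powr p + M powr p)"
      by (rule order_trans[OF norm_diff_powr_le[OF p]]) (use m(2) in \<open>auto intro!: mult_left_mono\<close>)
    ultimately show ?thesis using M0 by (intro mult_right_mono mult_left_mono) (auto simp: algebra_simps)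
  qed
  finally show ?thesis by (simp add: algebra_simps)
qed

text \<open>Dominated convergence along an arbitrary null sequence, so that positive and negative
  \<open>e n\<close> are covered by one statement. Measurability of the limit \<open>g\<close> is
  inherited from the quotients.\<close>

lemma energy_directional_derivative:
  fixes f :: "('n::finite, 'm::finite) integrand" and u \<eta> :: "real \<Rightarrow> real^'n \<Rightarrow> real^'m"
  assumes \<Omega>: "open \<Omega>" "bounded \<Omega>" and p: "0 < p" and T: "0 < T"
    and int: "\<And>v. v \<in> Vp p \<Omega> T \<Longrightarrow>
           integrable (cyl \<Omega> T) (\<lambda>(x, t). f x t (v t x) (spatial_gradient \<Omega> T v t x))"
    and C1: "\<And>x t. x \<in> \<Omega> \<Longrightarrow> t \<in> {0<..<T} \<Longrightarrow> C1_fun (\<lambda>(v, \<Lambda>). f x t v \<Lambda>)"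
    and growth: "\<And>x t v \<Lambda>. x \<in> \<Omega> \<Longrightarrow> t \<in> {0<..<T} \<Longrightarrow>
           \<bar>f x t v \<Lambda>\<bar> + norm (f_v f x t v \<Lambda>) + norm (f_lam f x t v \<Lambda>)
           \<le> C * (1 + norm v powr p + norm \<Lambda> powr p)"
    and u: "u \<in> Vp p \<Omega> T" and \<eta>: "\<eta> \<in> smooth_test_curves \<Omega> T"
    and e: "\<And>n. e n \<noteq> 0" "\<And>n. \<bar>e n\<bar> \<le> 1" "e \<longlonglongrightarrow> 0"
  defines "g \<equiv> \<lambda>(x, t). f_lam f x t (u t x) (spatial_gradient \<Omega> T u t x) \<bullet> cgrad (\<eta> t) x
      + f_v f x t (u t x) (spatial_gradient \<Omega> T u t x) \<bullet> \<eta> t x"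
  shows "integrable (cyl \<Omega> T) g"
    and "(\<lambda>n. (energy f \<Omega> T u - energy f \<Omega> T (\<lambda>t x. u t x - e n *\<^sub>R \<eta> t x)) / e n) \<longlonglongrightarrow> (\<integral>z. g z \<partial>cyl \<Omega> T)"
proof -
  let ?v = "\<lambda>n t x. u t x - e n *\<^sub>R \<eta> t x"
  let ?G = "spatial_gradient \<Omega> T u"
  let ?H = "\<lambda>n t x. ?G t x - e n *\<^sub>R cgrad (\<eta> t) x"
  let ?fu = "\<lambda>(x, t). f x t (u t x) (?G t x)"
  let ?fv = "\<lambda>n. \<lambda>(x, t). f x t (?v n t x) (?H n t x)"
  let ?fs = "\<lambda>n. \<lambda>(x, t). f x t (?v n t x) (spatial_gradient \<Omega> T (?v n) t x)"
  define D where "D n z = (?fu z - ?fv n z) / e n" for n z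
  have S: "\<Omega> \<times> {0<..<T} \<in> sets lebesgue" using \<Omega> by simp
  have G: "is_spatial_gradient \<Omega> T u ?G" using u by (intro spatial_gradient_works) (simp add: Vp_def)
  have V: "?v n \<in> Vp p \<Omega> T" for n by (rule Vp_diff_curve[OF \<Omega> p T \<eta> u])
  have H: "is_spatial_gradient \<Omega> T (?v n) (?H n)" for n by (rule is_spatial_gradient_diff_curve[OF \<Omega>(1) G \<eta>])
  have sp: "is_spatial_gradient \<Omega> T (?v n) (spatial_gradient \<Omega> T (?v n))" for n
    using V[of n] by (intro spatial_gradient_works) (simp add: Vp_def)
  have fs: "integrable (cyl \<Omega> T) (?fs n)" for n by (rule int[OF V])
  have fu: "integrable (cyl \<Omega> T) ?fu" by (rule int[OF u])
  \<comment> \<open>The hypothesis \<open>int\<close> concerns \<open>?fs\<close>, with the chosen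
    gradient of the competitor, whereas pointwise limits can be taken only in \<open>?fv\<close>,
    with the explicit one.\<close>
  have ae: "AE z in cyl \<Omega> T. ?fs n z = ?fv n z" for n
    using is_spatial_gradient_unique[OF \<Omega>(1) sp H, of n] by eventually_elim (simp add: case_prod_beta)
  have fvm: "?fv n \<in> borel_measurable (cyl \<Omega> T)" for n
    by (rule borel_measurable_lebesgue_on_cong_AE[OF S borel_measurable_integrable[OF fs] ae])
  have fv: "integrable (cyl \<Omega> T) (?fv n)" for n
    by (rule integrable_cong_AE_imp[OF fs fvm]) (use ae[of n] in eventually_elim, simp)
  have en: "energy f \<Omega> T (?v n) = (\<integral>z. ?fv n z \<partial>cyl \<Omega> T)" for n
    unfolding energy_def by (rule integral_cong_AE[OF borel_measurable_integrable[OF fs] fvm ae])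
  have D: "(\<integral>z. D n z \<partial>cyl \<Omega> T) = (energy f \<Omega> T u - energy f \<Omega> T (?v n)) / e n" for n
    unfolding en unfolding D_def energy_def integral_divide_zero Bochner_Integration.integral_diff[OF fu fv] ..
  have Dm: "D n \<in> borel_measurable (cyl \<Omega> T)" for n
    unfolding D_def using fu fvm[of n] by measurable
  have lim: "(\<lambda>n. D n z) \<longlonglongrightarrow> g z" if zs: "z \<in> space (cyl \<Omega> T)" for z
  proof -
    obtain x t where z: "z = (x, t)" "x \<in> \<Omega>" "t \<in> {0<..<T}" using zs by auto
    let ?q = "\<lambda>r. f x t (u t x - r *\<^sub>R \<eta> t x) (?G t x - r *\<^sub>R cgrad (\<eta> t) x)"
    \<comment> \<open>The line runs in direction \<open>- \<eta>\<close>, whence \<open>- g\<close>;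
      \<open>D\<close> subtracts in the opposite order, which restores the sign.\<close>
    have "((\<lambda>h. (?q h - ?q 0) / h) \<longlongrightarrow> - g z) (at 0)"
      using integrand_line_derivative[where f = f and x = x and t = t, OF C1[OF z(2,3)], of "u t x" "\<eta> t x" "?G t x" "cgrad (\<eta> t) x" 0]
      by (simp add: has_field_derivative_iff g_def z(1) algebra_simps)
    moreover have "filterlim e (at 0) sequentially"
      using e by (simp add: filterlim_at)
    ultimately have "(\<lambda>n. (?q (e n) - ?q 0) / e n) \<longlonglongrightarrow> - g z"
      by (rule filterlim_compose)
    from tendsto_minus[OF this] show ?thesis
      by (simp add: D_def z(1) minus_divide_left)
  qed
  have gm: "g \<in> borel_measurable (cyl \<Omega> T)"
    by (rule borel_measurable_LIMSEQ_metric[OF Dm lim])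
  obtain M where M: "M \<ge> 0" "\<And>x t. x \<in> \<Omega> \<Longrightarrow> t \<in> {0..T} \<Longrightarrow> norm (\<eta> t x) \<le> M"
    "\<And>x t. x \<in> \<Omega> \<Longrightarrow> t \<in> {0..T} \<Longrightarrow> norm (cgrad (\<eta> t) x) \<le> M"
    using smooth_test_curves_bounded[OF \<Omega>(2) \<eta>] by blast
  let ?R = "\<lambda>z. \<bar>C\<bar> * M * (1 + 2 powr p * ((\<lambda>(x, t). norm (u t x) powr p + norm (?G t x) powr p) z + 2 * M powr p))"
  have fin: "finite_measure (cyl \<Omega> T)"
    using \<Omega> by (intro finite_measure_lebesgue_on_bounded open_Times bounded_Times) auto
  have R: "integrable (cyl \<Omega> T) ?R"
    using Vp_integrable[OF \<Omega>(1) p u G] fin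
    by (intro integrable_mult_right Bochner_Integration.integrable_add finite_measure.integrable_const)
  have bound: "AE z in cyl \<Omega> T. norm (D n z) \<le> ?R z" for n
  proof (rule AE_I2)
    fix z assume "z \<in> space (cyl \<Omega> T)"
    then obtain x t where z: "z = (x, t)" "x \<in> \<Omega>" "t \<in> {0<..<T}" by auto
    then have "norm (\<eta> t x) \<le> M" "norm (cgrad (\<eta> t) x) \<le> M" using M by auto
    from integrand_difference_quotient_bound[where f = f and x = x and t = t, OF C1[OF z(2,3)] growth[OF z(2,3)] _ e(1)[of n] e(2)[of n] this, of "u t x" "?G t x"] p
    show "norm (D n z) \<le> ?R z" by (simp add: D_def z(1))
  qed
  have limAE: "AE z in cyl \<Omega> T. (\<lambda>n. D n z) \<longlonglongrightarrow> g z" using lim by (rule AE_I2)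
  show "integrable (cyl \<Omega> T) g"
    by (rule integrable_dominated_convergence[OF gm Dm R limAE bound])
  have "(\<lambda>n. \<integral>z. D n z \<partial>cyl \<Omega> T) \<longlonglongrightarrow> (\<integral>z. g z \<partial>cyl \<Omega> T)"
    by (rule integral_dominated_convergence[OF gm Dm R limAE bound])
  then show "(\<lambda>n. (energy f \<Omega> T u - energy f \<Omega> T (?v n)) / e n) \<longlonglongrightarrow> (\<integral>z. g z \<partial>cyl \<Omega> T)"
    by (simp only: D)
qed

theorem lemma2p1:
  fixes \<Omega> :: "(real^'n) set"
    and p T C :: real
    and \<Phi> :: "real^'m \<Rightarrow> real^'m"
    and f :: "real^'n \<Rightarrow> real \<Rightarrow> real^'m \<Rightarrow> real^'n^'m \<Rightarrow> real"
    and u0 :: "real^'n \<Rightarrow> real^'m"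
    and u :: "real \<Rightarrow> real^'n \<Rightarrow> real^'m"
  assumes "open \<Omega>" and "bounded \<Omega>" and "p > 1" and "T > 0"
    and "\<And>v. v \<in> Vp p \<Omega> T \<Longrightarrow> integrable (cyl \<Omega> T) (\<lambda>(x, t). \<Phi> (v t x))"
    and "\<And>v. v \<in> Vp p \<Omega> T \<Longrightarrow>
           integrable (cyl \<Omega> T) (\<lambda>(x, t). f x t (v t x) (spatial_gradient \<Omega> T v t x))"
    and "integrable (lebesgue_on \<Omega>) u0"
    and "\<And>x t. x \<in> \<Omega> \<Longrightarrow> t \<in> {0<..<T} \<Longrightarrow> C1_fun (\<lambda>(v, \<Lambda>). f x t v \<Lambda>)"
    and "\<And>x t v \<Lambda>. x \<in> \<Omega> \<Longrightarrow> t \<in> {0<..<T} \<Longrightarrow>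
           \<bar>f x t v \<Lambda>\<bar> + norm (f_v f x t v \<Lambda>) + norm (f_lam f x t v \<Lambda>)
           \<le> C * (1 + norm v powr p + norm \<Lambda> powr p)"
    and "u \<in> Vp0 p \<Omega> T"
    and "parabolic_minimum p \<Omega> T (energy f \<Omega> T) \<Phi> u0 u"
  shows "weak_solution p \<Omega> T f \<Phi> u0 u"
proof -
  let ?G = "spatial_gradient \<Omega> T u"
  have p: "0 < p" using assms(3) by simp
  have u: "u \<in> Vp p \<Omega> T" and min: "\<And>\<eta>. \<eta> \<in> smooth_test_curves \<Omega> T \<Longrightarrow> (\<forall>x. \<eta> T x = 0) \<Longrightarrow>
        - (\<integral>(x, t). \<Phi> (u t x) \<bullet> vector_derivative (\<lambda>s. \<eta> s x) (at t) \<partial>cyl \<Omega> T) + energy f \<Omega> T u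
        \<le> energy f \<Omega> T (\<lambda>t x. u t x - \<eta> t x) + (\<integral>x. u0 x \<bullet> \<eta> 0 x \<partial>lebesgue_on \<Omega>)"
    using assms(11) by (auto simp: parabolic_minimum_def)
  have main: "integrable (cyl \<Omega> T) g \<and> - A + (\<integral>z. g z \<partial>cyl \<Omega> T) = B"
    if \<eta>: "\<eta> \<in> smooth_test_curves \<Omega> T" and \<eta>T: "\<forall>x. \<eta> T x = 0"
      and A: "A = (\<integral>(x, t). \<Phi> (u t x) \<bullet> vector_derivative (\<lambda>s. \<eta> s x) (at t) \<partial>cyl \<Omega> T)"
      and B: "B = (\<integral>x. u0 x \<bullet> \<eta> 0 x \<partial>lebesgue_on \<Omega>)"
      and g: "g = (\<lambda>(x, t). f_lam f x t (u t x) (?G t x) \<bullet> cgrad (\<eta> t) x + f_v f x t (u t x) (?G t x) \<bullet> \<eta> t x)"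
    for \<eta> A B g
  proof -
    let ?E = "\<lambda>c. energy f \<Omega> T (\<lambda>t x. u t x - c *\<^sub>R \<eta> t x)"
    \<comment> \<open>Minimality tested with \<open>c \<eta>\<close>; \<open>c\<close> may have
      either sign, and the terms linear in the test curve scale by \<open>c\<close>.\<close>
    have E: "energy f \<Omega> T u - ?E c \<le> c * (A + B)" for c
    proof -
      have vd: "vector_derivative (\<lambda>s. c *\<^sub>R \<eta> s x) (at t) = c *\<^sub>R vector_derivative (\<lambda>s. \<eta> s x) (at t)"
        if "t \<in> {0<..<T}" for x t
        using smooth_test_curves_differentiable[OF \<eta> that, of x]
        by (intro vector_derivative_at bounded_linear.has_vector_derivative[OF bounded_linear_scaleR_right])
          (simp add: vector_derivative_works)
      have "(\<integral>(x, t). \<Phi> (u t x) \<bullet> vector_derivative (\<lambda>s. c *\<^sub>R \<eta> s x) (at t) \<partial>cyl \<Omega> T) =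
        (\<integral>z. c * (\<lambda>(x, t). \<Phi> (u t x) \<bullet> vector_derivative (\<lambda>s. \<eta> s x) (at t)) z \<partial>cyl \<Omega> T)"
        by (intro Bochner_Integration.integral_cong) (auto simp: vd)
      also have "\<dots> = c * A" by (simp add: A)
      finally have cA: "(\<integral>(x, t). \<Phi> (u t x) \<bullet> vector_derivative (\<lambda>s. c *\<^sub>R \<eta> s x) (at t) \<partial>cyl \<Omega> T) = c * A" .
      have cB: "(\<integral>x. u0 x \<bullet> (c *\<^sub>R \<eta> 0 x) \<partial>lebesgue_on \<Omega>) = c * B" by (simp add: B)
      have "\<forall>x. c *\<^sub>R \<eta> T x = 0" using \<eta>T by simp
      from min[OF smooth_test_curves_scaleR[OF \<eta>] this] show ?thesis
        unfolding cA cB by (simp add: algebra_simps)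
    qed
    \<comment> \<open>\<open>Suc n\<close> keeps \<open>e n\<close> nonzero and at most 1, as the
      domination of the quotients requires.\<close>
    define e where "e n = inverse (real (Suc n))" for n
    have e: "0 < e n" "e n \<le> 1" "e n \<noteq> 0" "\<bar>e n\<bar> \<le> 1" for n by (auto simp: e_def field_simps)
    have elim: "e \<longlonglongrightarrow> 0" unfolding e_def[abs_def] by (rule LIMSEQ_inverse_real_of_nat)
    then have elim': "(\<lambda>n. - e n) \<longlonglongrightarrow> 0" by (auto dest: tendsto_minus)
    have dir: "integrable (cyl \<Omega> T) g" "(\<lambda>n. (energy f \<Omega> T u - ?E (r n)) / r n) \<longlonglongrightarrow> (\<integral>z. g z \<partial>cyl \<Omega> T)"
      if r: "\<And>n. r n \<noteq> 0" "\<And>n. \<bar>r n\<bar> \<le> 1" "r \<longlonglongrightarrow> 0" for r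
      unfolding g
      by (rule energy_directional_derivative[where f = f and C = C and e = r, OF assms(1,2) p assms(4) _ _ _ u \<eta>];
        use assms(6,8,9) r in blast)+
    have gi: "integrable (cyl \<Omega> T) g" by (rule dir(1)[OF e(3,4) elim])
    have "(\<integral>z. g z \<partial>cyl \<Omega> T) \<le> A + B"
      by (rule LIMSEQ_le_const2[OF dir(2)[OF e(3,4) elim]])
        (use E e(1) in \<open>auto simp: divide_le_eq mult.commute\<close>)
    \<comment> \<open>Division of \<open>E\<close> by the negative number \<open>- e n\<close>
      reverses the inequality, while the quotients keep the same limit.\<close>
    moreover have "A + B \<le> (\<integral>z. g z \<partial>cyl \<Omega> T)"
    proof (rule LIMSEQ_le_const)
      show "(\<lambda>n. (energy f \<Omega> T u - ?E (- e n)) / (- e n)) \<longlonglongrightarrow> (\<integral>z. g z \<partial>cyl \<Omega> T)"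
        by (rule dir(2)) (use e elim' in simp_all)
      have "A + B \<le> (energy f \<Omega> T u - ?E (- e n)) / (- e n)" for n
      proof -
        have neg: "- e n < 0" using e(1) by simp
        show ?thesis
          unfolding neg_le_divide_eq[OF neg] using E[of "- e n"] by (subst mult.commute)
      qed
      then show "\<exists>N. \<forall>n\<ge>N. A + B \<le> (energy f \<Omega> T u - ?E (- e n)) / (- e n)" by blast
    qed
    ultimately show ?thesis using gi by simp
  qed
  \<comment> \<open>The double sum is the Frobenius inner product with the Jacobian of
    \<open>\<eta> t\<close>.\<close>
  have expand: "(\<lambda>(x, t). (\<Sum>i\<in>UNIV. \<Sum>\<alpha>\<in>UNIV. f_lam f x t (u t x) (?G t x) $ i $ \<alpha> *
        frechet_derivative (\<eta> t) (at x) (axis \<alpha> 1) $ i) + (\<Sum>i\<in>UNIV. f_v f x t (u t x) (?G t x) $ i * \<eta> t x $ i)) =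
      (\<lambda>(x, t). f_lam f x t (u t x) (?G t x) \<bullet> cgrad (\<eta> t) x + f_v f x t (u t x) (?G t x) \<bullet> \<eta> t x)" for \<eta>
    by (simp add: inner_vec_def cgrad_def)
  show ?thesis
    unfolding weak_solution_def Let_def expand
    using assms(10) assms(5)[OF u] main by blast
qed

end
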